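(* Let $E$ be an elliptic curve defined over $\mathbb{Q}$ and let $K/\mathbb{Q}$ be a number field with $[K:\mathbb{Q}]=6$. If $E(K)_{\mathrm{tors}}\cong \mathbb{Z}/4\mathbb{Z}\times\mathbb{Z}/12\mathbb{Z}$, then the LMFDB label of $E$ is 162.d2 or 1296.l2; that is, $E$ is isomorphic over $\mathbb{Q}$ to $y^2=x^3+69x+22$ (162.d2) or to $y^2=x^3+69x-22$ (1296.l2). In particular, $j(E)=109503/64$.
   Context: $E(K)_{\mathrm{tors}}$ denotes the torsion subgroup of the group of $K$-rational points of $E$ (base changed to $K$), and $j(E)$ is the $j$-invariant. An LMFDB label denotes a $\mathbb{Q}$-isomorphism class of elliptic curves over $\mathbb{Q}$: the label 162.d2 is the class of $y^2=x^3+69x+22$ (conductor 162), and the label 1296.l2 is the class of $y^2=x^3+69x-22$ (conductor 1296). *)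

theory Defs
  imports Complex_Main "HOL-Algebra.Elementary_Groups"
begin

text \<open>\<open>Weierstrass a1 a2 a3 a4 a6\<close> stands for the plane cubic
  \<open>y\<^sup>2 + a1 x y + a3 y = x\<^sup>3 + a2 x\<^sup>2 + a4 x + a6\<close>.\<close>

datatype 'a weierstrass = Weierstrass (a1: 'a) (a2: 'a) (a3: 'a) (a4: 'a) (a6: 'a)

definition weierstrass_eval :: "'a::comm_ring_1 weierstrass \<Rightarrow> 'a \<Rightarrow> 'a \<Rightarrow> 'a" where
  "weierstrass_eval E x y =
     y^2 + a1 E * x * y + a3 E * y - (x^3 + a2 E * x^2 + a4 E * x + a6 E)"

definition b2 :: "'a::comm_ring_1 weierstrass \<Rightarrow> 'a" where
  "b2 E = (a1 E)^2 + 4 * a2 E"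

definition b4 :: "'a::comm_ring_1 weierstrass \<Rightarrow> 'a" where
  "b4 E = 2 * a4 E + a1 E * a3 E"

definition b6 :: "'a::comm_ring_1 weierstrass \<Rightarrow> 'a" where
  "b6 E = (a3 E)^2 + 4 * a6 E"

definition b8 :: "'a::comm_ring_1 weierstrass \<Rightarrow> 'a" where
  "b8 E = (a1 E)^2 * a6 E + 4 * a2 E * a6 E - a1 E * a3 E * a4 E
            + a2 E * (a3 E)^2 - (a4 E)^2"

definition c4 :: "'a::comm_ring_1 weierstrass \<Rightarrow> 'a" where
  "c4 E = (b2 E)^2 - 24 * b4 E"

definition discriminant :: "'a::comm_ring_1 weierstrass \<Rightarrow> 'a" where
  "discriminant E =
     - ((b2 E)^2 * b8 E) - 8 * (b4 E)^3 - 27 * (b6 E)^2 + 9 * b2 E * b4 E * b6 E"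

text \<open>An elliptic curve over a field is given by a Weierstrass equation with coefficients in that
  field and nonzero discriminant; the base point is the point at infinity.\<close>

definition elliptic_curve :: "'a::field weierstrass \<Rightarrow> bool" where
  "elliptic_curve E \<longleftrightarrow> discriminant E \<noteq> 0"

definition j_invariant :: "'a::field weierstrass \<Rightarrow> 'a" where
  "j_invariant E = (c4 E)^3 / discriminant E"

text \<open>\<open>change_coords u r s t E\<close> is the equation obtained from \<open>E\<close> by the substitution
  \<open>x = u\<^sup>2 x' + r\<close>, \<open>y = u\<^sup>3 y' + s u\<^sup>2 x' + t\<close> and division by \<open>u\<^sup>6\<close>
  (see \<open>weierstrass_eval_change_coords\<close> below).\<close>

definition change_coords ::
    "'a::field \<Rightarrow> 'a \<Rightarrow> 'a \<Rightarrow> 'a \<Rightarrow> 'a weierstrass \<Rightarrow> 'a weierstrass" where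
  "change_coords u r s t E = Weierstrass
     ((a1 E + 2 * s) / u)
     ((a2 E - s * a1 E + 3 * r - s^2) / u^2)
     ((a3 E + r * a1 E + 2 * t) / u^3)
     ((a4 E - s * a3 E + 2 * r * a2 E - (t + r * s) * a1 E + 3 * r^2 - 2 * s * t) / u^4)
     ((a6 E + r * a4 E + r^2 * a2 E + r^3 - t * a3 E - t^2 - r * t * a1 E) / u^6)"

lemma weierstrass_eval_change_coords:
  assumes "u \<noteq> 0"
  shows "weierstrass_eval E (u^2 * x + r) (u^3 * y + s * u^2 * x + t) =
         u^6 * weierstrass_eval (change_coords u r s t E) x y"
  using assms
  by (simp add: weierstrass_eval_def change_coords_def field_simps) algebra

text \<open>The isomorphisms over the field between elliptic curves given by Weierstrass equations are
  precisely these coordinate changes with coefficients in the field.\<close>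

definition isomorphic_curves :: "'a::field weierstrass \<Rightarrow> 'a weierstrass \<Rightarrow> bool" where
  "isomorphic_curves E E' \<longleftrightarrow> (\<exists>u r s t. u \<noteq> 0 \<and> E' = change_coords u r s t E)"

datatype 'a point = Infinity | Affine 'a 'a

definition points :: "'a::field weierstrass \<Rightarrow> 'a point set" where
  "points E = insert Infinity {Affine x y | x y. weierstrass_eval E x y = 0}"

text \<open>Chord-tangent law: \<open>l\<close> is the slope of the line through the two points (of the tangent line if
  they coincide), and the sum is the negative of the third intersection point.\<close>

fun point_add :: "'a::field weierstrass \<Rightarrow> 'a point \<Rightarrow> 'a point \<Rightarrow> 'a point" where
  "point_add E Infinity Q = Q"
| "point_add E P Infinity = P"
| "point_add E (Affine x1 y1) (Affine x2 y2) =
    (if x1 = x2 \<and> y1 + y2 + a1 E * x2 + a3 E = 0 then Infinity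
     else
       let l = (if x1 = x2
                then (3 * x1^2 + 2 * a2 E * x1 + a4 E - a1 E * y1) / (2 * y1 + a1 E * x1 + a3 E)
                else (y2 - y1) / (x2 - x1));
           x3 = l^2 + a1 E * l - a2 E - x1 - x2
       in Affine x3 (- (y1 + l * (x3 - x1)) - a1 E * x3 - a3 E))"

definition point_group :: "'a::field weierstrass \<Rightarrow> 'a point monoid" where
  "point_group E = \<lparr>carrier = points E, monoid.mult = point_add E, one = Infinity\<rparr>"

definition torsion_subgroup :: "'g monoid \<Rightarrow> 'g monoid" where
  "torsion_subgroup G =
     G\<lparr>carrier := {g \<in> carrier G. \<exists>n::nat. n > 0 \<and> g [^]\<^bsub>G\<^esub> n = \<one>\<^bsub>G\<^esub>}\<rparr>"

text \<open>A number field is a type \<open>'k\<close> of characteristic zero whose dimension over the rationals is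
  finite.  Note that \<open>dim\<close> is \<open>0\<close> for infinite-dimensional spaces, so a positive degree entails
  finiteness.\<close>

lemma vector_space_over_rat:
  "vector_space (\<lambda>(q::rat) (x::'k::field_char_0). of_rat q * x)"
  by unfold_locales (simp_all add: of_rat_add of_rat_mult algebra_simps)

definition degree_over_rat :: "'k::field_char_0 itself \<Rightarrow> nat" where
  "degree_over_rat _ = vector_space.dim (\<lambda>(q::rat) (x::'k). of_rat q * x) UNIV"

definition base_change :: "rat weierstrass \<Rightarrow> 'k::field_char_0 weierstrass" where
  "base_change E = map_weierstrass of_rat E"

definition curve_162d2 :: "rat weierstrass" where
  "curve_162d2 = Weierstrass 0 0 0 69 22"

definition curve_1296l2 :: "rat weierstrass" where
  "curve_1296l2 = Weierstrass 0 0 0 69 (- 22)"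

end

theory Submission
  imports Defs "HOL-Computational_Algebra.Nth_Powers"
begin

text \<open>
  Write the curve as \<open>y\<^sup>2 = f(x) = x\<^sup>3 + A x + B\<close> with \<open>A\<close>, \<open>B\<close> rational and roots \<open>e1\<close>, \<open>e2\<close>, \<open>e3\<close> of \<open>f\<close>.
  The torsion hypothesis is used through three consequences. The four-torsion is rational over \<open>K\<close>, so each
  \<open>(e\<^sub>j, 0)\<close> is a double and all differences \<open>e\<^sub>j - e\<^sub>k\<close> are squares in \<open>K\<close>; in particular \<open>K\<close> contains a
  square root \<open>i\<close> of \<open>- 1\<close>. There is a point of order three over \<open>K\<close>. Its abscissa is unique
  (\<open>torsion_four_twelve\<close>).

  The field \<open>K\<close> has degree three over \<open>F = \<rat>(i)\<close>. Hence an element of \<open>K\<close> that is quadratic over \<open>F\<close> lies in \<open>F\<close>,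
  and a quartic over \<open>F\<close> with a root in \<open>K\<close> has a root in \<open>F\<close> (\<open>quadratic_in_F\<close>, \<open>quartic_root_in_F\<close>).
  This has two applications. First, if \<open>f\<close> is irreducible over \<open>F\<close>, then \<open>K\<close> is cyclic over \<open>F\<close>, and uniqueness
  of the abscissa of the three-torsion point makes it invariant under the automorphisms, hence rational; in any
  case the third division polynomial has a rational root \<open>X\<close> (\<open>rational_flex\<close>), so the curve has a rational
  three-isogeny. Secondly, with \<open>z\<^sub>1\<close>, \<open>z\<^sub>2\<close>, \<open>z\<^sub>3\<close> square roots of \<open>e1 - e2\<close>, \<open>e2 - e3\<close>, \<open>e3 - e1\<close> and \<open>r = z\<^sub>1 z\<^sub>2 z\<^sub>3\<close>,
  the sum \<open>z\<^sub>1 + z\<^sub>2 + z\<^sub>3\<close> is a root of \<open>T\<^sup>4 - 8 r T - 12 A\<close>, where \<open>r\<^sup>4 = - 4 A\<^sup>3 - 27 B\<^sup>2\<close>. So \<open>r\<close> is in \<open>F\<close> and the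
  quartic has a root in \<open>F\<close>. Up to powers of \<open>i\<close>, either \<open>r\<close> is rational, or \<open>r = (1 + i) q\<close> with \<open>q\<close> rational.

  If \<open>r\<close> is rational, the roots of \<open>f\<close> are rational and their two smaller gaps are squares of rational numbers.
  Together with the three-isogeny this gives a rational point with \<open>y \<noteq> 0\<close> on the curve 48a1,
  \<open>y\<^sup>2 = x (x - 1) (x - 4)\<close>, and there is none (\<open>three_isogeny_gap_product_not_square\<close>). If \<open>r = (1 + i) q\<close>, there is
  a rational \<open>m\<close> with \<open>m\<^sup>4 + 4 q m + 3 A = 0\<close>. Combined with the parameter \<open>k\<close> of the three-isogeny this gives a
  rational point on the curve \<open>y\<^sup>2 = x\<^sup>3 - 14 x\<^sup>2 + 81 x\<close>, which is isogenous to 48a1 and has rational torsion of order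
  eight and rank zero (\<open>curve_Z8_points\<close>). The eight points leave \<open>k = 32/9\<close>, \<open>- 1/9\<close>, \<open>- 8/3\<close>
  (\<open>genus_one_fibre\<close>). The value \<open>- 1/9\<close> would make \<open>3\<close> a square. For \<open>- 8/3\<close> the cubic \<open>f\<close> is irreducible and
  the points with abscissa \<open>X\<close> have their ordinates outside \<open>K\<close>. The value \<open>32/9\<close> gives
  \<open>(A, B) = (69 u\<^sup>4, \<plusminus> 22 u\<^sup>6)\<close>.

  That 48a1 has no further rational points is an infinite descent in the style of Fermat on
  \<open>M\<^sup>2 = e\<^sup>2 + A\<^sup>2 = 4 e\<^sup>2 + B\<^sup>2\<close> (\<open>no_concordant\<close>).
\<close>

section \<open>Coordinate changes and the chord-tangent law\<close>

fun coords_map :: "'a::field \<Rightarrow> 'a \<Rightarrow> 'a \<Rightarrow> 'a \<Rightarrow> 'a point \<Rightarrow> 'a point" where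
  "coords_map u r s t Infinity = Infinity"
| "coords_map u r s t (Affine x y) = Affine (u^2 * x + r) (u^3 * y + s * u^2 * x + t)"

lemma point_add_Infinity [simp]:
  "point_add E Infinity Q = Q" "point_add E P Infinity = P"
  by (cases P; simp)+

lemma mem_points [simp]:
  "Infinity \<in> points E" "Affine x y \<in> points E \<longleftrightarrow> weierstrass_eval E x y = 0"
  by (auto simp: points_def)

lemma change_coords_sel:
  "a1 (change_coords u r s t E) = (a1 E + 2 * s) / u"
  "a2 (change_coords u r s t E) = (a2 E - s * a1 E + 3 * r - s^2) / u^2"
  "a3 (change_coords u r s t E) = (a3 E + r * a1 E + 2 * t) / u^3"
  "a4 (change_coords u r s t E) =
    (a4 E - s * a3 E + 2 * r * a2 E - (t + r * s) * a1 E + 3 * r^2 - 2 * s * t) / u^4"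
  "a6 (change_coords u r s t E) =
    (a6 E + r * a4 E + r^2 * a2 E + r^3 - t * a3 E - t^2 - r * t * a1 E) / u^6"
  by (simp_all add: change_coords_def)

text \<open>The substitution is affine and maps lines to lines: a slope \<open>l\<close> becomes \<open>u l + s\<close>. Membership in the curve
  matters in the tangent case only, where equal abscissae must force equal ordinates.\<close>

lemma point_add_coords_map:
  fixes u :: "'a::field"
  assumes u: "u \<noteq> 0"
    and P: "P \<in> points (change_coords u r s t E)" and Q: "Q \<in> points (change_coords u r s t E)"
  shows "point_add E (coords_map u r s t P) (coords_map u r s t Q) =
    coords_map u r s t (point_add (change_coords u r s t E) P Q)"
proof (cases P; cases Q)
  fix x1 y1 x2 y2
  assume PQ: "P = Affine x1 y1" "Q = Affine x2 y2"
  define E' where "E' = change_coords u r s t E"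
  define X1 where "X1 = u^2 * x1 + r"
  define X2 where "X2 = u^2 * x2 + r"
  define Y1 where "Y1 = u^3 * y1 + s * u^2 * x1 + t"
  define Y2 where "Y2 = u^3 * y2 + s * u^2 * x2 + t"
  have Xeq: "X1 = X2 \<longleftrightarrow> x1 = x2" using u by (simp add: X1_def X2_def)
  \<comment> \<open>The coefficients of \<open>E\<close> in terms of those of the transformed equation, without division.\<close>
  have e1: "a1 E = u * a1 E' - 2 * s"
    using u by (simp add: E'_def change_coords_sel)
  have e2: "a2 E = u^2 * a2 E' + s * a1 E - 3 * r + s^2"
    using u by (simp add: E'_def change_coords_sel)
  have e3: "a3 E = u^3 * a3 E' - r * a1 E - 2 * t"
    using u by (simp add: E'_def change_coords_sel)
  have e4: "a4 E = u^4 * a4 E' + s * a3 E - 2 * r * a2 E + (t + r * s) * a1 E - 3 * r^2 + 2 * s * t"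
    using u by (simp add: E'_def change_coords_sel)
  have vert: "Y1 + Y2 + a1 E * X2 + a3 E = u^3 * (y1 + y2 + a1 E' * x2 + a3 E')" if "x1 = x2"
    unfolding X2_def Y1_def Y2_def e3 e1 that by algebra
  define L where "L = (if X1 = X2
                then (3 * X1^2 + 2 * a2 E * X1 + a4 E - a1 E * Y1) / (2 * Y1 + a1 E * X1 + a3 E)
                else (Y2 - Y1) / (X2 - X1))"
  define l where "l = (if x1 = x2
                then (3 * x1^2 + 2 * a2 E' * x1 + a4 E' - a1 E' * y1) / (2 * y1 + a1 E' * x1 + a3 E')
                else (y2 - y1) / (x2 - x1))"
  show ?thesis
  proof (cases "x1 = x2 \<and> y1 + y2 + a1 E' * x2 + a3 E' = 0")
    case True
    then have F: "X1 = X2 \<and> Y1 + Y2 + a1 E * X2 + a3 E = 0" using vert Xeq by simp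
    show ?thesis
      unfolding PQ coords_map.simps E'_def[symmetric]
      by (simp only: X1_def[symmetric] X2_def[symmetric] Y1_def[symmetric] Y2_def[symmetric]
          point_add.simps if_P[OF F] if_P[OF True] coords_map.simps)
  next
    case False
    then have F: "\<not> (X1 = X2 \<and> Y1 + Y2 + a1 E * X2 + a3 E = 0)" using vert u Xeq by auto
    have L: "L = u * l + s"
    proof (cases "x1 = x2")
      case True
      have "(y1 - y2) * (y1 + y2 + a1 E' * x2 + a3 E') = 0"
      proof -
        have "weierstrass_eval E' x1 y1 = 0" "weierstrass_eval E' x2 y2 = 0"
          using P Q PQ by (simp_all add: E'_def)
        then show ?thesis using True unfolding weierstrass_eval_def by algebra
      qed
      with True False have yy: "y1 = y2" by auto
      define d where "d = 2 * y1 + a1 E' * x1 + a3 E'"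
      define n where "n = 3 * x1^2 + 2 * a2 E' * x1 + a4 E' - a1 E' * y1"
      have d: "d \<noteq> 0" using False True yy by (simp add: d_def algebra_simps)
      have D: "2 * Y1 + a1 E * X1 + a3 E = u^3 * d"
        unfolding d_def X1_def Y1_def e3 e1 by algebra
      have N: "3 * X1^2 + 2 * a2 E * X1 + a4 E - a1 E * Y1 = u^4 * n + s * u^3 * d"
        unfolding d_def n_def X1_def Y1_def e4 e3 e2 e1 by algebra
      have "L = (u^4 * n + s * u^3 * d) / (u^3 * d)"
        unfolding L_def if_P[OF Xeq[THEN iffD2, OF True]] N D ..
      moreover have "l = n / d"
        unfolding l_def if_P[OF True] n_def d_def ..
      ultimately show ?thesis using u d by (simp add: add_divide_distrib power_numeral_reduce)
    next
      case False
      then have "x2 - x1 \<noteq> 0" by simp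
      moreover have "X2 - X1 = u^2 * (x2 - x1)" "Y2 - Y1 = u^3 * (y2 - y1) + s * u^2 * (x2 - x1)"
        by (simp_all add: X1_def X2_def Y1_def Y2_def algebra_simps)
      ultimately show ?thesis using False Xeq u
        by (simp add: L_def l_def add_divide_distrib power_numeral_reduce)
    qed
    define x3 where "x3 = l^2 + a1 E' * l - a2 E' - x1 - x2"
    define X3 where "X3 = L^2 + a1 E * L - a2 E - X1 - X2"
    have X3: "X3 = u^2 * x3 + r"
      unfolding X3_def x3_def L X1_def X2_def e2 e1 by algebra
    have Y3: "- (Y1 + L * (X3 - X1)) - a1 E * X3 - a3 E =
        u^3 * (- (y1 + l * (x3 - x1)) - a1 E' * x3 - a3 E') + s * u^2 * x3 + t"
      unfolding X3 L X1_def Y1_def e3 e1 by algebra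
    have A: "point_add E (Affine X1 Y1) (Affine X2 Y2) =
        Affine X3 (- (Y1 + L * (X3 - X1)) - a1 E * X3 - a3 E)"
      using F by (simp only: point_add.simps if_not_P if_False Let_def L_def[symmetric] X3_def[symmetric])
    have B: "point_add E' (Affine x1 y1) (Affine x2 y2) =
        Affine x3 (- (y1 + l * (x3 - x1)) - a1 E' * x3 - a3 E')"
      using False by (simp only: point_add.simps if_not_P if_False Let_def l_def[symmetric] x3_def[symmetric])
    show ?thesis
      unfolding PQ coords_map.simps E'_def[symmetric] B
      by (simp only: X1_def[symmetric] X2_def[symmetric] Y1_def[symmetric] Y2_def[symmetric] A coords_map.simps)
        (simp only: X3 Y3[unfolded X3])
  qed
qed simp_all

lemma coords_map_mem_points:
  assumes "u \<noteq> 0"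
  shows "coords_map u r s t P \<in> points E \<longleftrightarrow> P \<in> points (change_coords u r s t E)"
  using assms by (cases P) (simp_all add: weierstrass_eval_change_coords)

lemma bij_betw_coords_map:
  assumes u: "u \<noteq> 0"
  shows "bij_betw (coords_map u r s t) (points (change_coords u r s t E)) (points E)"
proof (rule bij_betwI')
  fix P Q
  show "coords_map u r s t P = coords_map u r s t Q \<longleftrightarrow> P = Q"
    using u by (cases P; cases Q) auto
next
  fix P assume "P \<in> points (change_coords u r s t E)"
  then show "coords_map u r s t P \<in> points E" using u by (simp add: coords_map_mem_points)
next
  fix Q assume Q: "Q \<in> points E"
  have "\<exists>P. coords_map u r s t P = Q"
  proof (cases Q)
    case Infinity
    then show ?thesis by (intro exI[of _ Infinity]) simp
  next
    case (Affine x y)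
    then show ?thesis using u
      by (intro exI[of _ "Affine ((x - r) / u^2) ((y - s * (x - r) - t) / u^3)"]) simp
  qed
  then show "\<exists>P\<in>points (change_coords u r s t E). Q = coords_map u r s t P"
    using Q u by (metis coords_map_mem_points)
qed

text \<open>On the line through the two points the equation of the curve becomes a monic cubic in the abscissa with
  the two given abscissae as roots; the formula for \<open>x3\<close> is the sum of the roots.\<close>

lemma point_add_closed:
  fixes E :: "'a::field weierstrass"
  assumes "P \<in> points E" "Q \<in> points E"
  shows "point_add E P Q \<in> points E"
proof (cases P; cases Q)
  fix x1 y1 x2 y2
  assume PQ: "P = Affine x1 y1" "Q = Affine x2 y2"
  show ?thesis
  proof (cases "x1 = x2 \<and> y1 + y2 + a1 E * x2 + a3 E = 0")
    case True
    then show ?thesis using PQ by simp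
  next
    case False
    define l where "l = (if x1 = x2
                then (3 * x1^2 + 2 * a2 E * x1 + a4 E - a1 E * y1) / (2 * y1 + a1 E * x1 + a3 E)
                else (y2 - y1) / (x2 - x1))"
    define x3 where "x3 = l^2 + a1 E * l - a2 E - x1 - x2"
    define y3 where "y3 = - (y1 + l * (x3 - x1)) - a1 E * x3 - a3 E"
    have sum: "point_add E P Q = Affine x3 y3"
      using False
      by (simp only: PQ point_add.simps if_not_P if_False Let_def l_def[symmetric] x3_def[symmetric] y3_def[symmetric])
    have c1: "y1^2 + a1 E * x1 * y1 + a3 E * y1 = x1^3 + a2 E * x1^2 + a4 E * x1 + a6 E"
      and c2: "y2^2 + a1 E * x2 * y2 + a3 E * y2 = x2^3 + a2 E * x2^2 + a4 E * x2 + a6 E"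
      using assms PQ by (simp_all add: weierstrass_eval_def)
    have "weierstrass_eval E x3 y3 = 0"
    proof (cases "x1 = x2")
      case True
      have "(y1 - y2) * (y1 + y2 + a1 E * x2 + a3 E) = 0"
        using c1 c2 True by algebra
      with True False have "y1 = y2" by auto
      with True False have "2 * y1 + a1 E * x1 + a3 E \<noteq> 0" by (auto simp: algebra_simps)
      then have "l * (2 * y1 + a1 E * x1 + a3 E) = 3 * x1^2 + 2 * a2 E * x1 + a4 E - a1 E * y1"
        using True by (simp add: l_def)
      then show ?thesis
        using c1 True unfolding weierstrass_eval_def y3_def x3_def by algebra
    next
      case False
      then have "l * (x2 - x1) = y2 - y1" by (simp add: l_def)
      then have "(x2 - x1) * weierstrass_eval E x3 y3 = 0"
        using c1 c2 unfolding weierstrass_eval_def y3_def x3_def by algebra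
      then show ?thesis using False by simp
    qed
    then show ?thesis using sum by simp
  qed
qed (use assms in simp_all)

lemma point_group_sel [simp]:
  "carrier (point_group E) = points E" "P \<otimes>\<^bsub>point_group E\<^esub> Q = point_add E P Q"
  "\<one>\<^bsub>point_group E\<^esub> = Infinity"
  by (simp_all add: point_group_def)

lemma point_pow_0 [simp]: "P [^]\<^bsub>point_group E\<^esub> (0::nat) = Infinity"
  and point_pow_Suc [simp]:
    "P [^]\<^bsub>point_group E\<^esub> Suc n = point_add E (P [^]\<^bsub>point_group E\<^esub> n) P"
  by (simp_all add: nat_pow_def)

lemma point_pow_closed:
  "P \<in> points E \<Longrightarrow> P [^]\<^bsub>point_group E\<^esub> (n::nat) \<in> points E"
  by (induction n) (simp_all add: point_add_closed)

lemma point_pow_coords_map: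
  assumes "u \<noteq> 0" "P \<in> points (change_coords u r s t E)"
  shows "(coords_map u r s t P) [^]\<^bsub>point_group E\<^esub> (n::nat) =
    coords_map u r s t (P [^]\<^bsub>point_group (change_coords u r s t E)\<^esub> n)"
  using assms by (induction n) (simp_all add: point_add_coords_map point_pow_closed)

lemma torsion_subgroup_sel [simp]:
  "carrier (torsion_subgroup G) = {g \<in> carrier G. \<exists>n::nat. n > 0 \<and> g [^]\<^bsub>G\<^esub> n = \<one>\<^bsub>G\<^esub>}"
  "P \<otimes>\<^bsub>torsion_subgroup G\<^esub> Q = P \<otimes>\<^bsub>G\<^esub> Q" "\<one>\<^bsub>torsion_subgroup G\<^esub> = \<one>\<^bsub>G\<^esub>"
  by (simp_all add: torsion_subgroup_def)

text \<open>This transports the hypothesis on the torsion to the short equation.\<close>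

lemma torsion_subgroup_change_coords_iso:
  assumes u: "u \<noteq> 0"
  shows "torsion_subgroup (point_group (change_coords u r s t E)) \<cong> torsion_subgroup (point_group E)"
proof -
  let ?E' = "change_coords u r s t E"
  let ?T' = "carrier (torsion_subgroup (point_group ?E'))"
  let ?T = "carrier (torsion_subgroup (point_group E))"
  have bij: "bij_betw (coords_map u r s t) (points ?E') (points E)"
    using u by (rule bij_betw_coords_map)
  have inf: "coords_map u r s t P = Infinity \<longleftrightarrow> P = Infinity" for P
    by (cases P) simp_all
  have mem: "P \<in> ?T' \<longleftrightarrow> coords_map u r s t P \<in> ?T" if "P \<in> points ?E'" for P
    using that u by (simp add: coords_map_mem_points point_pow_coords_map inf)
  have T': "?T' \<subseteq> points ?E'" and T: "?T \<subseteq> points E" by auto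
  have im: "coords_map u r s t ` ?T' = ?T"
  proof (intro equalityI subsetI)
    fix Q assume "Q \<in> coords_map u r s t ` ?T'"
    then obtain P where "P \<in> ?T'" "Q = coords_map u r s t P" by (rule imageE)
    with mem[OF subsetD[OF T']] show "Q \<in> ?T" by (simp only:)
  next
    fix Q assume Q: "Q \<in> ?T"
    then have "Q \<in> coords_map u r s t ` points ?E'"
      using T bij_betw_imp_surj_on[OF bij] by (simp only: subset_iff)
    then obtain P where P: "P \<in> points ?E'" "Q = coords_map u r s t P" by (rule imageE)
    then have "P \<in> ?T'" using Q mem by (simp only:)
    then show "Q \<in> coords_map u r s t ` ?T'" using P(2) by (rule rev_image_eqI)
  qed
  have "bij_betw (coords_map u r s t) ?T' ?T"
    by (rule bij_betw_subset[OF bij T' im])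
  moreover have "coords_map u r s t \<in> hom (torsion_subgroup (point_group ?E')) (torsion_subgroup (point_group E))"
  proof (rule homI)
    fix P Q assume "P \<in> ?T'" "Q \<in> ?T'"
    then show "coords_map u r s t (P \<otimes>\<^bsub>torsion_subgroup (point_group ?E')\<^esub> Q) =
        coords_map u r s t P \<otimes>\<^bsub>torsion_subgroup (point_group E)\<^esub> coords_map u r s t Q"
      using T' u by (simp add: point_add_coords_map)
  qed (use im in blast)
  ultimately show ?thesis by (intro is_isoI isoI)
qed

lemma point_add_chord:
  assumes "x1 \<noteq> x2" "l * (x2 - x1) = y2 - y1"
    and "x3 = l^2 + a1 E * l - a2 E - x1 - x2" "y3 = - (y1 + l * (x3 - x1)) - a1 E * x3 - a3 E"
  shows "point_add E (Affine x1 y1) (Affine x2 y2) = Affine x3 y3"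
proof -
  have "(y2 - y1) / (x2 - x1) = l"
    using assms(1,2) by (simp add: nonzero_divide_eq_eq)
  then show ?thesis using assms(1,3,4) by (simp add: Let_def)
qed

lemma point_add_tangent:
  assumes "2 * y1 + a1 E * x1 + a3 E \<noteq> 0"
    and "l * (2 * y1 + a1 E * x1 + a3 E) = 3 * x1^2 + 2 * a2 E * x1 + a4 E - a1 E * y1"
    and "x3 = l^2 + a1 E * l - a2 E - 2 * x1" "y3 = - (y1 + l * (x3 - x1)) - a1 E * x3 - a3 E"
  shows "point_add E (Affine x1 y1) (Affine x1 y1) = Affine x3 y3"
proof -
  have "2 * y1 + a1 E * x1 + a3 E = y1 + y1 + a1 E * x1 + a3 E"
    unfolding mult_2 ..
  with assms(1) have "\<not> (x1 = x1 \<and> y1 + y1 + a1 E * x1 + a3 E = 0)"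
    by (simp only: simp_thms not_False_eq_True)
  note generic = if_not_P[OF this]
  have slope: "(3 * x1^2 + 2 * a2 E * x1 + a4 E - a1 E * y1) / (2 * y1 + a1 E * x1 + a3 E) = l"
    unfolding assms(2)[symmetric] by (rule nonzero_mult_div_cancel_right[OF assms(1)])
  have x3: "l^2 + a1 E * l - a2 E - x1 - x1 = x3"
    unfolding assms(3) mult_2 by (simp only: diff_diff_eq add.assoc)
  show ?thesis
    unfolding point_add.simps generic Let_def by (simp only: refl if_True slope x3 assms(4))
qed

section \<open>Doubling and torsion points\<close>

lemma point_add_commute:
  fixes E :: "'a::field weierstrass"
  assumes "P \<in> points E" "Q \<in> points E"
  shows "point_add E P Q = point_add E Q P"
proof (cases P; cases Q)
  fix x1 y1 x2 y2
  assume PQ: "P = Affine x1 y1" "Q = Affine x2 y2"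
  show ?thesis
  proof (cases "x1 = x2")
    case True
    have "weierstrass_eval E x1 y1 = 0" "weierstrass_eval E x2 y2 = 0"
      using assms PQ by simp_all
    then have "(y1 - y2) * (y1 + y2 + a1 E * x2 + a3 E) = 0"
      using True unfolding weierstrass_eval_def by algebra
    then consider "y1 = y2" | "y1 + y2 + a1 E * x2 + a3 E = 0" by auto
    then show ?thesis
    proof cases
      case 2
      then have "y2 + y1 + a1 E * x2 + a3 E = 0" by (simp only: add.commute[of y2 y1])
      with 2 show ?thesis unfolding PQ True by simp
    qed (simp add: PQ True)
  next
    case False
    define l where "l = (y2 - y1) / (x2 - x1)"
    have l: "l * (x2 - x1) = y2 - y1" using False by (simp add: l_def)
    define x3 where "x3 = l^2 + a1 E * l - a2 E - x1 - x2"
    have "point_add E (Affine x1 y1) (Affine x2 y2) = Affine x3 (- (y1 + l * (x3 - x1)) - a1 E * x3 - a3 E)"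
      by (rule point_add_chord[OF False l x3_def refl])
    moreover have "point_add E (Affine x2 y2) (Affine x1 y1) = Affine x3 (- (y1 + l * (x3 - x1)) - a1 E * x3 - a3 E)"
    proof (rule point_add_chord)
      show "l * (x1 - x2) = y1 - y2" using l by algebra
      show "x3 = l^2 + a1 E * l - a2 E - x2 - x1" unfolding x3_def by algebra
      show "- (y1 + l * (x3 - x1)) - a1 E * x3 - a3 E = - (y2 + l * (x3 - x2)) - a1 E * x3 - a3 E"
        using l by algebra
    qed (use False in simp)
    ultimately show ?thesis using PQ by simp
  qed
qed simp_all

text \<open>A point \<open>(u, v)\<close> with \<open>u \<noteq> 0\<close> of the curve \<open>y\<^sup>2 + c x y + d y = x\<^sup>3 + b x\<^sup>2\<close> is described by
  \<open>k = v / u\<close> and \<open>t = d / u\<close>: in these terms the equation gives \<open>b\<close> as a polynomial in \<open>u\<close>, \<open>k\<close>,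
  \<open>t\<close>, \<open>c\<close>, so that the group law needs no reduction modulo the equation.\<close>

lemma add_tangent_origin:
  fixes E :: "'a::field weierstrass"
  assumes "u \<noteq> 0" "a3 E = t * u" "a2 E = k^2 + a1 E * k + t * k - u"
  shows "point_add E (Affine u (k * u)) (Affine 0 0) = Affine (- (t * k)) (t * (k^2 + a1 E * k - u))"
  apply (rule point_add_chord[where l = k])
  subgoal by fact
  subgoal by simp
  subgoal unfolding assms by simp
  subgoal unfolding assms by algebra
  done

text \<open>The case of \<open>point_add_double\<close> in which \<open>Q\<close> is the origin and the tangent at \<open>Q\<close> is the line \<open>y = 0\<close>, which
  makes the addition of \<open>Q\<close> the short formula \<open>add_tangent_origin\<close>.\<close>

lemma add_double_tangent_origin:
  fixes E :: "'a::field weierstrass"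
  assumes E: "a4 E = 0" "a6 E = 0" "a3 E \<noteq> 0"
    and P: "P \<in> points E"
  defines "Q \<equiv> Affine 0 0"
  shows "point_add E (point_add E P Q) Q = point_add E P (point_add E Q Q)"
proof (cases P)
  case Infinity
  then show ?thesis by simp
next
  case (Affine x y)
  define b where "b = a2 E"
  define c where "c = a1 E"
  define d where "d = a3 E"
  note bcd = b_def[symmetric] c_def[symmetric] d_def[symmetric]
  have d: "d \<noteq> 0" using E by (simp add: d_def)
  have eq: "y^2 + c * x * y + d * y = x^3 + b * x^2"
    using P Affine E by (simp add: weierstrass_eval_def bcd)
  have Q: "Q \<in> points E" using E by (simp add: Q_def weierstrass_eval_def)
  have QQ: "point_add E Q Q = Affine (- b) (c * b - d)"
    unfolding Q_def by (rule point_add_tangent[where l = 0]) (use E d in \<open>simp_all add: bcd\<close>)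
  show ?thesis
  proof (cases "x = 0")
    case True
    then have "y * (y + d) = 0" using eq by algebra
    then consider "y = 0" | "y = - d" by (auto simp: add_eq_0_iff2)
    then show ?thesis
    proof cases
      case 1
      then have "P = Q" using Affine True by (simp add: Q_def)
      then show ?thesis using Q by (simp add: point_add_commute point_add_closed)
    next
      case 2
      have "point_add E P Q = Infinity"
        unfolding Affine Q_def using True 2 by (simp add: bcd)
      moreover have "point_add E P (Affine (- b) (c * b - d)) = Q"
      proof (cases "b = 0")
        case b: True
        have D: "2 * (- d) + c * 0 + d = - d" by algebra
        have "point_add E (Affine 0 (- d)) (Affine 0 (- d)) = Affine 0 0"
        proof (rule point_add_tangent[where l = "- c"], unfold bcd D E b)
          show "- d \<noteq> 0" using d by simp
        qed (simp_all add: power2_eq_square)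
        then show ?thesis unfolding Affine Q_def True 2 b by simp
      next
        case False
        show ?thesis unfolding Affine Q_def True 2
          by (rule point_add_chord[where l = "- c"])
            (use False in \<open>simp_all add: bcd power2_eq_square\<close>)
      qed
      ultimately show ?thesis using QQ by simp
    qed
  next
    case x: False
    define l where "l = y / x"
    define t where "t = d / x"
    have y: "y = l * x" and dt: "d = t * x" using x by (simp_all add: l_def t_def)
    have t: "t \<noteq> 0" using d x by (simp add: t_def)
    have "x^2 * (l^2 + c * l + t * l - x) = x^2 * b"
      using eq unfolding y dt by algebra
    then have b: "b = l^2 + c * l + t * l - x" using x by simp
    define g where "g = l^2 + c * l - x"
    have PQ: "point_add E P Q = Affine (- (t * l)) (t * g)"
      unfolding Affine Q_def y g_def c_def
      by (rule add_tangent_origin) (use x dt b in \<open>simp_all add: bcd\<close>)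
    show ?thesis
    proof (cases "l = 0")
      case True
      then have "point_add E (point_add E P Q) Q = Infinity"
        unfolding PQ using True by (simp add: Q_def bcd g_def dt)
      moreover have "point_add E P (Affine (- b) (c * b - d)) = Infinity"
        unfolding Affine y using True b by (simp add: bcd)
      ultimately show ?thesis using QQ by simp
    next
      case l: False
      define k where "k = - g / l"
      define v where "v = - x / l"
      have g: "g = - (k * l)" and xv: "x = - (v * l)" using l by (simp_all add: k_def v_def)
      have c: "c * l = - (k * l) - l^2 - v * l" using g xv unfolding g_def by algebra
      have "l * c = l * (- k - l - v)" using c by algebra
      then have c: "c = - k - l - v" using l by simp
      have LHS: "point_add E (point_add E P Q) Q = Affine (- (v * k)) (v * (k^2 + c * k + t * l))"
      proof -
        have "point_add E P Q = Affine (- (t * l)) (k * - (t * l))" unfolding PQ g by simp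
        moreover have "point_add E (Affine (- (t * l)) (k * - (t * l))) (Affine 0 0) =
            Affine (- (v * k)) (v * (k^2 + a1 E * k - (- (t * l))))"
        proof (rule add_tangent_origin, unfold bcd)
          show "d = v * - (t * l)" unfolding dt xv by algebra
          show "b = k^2 + c * k + v * k - (- (t * l))" unfolding b xv c by algebra
        qed (use t l in simp)
        ultimately show ?thesis by (simp only: Q_def bcd diff_minus_eq_add)
      qed
      \<comment> \<open>The chord or tangent through \<open>P\<close> and \<open>2 Q\<close> has slope \<open>- v - c\<close>.\<close>
      have "point_add E P (Affine (- b) (c * b - d)) = Affine (- (v * k)) (v * (k^2 + c * k + t * l))"
      proof (cases "x = - b")
        case True
        have "l * (l + c + t) = 0" using True unfolding b by algebra
        then have "l + c + t = 0" using l by simp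
        then have tt: "t = k + v" unfolding c by algebra
        have "c * b - d = y" unfolding y dt b xv c tt by algebra
        moreover have "point_add E (Affine x y) (Affine x y) = Affine (- (v * k)) (v * (k^2 + c * k + t * l))"
        proof (rule point_add_tangent[where l = "- v - c"], unfold bcd E)
          have "2 * y + c * x + d = l * x" unfolding y dt xv c tt by algebra
          then show "2 * y + c * x + d \<noteq> 0" using l x by simp
          show "(- v - c) * (2 * y + c * x + d) = 3 * x^2 + 2 * b * x + 0 - c * y"
            unfolding y dt b xv c tt by algebra
          show "- (v * k) = (- v - c)^2 + c * (- v - c) - b - 2 * x"
            unfolding b xv c tt by algebra
          show "v * (k^2 + c * k + t * l) = - (y + (- v - c) * (- (v * k) - x)) - c * - (v * k) - d"
            unfolding y dt b xv c tt by algebra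
        qed
        ultimately show ?thesis unfolding Affine using True by simp
      next
        case False
        show ?thesis unfolding Affine
        proof (rule point_add_chord[where l = "- v - c"], unfold bcd)
          show "x \<noteq> - b" by fact
          show "(- v - c) * (- b - x) = c * b - d - y" unfolding y dt b xv c by algebra
          show "- (v * k) = (- v - c)^2 + c * (- v - c) - b - x - (- b)"
            unfolding b xv c by algebra
          show "v * (k^2 + c * k + t * l) = - (y + (- v - c) * (- (v * k) - x)) - c * - (v * k) - d"
            unfolding y dt b xv c by algebra
        qed
      qed
      then show ?thesis using LHS QQ by simp
    qed
  qed
qed

text \<open>The instance of associativity on which the treatment of torsion rests: a coordinate change moves \<open>Q\<close> to the
  origin and its tangent to \<open>y = 0\<close>.\<close>

lemma point_add_double:
  fixes E :: "'a::field weierstrass"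
  assumes P: "P \<in> points E" and Q: "Q \<in> points E" and QQ: "point_add E Q Q \<noteq> Infinity"
  shows "point_add E (point_add E P Q) Q = point_add E P (point_add E Q Q)"
proof (cases Q)
  case Infinity
  then show ?thesis by simp
next
  case (Affine p q)
  define D where "D = 2 * q + a1 E * p + a3 E"
  define N where "N = 3 * p^2 + 2 * a2 E * p + a4 E - a1 E * q"
  define l where "l = N / D"
  have "q + q + a1 E * p + a3 E = D" unfolding D_def mult_2 ..
  then have D: "D \<noteq> 0" using QQ Affine by auto
  then have l: "l * D = N" by (simp add: l_def)
  define E' where "E' = change_coords 1 p l q E"
  define f where "f = coords_map 1 p l q"
  have "a4 E' = N - l * D"
    unfolding E'_def change_coords_sel N_def D_def power_one div_by_1 by algebra
  then have "a4 E' = 0" using l by simp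
  moreover have "a6 E' = 0"
  proof -
    have "weierstrass_eval E p q = 0" using Q Affine by simp
    then show ?thesis unfolding E'_def change_coords_sel weierstrass_eval_def by (simp, algebra)
  qed
  moreover have "a3 E' \<noteq> 0"
  proof -
    have "a3 E' = D" unfolding E'_def change_coords_sel D_def power_one div_by_1 by algebra
    then show ?thesis using D by simp
  qed
  ultimately have add: "point_add E' (point_add E' R (Affine 0 0)) (Affine 0 0) =
      point_add E' R (point_add E' (Affine 0 0) (Affine 0 0))" if "R \<in> points E'" for R
    using that by (rule add_double_tangent_origin)
  have f: "point_add E (f R) (f S) = f (point_add E' R S)" if "R \<in> points E'" "S \<in> points E'" for R S
    using point_add_coords_map[of 1 R p l q E S] that by (simp add: f_def E'_def)
  have fQ: "Q = f (Affine 0 0)" using Affine by (simp add: f_def)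
  then have Q': "Affine 0 0 \<in> points E'"
    using Q coords_map_mem_points[of 1 p l q "Affine 0 0" E] by (simp add: f_def E'_def)
  obtain P' where P': "P' \<in> points E'" "P = f P'"
    using P bij_betw_imp_surj_on[OF bij_betw_coords_map[of 1 p l q E]]
    unfolding f_def E'_def by auto
  show ?thesis
    unfolding fQ P'(2) using P'(1) Q' by (simp only: f add point_add_closed)
qed

abbreviation torsion_points :: "'a::field weierstrass \<Rightarrow> 'a point set" where
  "torsion_points E \<equiv> carrier (torsion_subgroup (point_group E))"

text \<open>By \<open>point_add_double\<close> the powers of \<open>2 P\<close> are the even powers of \<open>P\<close>, and these are periodic.\<close>

lemma torsion_points_double:
  fixes E :: "'a::field weierstrass"
  assumes "P \<in> torsion_points E"
  shows "point_add E P P \<in> torsion_points E"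
proof (cases "point_add E P P = Infinity")
  case True
  then show ?thesis by (simp, intro exI[of _ 1]) simp
next
  case False
  let ?pow = "\<lambda>P n::nat. P [^]\<^bsub>point_group E\<^esub> n"
  from assms obtain n where P: "P \<in> points E" and n: "n > 0" "?pow P n = Infinity" by auto
  have double: "?pow (point_add E P P) m = ?pow P (2 * m)" for m
    using P False by (induction m) (simp_all add: point_add_double point_pow_closed)
  have "?pow P (n + k) = ?pow P k" for k
    using n by (induction k) simp_all
  then have "?pow (point_add E P P) n = Infinity" unfolding double mult_2 using n by simp
  then show ?thesis using P n by (auto simp: point_add_closed)
qed

text \<open>On a curve with \<open>a1 = a3 = 0\<close> the negative of a point is its image under
  \<open>(x, y) \<mapsto> (x, - y)\<close>, the coordinate change with \<open>u = - 1\<close>.\<close>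

definition point_neg :: "'a::field point \<Rightarrow> 'a point" where
  "point_neg = coords_map (- 1) 0 0 0"

lemma point_neg_simps [simp]:
  "point_neg Infinity = Infinity" "point_neg (Affine x y) = Affine x (- y)"
  by (simp_all add: point_neg_def)

lemma point_neg_mem_points:
  assumes "a1 E = 0" "a3 E = 0" "P \<in> points E"
  shows "point_neg P \<in> points E"
  using assms by (cases P) (simp_all add: weierstrass_eval_def)

lemma point_add_neg:
  assumes "a1 E = 0" "a3 E = 0"
  shows "point_add E P (point_neg P) = Infinity" "point_add E (point_neg P) P = Infinity"
  using assms by (cases P; simp)+

lemma point_neg_add:
  fixes E :: "'a::field weierstrass"
  assumes E: "a1 E = 0" "a3 E = 0" and "P \<in> points E" "Q \<in> points E"
  shows "point_add E (point_neg P) (point_neg Q) = point_neg (point_add E P Q)"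
proof -
  have "change_coords (- 1) 0 0 0 E = E"
    using E by (cases E) (simp add: change_coords_def)
  then show ?thesis
    using point_add_coords_map[of "- 1" P 0 0 0 E Q] assms by (simp add: point_neg_def)
qed

lemma torsion_points_neg:
  fixes E :: "'a::field weierstrass"
  assumes E: "a1 E = 0" "a3 E = 0" and P: "P \<in> torsion_points E"
  shows "point_neg P \<in> torsion_points E"
proof -
  have "P \<in> points E" using P by simp
  then have "(point_neg P) [^]\<^bsub>point_group E\<^esub> n = point_neg (P [^]\<^bsub>point_group E\<^esub> n)" for n :: nat
    by (induction n) (simp_all add: point_neg_add point_pow_closed E)
  then show ?thesis using P E by (auto simp: point_neg_mem_points)
qed

text \<open>The doubling formula with denominators cleared, for use in the halving criterion that follows.\<close>

lemma point_double_short: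
  fixes A B :: "'a::field_char_0"
  assumes "point_add (Weierstrass 0 0 0 A B) (Affine x y) (Affine x y) = Affine u v"
  shows "y \<noteq> 0" "u * (2 * y)^2 = (3 * x^2 + A)^2 - 2 * x * (2 * y)^2"
proof -
  show y: "y \<noteq> 0" using assms by auto
  define l where "l = (3 * x^2 + A) / (2 * y)"
  have l: "l * (2 * y) = 3 * x^2 + A" using y by (simp add: l_def)
  have "point_add (Weierstrass 0 0 0 A B) (Affine x y) (Affine x y) =
      Affine (l^2 - 2 * x) (- (y + l * (l^2 - 2 * x - x)))"
    by (rule point_add_tangent[where l = l]) (use y l in simp_all)
  then have u: "u = l^2 - 2 * x" using assms by simp
  show "u * (2 * y)^2 = (3 * x^2 + A)^2 - 2 * x * (2 * y)^2"
    unfolding u l[symmetric] by algebra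
qed

text \<open>The abscissa of \<open>2 (x, y)\<close> minus \<open>e2\<close> has the numerator \<open>(x - e2)\<^sup>2 - (e2 - e1) (e2 - e3)\<close> squared over
  \<open>(2 y)\<^sup>2\<close>, because translation by the point \<open>(e2, 0)\<close> of order two preserves it.\<close>

lemma difference_of_roots_is_square:
  fixes A B :: "'a::field_char_0"
  assumes sum: "e1 + e2 + e3 = 0" and A: "A = e1 * e2 + e1 * e3 + e2 * e3" and B: "B = - (e1 * e2 * e3)"
    and P: "Affine x y \<in> points (Weierstrass 0 0 0 A B)"
    and half: "point_add (Weierstrass 0 0 0 A B) (Affine x y) (Affine x y) = Affine e1 0"
  shows "\<exists>z. z^2 = e1 - e2"
proof -
  have e3: "e3 = - e1 - e2" using sum by algebra
  have y: "y \<noteq> 0" and dbl: "e1 * (2 * y)^2 = (3 * x^2 + A)^2 - 2 * x * (2 * y)^2"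
    using point_double_short[OF half] by simp_all
  have "y^2 = x^3 + A * x + B" using P by (simp add: weierstrass_eval_def)
  then have y2: "(2 * y)^2 = 4 * (x^3 + A * x + B)" by algebra
  have "(e1 - e2) * (2 * y)^2 = ((x - e2)^2 - (e2 - e1) * (e2 - e3))^2"
  proof -
    have "(e1 - e2) * (2 * y)^2 = (3 * x^2 + A)^2 - (2 * x + e2) * (2 * y)^2"
      using dbl by (simp add: left_diff_distrib distrib_right)
    also have "\<dots> = ((x - e2)^2 - (e2 - e1) * (e2 - e3))^2"
      unfolding y2 A B e3 by algebra
    finally show ?thesis .
  qed
  moreover have "(2 * y)^2 \<noteq> 0" using y by simp
  ultimately have "(((x - e2)^2 - (e2 - e1) * (e2 - e3)) / (2 * y))^2 = e1 - e2"
    unfolding power_divide by (metis nonzero_mult_div_cancel_right)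
  then show ?thesis by blast
qed

text \<open>The condition is \<open>2 P = - P\<close>: the tangent slope \<open>l\<close> satisfies \<open>l\<^sup>2 = 3 x\<close>, which is the vanishing of the third
  division polynomial.\<close>

lemma order_three_abscissa:
  fixes A B :: "'a::field_char_0"
  assumes P: "Affine x y \<in> points (Weierstrass 0 0 0 A B)"
  shows "point_add (Weierstrass 0 0 0 A B) (Affine x y) (Affine x y) = Affine x (- y) \<longleftrightarrow>
    y \<noteq> 0 \<and> 3 * x^4 + 6 * A * x^2 + 12 * B * x - A^2 = 0"
proof -
  have eq: "y^2 = x^3 + A * x + B" using P by (simp add: weierstrass_eval_def)
  show ?thesis
  proof (cases "y = 0")
    case False
    define l where "l = (3 * x^2 + A) / (2 * y)"
    have l: "l * (2 * y) = 3 * x^2 + A" using False by (simp add: l_def)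
    have sum: "point_add (Weierstrass 0 0 0 A B) (Affine x y) (Affine x y) =
        Affine (l^2 - 2 * x) (- (y + l * (l^2 - 2 * x - x)))"
      by (rule point_add_tangent[where l = l]) (use False l in simp_all)
    have "(2 * y)^2 * (l^2 - 3 * x) = - (3 * x^4 + 6 * A * x^2 + 12 * B * x - A^2)"
    proof -
      have "(2 * y)^2 * (l^2 - 3 * x) = (l * (2 * y))^2 - 12 * x * y^2" by algebra
      also have "\<dots> = - (3 * x^4 + 6 * A * x^2 + 12 * B * x - A^2)" unfolding l eq by algebra
      finally show ?thesis .
    qed
    moreover have "l^2 - 2 * x = x \<longleftrightarrow> l^2 - 3 * x = 0"
      by (simp add: algebra_simps)
    ultimately have "l^2 - 2 * x = x \<longleftrightarrow> 3 * x^4 + 6 * A * x^2 + 12 * B * x - A^2 = 0"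
      using False by (metis mult_eq_0_iff neg_equal_0_iff_equal power_not_zero zero_neq_numeral)
    then show ?thesis using sum False by auto
  qed simp
qed

lemma mod_add_eq_0_imp:
  fixes a c n :: int
  assumes "0 \<le> c" "c < n" "(a + c) mod n = 0"
  shows "c = (- a) mod n"
proof -
  have "(- a) mod n = (0 - a) mod n" by simp
  also have "\<dots> = ((a + c) mod n - a) mod n" by (simp only: assms(3))
  also have "\<dots> = c mod n" by (simp add: mod_diff_left_eq)
  finally show ?thesis using assms by simp
qed

text \<open>An isomorphism \<open>h\<close> with the abstract group respects doubling and negation, under which the torsion points are
  closed. That determines everything: points of order two are doubles of the preimages of \<open>(1, 0)\<close>, \<open>(0, 3)\<close>,
  \<open>(1, 3)\<close>, and points of order three, being characterised by \<open>2 P = - P\<close>, correspond to \<open>(0, 4)\<close> and \<open>(0, 8)\<close>.\<close>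

lemma torsion_four_twelve:
  fixes A B :: "'a::field_char_0"
  defines "E \<equiv> Weierstrass 0 0 0 A B"
  assumes iso: "torsion_subgroup (point_group E) \<cong> integer_mod_group 4 \<times>\<times> integer_mod_group 12"
  obtains P1 P2 P3 where "P1 \<in> points E" "P2 \<in> points E" "P3 \<in> points E"
    "distinct [Infinity, point_add E P1 P1, point_add E P2 P2, point_add E P3 P3]"
    "\<forall>P\<in>{P1, P2, P3}. point_add E (point_add E P P) (point_add E P P) = Infinity"
  and "\<exists>P\<in>points E. P \<noteq> Infinity \<and> point_add E P P = point_neg P"
  and "\<forall>P\<in>points E. \<forall>Q\<in>points E. P \<noteq> Infinity \<longrightarrow> Q \<noteq> Infinity \<longrightarrow>
    point_add E P P = point_neg P \<longrightarrow> point_add E Q Q = point_neg Q \<longrightarrow> Q = P \<or> Q = point_neg P"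
proof -
  define T where "T = torsion_points E"
  define H where "H = {0..<4::int} \<times> {0..<12::int}"
  define plus :: "int \<times> int \<Rightarrow> int \<times> int \<Rightarrow> int \<times> int"
    where "plus = (\<lambda>(a, b) (c, d). ((a + c) mod 4, (b + d) mod 12))"
  have E: "a1 E = 0" "a3 E = 0" by (simp_all add: E_def)
  from iso obtain h where h: "h \<in> hom (torsion_subgroup (point_group E)) (integer_mod_group 4 \<times>\<times> integer_mod_group 12)"
    and bij: "bij_betw h T H"
    unfolding is_iso_def iso_def T_def H_def by (auto simp: carrier_integer_mod_group)
  have add: "h (point_add E P Q) = plus (h P) (h Q)" if "P \<in> T" "Q \<in> T" for P Q
    using hom_mult[OF h that[unfolded T_def]] by (simp add: plus_def mult_DirProd' split_beta)
  have hT: "h P \<in> H" if "P \<in> T" for P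
    using bij that by (auto simp: bij_betw_def)
  have inj: "P = Q" if "P \<in> T" "Q \<in> T" "h P = h Q" for P Q
    using bij that by (auto simp: bij_betw_def inj_on_def)
  have surj: "\<exists>P\<in>T. h P = z" if "z \<in> H" for z
    using bij that by (metis bij_betw_imp_surj_on imageE)
  have TE: "P \<in> points E" if "P \<in> T" for P
    using that by (simp add: T_def)
  have inf: "Infinity \<in> T"
    by (auto simp: T_def intro!: exI[of _ 1])
  have dbl: "point_add E P P \<in> T" if "P \<in> T" for P
    using that unfolding T_def by (rule torsion_points_double)
  have neg: "point_neg P \<in> T" if "P \<in> T" for P
    using E that unfolding T_def by (rule torsion_points_neg)
  have h0: "h Infinity = (0, 0)"
  proof -
    have "h Infinity = plus (h Infinity) (h Infinity)" using add[OF inf inf] by simp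
    moreover obtain a b where "h Infinity = (a, b)" by (cases "h Infinity")
    ultimately show ?thesis using hT[OF inf] by (simp add: plus_def H_def) presburger
  qed
  have eq_inf: "P = Infinity \<longleftrightarrow> h P = (0, 0)" if "P \<in> T" for P
    using inj[OF that inf] h0 by auto
  obtain P1 where P1: "P1 \<in> T" "h P1 = (1, 0)" using surj[of "(1, 0)"] by (auto simp: H_def)
  obtain P2 where P2: "P2 \<in> T" "h P2 = (0, 3)" using surj[of "(0, 3)"] by (auto simp: H_def)
  obtain P3 where P3: "P3 \<in> T" "h P3 = (1, 3)" using surj[of "(1, 3)"] by (auto simp: H_def)
  have d1: "h (point_add E P1 P1) = (2, 0)" using add[OF P1(1) P1(1)] P1(2) by (simp add: plus_def)
  have d2: "h (point_add E P2 P2) = (0, 6)" using add[OF P2(1) P2(1)] P2(2) by (simp add: plus_def)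
  have d3: "h (point_add E P3 P3) = (2, 6)" using add[OF P3(1) P3(1)] P3(2) by (simp add: plus_def)
  have 1: "P1 \<in> points E" "P2 \<in> points E" "P3 \<in> points E"
    using P1 P2 P3 TE by auto
  have 2: "distinct [Infinity, point_add E P1 P1, point_add E P2 P2, point_add E P3 P3]"
    using d1 d2 d3 h0 by (auto simp del: point_add.simps)
  have 3: "\<forall>P\<in>{P1, P2, P3}. point_add E (point_add E P P) (point_add E P P) = Infinity"
    using P1 P2 P3 d1 d2 d3 by (auto simp: eq_inf dbl add plus_def simp del: point_add.simps)
  have tors: "P \<in> T" if "P \<in> points E" "point_add E P P = point_neg P" for P
  proof -
    have "\<exists>n::nat. n > 0 \<and> P [^]\<^bsub>point_group E\<^esub> n = Infinity"
      by (rule exI[of _ "Suc (Suc (Suc 0))"]) (use that E in \<open>simp add: point_add_neg\<close>)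
    then show ?thesis using that(1) by (simp add: T_def)
  qed
  have order3: "h P \<in> {(0, 4), (0, 8)}" if P: "P \<in> T" "P \<noteq> Infinity" "point_add E P P = point_neg P" for P
  proof -
    obtain a b where ab: "h P = (a, b)" by (cases "h P")
    have "plus (h (point_neg P)) (h P) = (0, 0)"
      using add[OF neg[OF P(1)] P(1)] h0 E by (simp add: point_add_neg)
    moreover have "h (point_neg P) = plus (h P) (h P)"
      using add[OF P(1) P(1)] P(3) by simp
    moreover have "h P \<noteq> (0, 0)" using P eq_inf by simp
    moreover have "a \<in> {0, 1, 2, 3}" "b \<in> {0, 1, 2, 3, 4, 5, 6, 7, 8, 9, 10, 11}"
    proof -
      have "0 \<le> a" "a < 4" and b: "0 \<le> b" "b < 12" using hT[OF P(1)] ab by (simp_all add: H_def)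
      then show "a \<in> {0, 1, 2, 3}" by auto
      from b show "b \<in> {0, 1, 2, 3, 4, 5, 6, 7, 8, 9, 10, 11}" unfolding insert_iff empty_iff by presburger
    qed
    ultimately show ?thesis using ab by (auto simp: plus_def)
  qed
  have neg_h: "h (point_neg P) = ((- fst (h P)) mod 4, (- snd (h P)) mod 12)" if P: "P \<in> T" for P
  proof -
    obtain a b where ab: "h P = (a, b)" by (cases "h P")
    obtain c d where cd: "h (point_neg P) = (c, d)" by (cases "h (point_neg P)")
    have "plus (h P) (h (point_neg P)) = (0, 0)"
      using add[OF P neg[OF P]] h0 E by (simp add: point_add_neg)
    then show ?thesis using hT[OF neg[OF P]] ab cd
      by (simp add: plus_def H_def mod_add_eq_0_imp)
  qed
  have 4: "\<exists>P\<in>points E. P \<noteq> Infinity \<and> point_add E P P = point_neg P"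
  proof -
    obtain P where P: "P \<in> T" "h P = (0, 4)" using surj[of "(0, 4)"] by (auto simp: H_def)
    have "h (point_add E P P) = h (point_neg P)"
      using add[OF P(1) P(1)] neg_h[OF P(1)] P(2) by (simp add: plus_def)
    then have "point_add E P P = point_neg P" by (rule inj[OF dbl[OF P(1)] neg[OF P(1)]])
    moreover have "P \<noteq> Infinity" using P h0 by auto
    ultimately show ?thesis using P TE by blast
  qed
  have 5: "Q = P \<or> Q = point_neg P"
    if "P \<in> points E" "Q \<in> points E" "P \<noteq> Infinity" "Q \<noteq> Infinity"
      "point_add E P P = point_neg P" "point_add E Q Q = point_neg Q" for P Q
  proof -
    have PQ: "P \<in> T" "Q \<in> T" using that tors by auto
    have "h P \<in> {(0, 4), (0, 8)}" "h Q \<in> {(0, 4), (0, 8)}" using order3 PQ that by auto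
    then have "h Q = h P \<or> h Q = h (point_neg P)" using neg_h[OF PQ(1)] by auto
    then show ?thesis using inj PQ neg by blast
  qed
  then have 5: "\<forall>P\<in>points E. \<forall>Q\<in>points E. P \<noteq> Infinity \<longrightarrow> Q \<noteq> Infinity \<longrightarrow>
      point_add E P P = point_neg P \<longrightarrow> point_add E Q Q = point_neg Q \<longrightarrow> Q = P \<or> Q = point_neg P"
    by (intro ballI impI)
  show ?thesis by (rule that[OF 1 2 3 4 5])
qed

section \<open>Fields of degree six containing a square root of minus one\<close>

interpretation over_rat: vector_space "\<lambda>(q::rat) (x::'k::field_char_0). of_rat q * x"
  by (rule vector_space_over_rat)

text \<open>More vectors than the degree are dependent; a family with repetitions has an obvious relation.\<close>

lemma rational_relation:
  fixes v :: "nat \<Rightarrow> 'k::field_char_0"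
  assumes deg: "degree_over_rat TYPE('k) < n" and pos: "degree_over_rat TYPE('k) > 0"
  obtains c :: "nat \<Rightarrow> rat" where "\<exists>i<n. c i \<noteq> 0" "(\<Sum>i<n. of_rat (c i) * v i) = 0"
proof (cases "inj_on v {..<n}")
  case True
  obtain B :: "'k set" where B: "over_rat.independent B" "UNIV \<subseteq> over_rat.span B"
    "card B = degree_over_rat TYPE('k)"
    using over_rat.basis_exists[of UNIV] unfolding degree_over_rat_def by metis
  have "finite B" using B(3) pos by (simp add: card_ge_0_finite)
  have dep: "over_rat.dependent (v ` {..<n})"
  proof (rule ccontr)
    assume "over_rat.independent (v ` {..<n})"
    then have "card (v ` {..<n}) \<le> card B"
      using over_rat.independent_span_bound[OF \<open>finite B\<close>] B(2) by blast
    then show False using deg B(3) card_image[OF True] by simp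
  qed
  then obtain u w where u: "(\<Sum>x\<in>v ` {..<n}. of_rat (u x) * x) = 0" "w \<in> v ` {..<n}" "u w \<noteq> 0"
    using over_rat.dependent_finite[of "v ` {..<n}"] by auto
  then show ?thesis
    using True by (intro that[of "u \<circ> v"]) (auto simp: sum.reindex)
next
  case False
  then obtain i j where ij: "i < n" "j < n" "i \<noteq> j" "v i = v j" by (auto simp: inj_on_def)
  define c where "c = (\<lambda>k. if k = i then 1 else if k = j then - 1 else (0::rat))"
  have "(\<Sum>k<n. of_rat (c k) * v k) = (\<Sum>k\<in>{i, j}. of_rat (c k) * v k)"
    by (rule sum.mono_neutral_right) (use ij in \<open>auto simp: c_def\<close>)
  also have "\<dots> = 0" using ij by (simp add: c_def)
  finally show ?thesis using ij(1) by (intro that[of c]) (auto simp: c_def)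
qed

lemma not_rational_combination:
  fixes v :: "nat \<Rightarrow> 'k::field_char_0"
  assumes deg: "n < degree_over_rat TYPE('k)"
  obtains w where "\<forall>c::nat \<Rightarrow> rat. w \<noteq> (\<Sum>i<n. of_rat (c i) * v i)"
proof -
  obtain B :: "'k set" where B: "over_rat.independent B" "card B = degree_over_rat TYPE('k)"
    using over_rat.basis_exists[of UNIV] unfolding degree_over_rat_def by metis
  have "\<exists>w. w \<notin> over_rat.span (v ` {..<n})"
  proof (rule ccontr)
    assume "\<not> ?thesis"
    then have "card B \<le> card (v ` {..<n})"
      using over_rat.independent_span_bound[OF _ B(1), of "v ` {..<n}"] by auto
    also have "\<dots> \<le> n" using card_image_le[of "{..<n}" v] by simp
    finally show False using deg B(2) by simp
  qed
  then obtain w where w: "w \<notin> over_rat.span (v ` {..<n})" by blast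
  have "(\<Sum>i<n. of_rat (c i) * v i) \<in> over_rat.span (v ` {..<n})" for c :: "nat \<Rightarrow> rat"
    by (intro over_rat.span_sum over_rat.span_scale over_rat.span_base) auto
  with w show ?thesis by (intro that[of w]) auto
qed

text \<open>The subfield \<open>\<rat>(i)\<close> for a square root \<open>i\<close> of \<open>- 1\<close>.\<close>

definition gauss_field :: "'k::field_char_0 \<Rightarrow> 'k set" where
  "gauss_field i = {of_rat a + of_rat b * i | a b. True}"

locale gaussian_sextic_field =
  fixes i :: "'k::field_char_0"
  assumes i: "i^2 = - 1" and degree: "degree_over_rat TYPE('k) = 6"
begin

abbreviation F :: "'k set" where "F \<equiv> gauss_field i"

lemma F_E:
  assumes "z \<in> F"
  obtains a b where "z = of_rat a + of_rat b * i"
  using assms by (auto simp: gauss_field_def)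

lemma F_I: "of_rat a + of_rat b * i \<in> F"
  by (auto simp: gauss_field_def)

lemma F_of_rat [simp, intro]: "of_rat a \<in> F"
  using F_I[of a 0] by simp

lemma F_i [simp, intro]: "i \<in> F"
  using F_I[of 0 1] by simp

lemma F_const [simp, intro]: "0 \<in> F" "1 \<in> F" "numeral k \<in> F"
  using F_of_rat[of 0] F_of_rat[of 1] F_of_rat[of "numeral k"] by simp_all

lemma gauss_eq_0_iff [simp]: "of_rat a + of_rat b * i = 0 \<longleftrightarrow> a = 0 \<and> b = 0"
proof
  assume "of_rat a + of_rat b * i = 0"
  then have "(of_rat a)^2 = - (of_rat b * of_rat b :: 'k)" using i by algebra
  then have "of_rat (a * a + b * b) = (0 :: 'k)"
    by (simp add: of_rat_add of_rat_mult power2_eq_square)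
  then have "a * a + b * b = 0" by (simp only: of_rat_eq_0_iff)
  then show "a = 0 \<and> b = 0" by (simp add: sum_squares_eq_zero_iff)
qed simp

lemma gauss_eq_iff:
  "of_rat a + of_rat b * i = of_rat c + of_rat d * i \<longleftrightarrow> a = c \<and> b = d"
  using gauss_eq_0_iff[of "a - c" "b - d"] by (auto simp: of_rat_diff algebra_simps)

lemma F_add [simp, intro]:
  assumes "x \<in> F" "y \<in> F" shows "x + y \<in> F"
proof -
  obtain a b c d where "x = of_rat a + of_rat b * i" "y = of_rat c + of_rat d * i"
    using assms by (elim F_E)
  then have "x + y = of_rat (a + c) + of_rat (b + d) * i"
    by (simp add: of_rat_add algebra_simps)
  then show ?thesis using F_I by simp
qed

lemma F_mult [simp, intro]:
  assumes "x \<in> F" "y \<in> F" shows "x * y \<in> F"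
proof -
  obtain a b c d where xy: "x = of_rat a + of_rat b * i" "y = of_rat c + of_rat d * i"
    using assms by (elim F_E)
  have "x * y = of_rat (a * c - b * d) + of_rat (a * d + b * c) * i"
    unfolding xy of_rat_add of_rat_mult of_rat_diff using i by algebra
  then show ?thesis using F_I by simp
qed

lemma F_uminus [simp, intro]: "x \<in> F \<Longrightarrow> - x \<in> F"
  using F_mult[OF F_of_rat[of "- 1"], of x] unfolding of_rat_minus of_rat_1 by simp

lemma F_diff [simp, intro]: "x \<in> F \<Longrightarrow> y \<in> F \<Longrightarrow> x - y \<in> F"
  using F_add[of x "- y"] by simp

lemma F_power [simp, intro]: "x \<in> F \<Longrightarrow> x ^ n \<in> F"
  by (induction n) auto

lemma F_inverse [simp, intro]:
  assumes "x \<in> F" shows "inverse x \<in> F"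
proof (cases "x = 0")
  case False
  obtain a b where x: "x = of_rat a + of_rat b * i" using assms by (elim F_E)
  define n where "n = a * a + b * b"
  have "n \<noteq> 0" using False x by (auto simp: n_def sum_squares_eq_zero_iff)
  have "x * (of_rat a + of_rat (- b) * i) = of_rat n"
    unfolding x n_def of_rat_add of_rat_mult of_rat_minus using i by algebra
  then have "x * ((of_rat a + of_rat (- b) * i) * of_rat (inverse n)) = 1"
    using \<open>n \<noteq> 0\<close> by (simp add: mult.assoc[symmetric] flip: of_rat_mult)
  then have "inverse x = (of_rat a + of_rat (- b) * i) * of_rat (inverse n)"
    by (rule inverse_unique)
  then show ?thesis using F_I[of a "- b"] by (simp only: F_mult F_of_rat)
qed simp

lemma F_divide [simp, intro]: "x \<in> F \<Longrightarrow> y \<in> F \<Longrightarrow> x / y \<in> F"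
  unfolding divide_inverse by simp

lemma sum_lessThan_4: "sum f {..<4::nat} = f 0 + f 1 + f 2 + (f 3 :: 'k)"
  and sum_lessThan_8: "sum f {..<8::nat} = f 0 + f 1 + f 2 + f 3 + f 4 + f 5 + f 6 + (f 7 :: 'k)"
  by (simp_all add: eval_nat_numeral)

text \<open>The eight elements \<open>w j\<close>, \<open>i w j\<close> exceed the degree six over the rationals.\<close>

lemma F_relation:
  fixes w :: "nat \<Rightarrow> 'k"
  obtains c where "\<forall>j. c j \<in> F" "\<exists>j<4. c j \<noteq> 0" "(\<Sum>j<4. c j * w j) = 0"
proof -
  define v where "v n = (if even n then w (n div 2) else i * w (n div 2))" for n
  obtain c where c: "\<exists>n<8. c n \<noteq> 0" "(\<Sum>n<8. of_rat (c n) * v n) = 0"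
    by (rule rational_relation[of 8 v]) (simp_all add: degree)
  define e where "e j = of_rat (c (2 * j)) + of_rat (c (2 * j + 1)) * i" for j
  have v: "v 0 = w 0" "v 1 = i * w 0" "v 2 = w 1" "v 3 = i * w 1"
      "v 4 = w 2" "v 5 = i * w 2" "v 6 = w 3" "v 7 = i * w 3"
    by (simp_all add: v_def)
  have e: "e 0 = of_rat (c 0) + of_rat (c 1) * i" "e 1 = of_rat (c 2) + of_rat (c 3) * i"
      "e 2 = of_rat (c 4) + of_rat (c 5) * i" "e 3 = of_rat (c 6) + of_rat (c 7) * i"
    unfolding e_def by (simp_all add: eval_nat_numeral)
  have "(\<Sum>j<4. e j * w j) = (\<Sum>n<8. of_rat (c n) * v n)"
    unfolding sum_lessThan_4 sum_lessThan_8 e v by (simp add: algebra_simps)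
  moreover have "\<exists>j<4. e j \<noteq> 0"
  proof -
    obtain n where n: "n < 8" "c n \<noteq> 0" using c by auto
    have "n = 2 * (n div 2) \<or> n = 2 * (n div 2) + 1" by linarith
    then have "e (n div 2) \<noteq> 0" using n(2) unfolding e_def gauss_eq_0_iff by metis
    then show ?thesis using n(1) by (intro exI[of _ "n div 2"]) auto
  qed
  ultimately show ?thesis using c(2) by (intro that[of e]) (auto simp: e_def F_I)
qed

lemma F_relation4:
  fixes w0 w1 w2 w3 :: 'k
  obtains c0 c1 c2 c3 where "c0 \<in> F" "c1 \<in> F" "c2 \<in> F" "c3 \<in> F"
    "c0 \<noteq> 0 \<or> c1 \<noteq> 0 \<or> c2 \<noteq> 0 \<or> c3 \<noteq> 0" "c0 * w0 + c1 * w1 + c2 * w2 + c3 * w3 = 0"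
proof -
  obtain c where "\<forall>j. c j \<in> F" "\<exists>j<4. c j \<noteq> 0" "(\<Sum>j<4. c j * ([w0, w1, w2, w3] ! j)) = 0"
    by (rule F_relation[of "\<lambda>j. [w0, w1, w2, w3] ! j"])
  then show ?thesis
    by (intro that[of "c 0" "c 1" "c 2" "c 3"])
      (auto simp: sum_lessThan_4 less_Suc_eq numeral_eq_Suc)
qed

text \<open>A plane over \<open>F\<close> has dimension four over the rationals, less than the degree six.\<close>

lemma F_plane_proper:
  obtains w where "\<forall>a\<in>F. \<forall>b\<in>F. w \<noteq> a + b * z"
proof -
  obtain w where w: "\<forall>c::nat \<Rightarrow> rat. w \<noteq> (\<Sum>n<4. of_rat (c n) * ([1, i, z, i * z] ! n))"
    by (rule not_rational_combination[of 4 "\<lambda>n. [1, i, z, i * z] ! n"]) (simp_all add: degree)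
  have "w \<noteq> a + b * z" if ab: "a \<in> F" "b \<in> F" for a b
  proof -
    obtain p q r s where "a = of_rat p + of_rat q * i" "b = of_rat r + of_rat s * i"
      using ab by (elim F_E)
    then show ?thesis
      using w[rule_format, of "\<lambda>n. [p, q, r, s] ! n"] unfolding sum_lessThan_4 by (simp add: algebra_simps)
  qed
  then show ?thesis by (intro that) blast
qed

text \<open>The dimension of the field over \<open>F\<close> is three, so it has no subfield of degree two over \<open>F\<close>:
  for \<open>z\<close> quadratic over \<open>F\<close> but not in \<open>F\<close>, and \<open>w\<close> outside the field \<open>F + F z\<close>, the four elements
  \<open>1, z, w, z w\<close> would be independent over \<open>F\<close>.\<close>

lemma quadratic_in_F:
  assumes a: "a \<in> F" and b: "b \<in> F" and z: "z^2 + a * z + b = 0"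
  shows "z \<in> F"
proof (rule ccontr)
  assume nz: "z \<notin> F"
  have indep: "c = 0 \<and> d = 0" if "c \<in> F" "d \<in> F" "c + d * z = 0" for c d
  proof -
    have "d = 0"
    proof (rule ccontr)
      assume "d \<noteq> 0"
      then have "z = - c / d" using that(3) by (simp add: field_simps eq_neg_iff_add_eq_0)
      then show False using nz that by (metis F_divide F_uminus)
    qed
    then show ?thesis using that(3) by simp
  qed
  obtain w where w: "\<forall>c\<in>F. \<forall>d\<in>F. w \<noteq> c + d * z"
    by (rule F_plane_proper[of z])
  obtain c0 c1 c2 c3 where c: "c0 \<in> F" "c1 \<in> F" "c2 \<in> F" "c3 \<in> F"
    "c0 \<noteq> 0 \<or> c1 \<noteq> 0 \<or> c2 \<noteq> 0 \<or> c3 \<noteq> 0" "c0 * 1 + c1 * z + c2 * w + c3 * (z * w) = 0"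
    by (rule F_relation4[of 1 z w "z * w"])
  have rel: "(c0 + c1 * z) + (c2 + c3 * z) * w = 0" using c(6) by algebra
  show False
  proof (cases "c2 + c3 * z = 0")
    case True
    then show False using rel indep[of c2 c3] indep[of c0 c1] c by auto
  next
    case False
    \<comment> \<open>The conjugate of the divisor; their product is the norm to \<open>F\<close>.\<close>
    define r where "r = c2 - c3 * a - c3 * z"
    define N where "N = c2^2 - c2 * c3 * a + c3^2 * b"
    have "(c2 + c3 * z) * r = N - c3^2 * (z^2 + a * z + b)" unfolding r_def N_def by algebra
    then have N: "(c2 + c3 * z) * r = N" unfolding z by simp
    have "r \<noteq> 0"
    proof
      assume "r = 0"
      then have "(c2 - c3 * a) + (- c3) * z = 0" by (simp add: r_def)
      with c a have "c2 - c3 * a = 0 \<and> - c3 = 0" by (intro indep F_diff F_mult F_uminus)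
      then show False using False by simp
    qed
    then have N0: "N \<noteq> 0" using N False by auto
    have "N * w = ((c2 + c3 * z) * w) * r" unfolding N[symmetric] by algebra
    also have "(c2 + c3 * z) * w = - (c0 + c1 * z)" using rel by algebra
    also have "- (c0 + c1 * z) * r =
        (- (c0 * (c2 - c3 * a)) - c1 * c3 * b) + (c0 * c3 - c1 * c2) * z + c1 * c3 * (z^2 + a * z + b)"
      unfolding r_def by algebra
    also have "\<dots> = (- (c0 * (c2 - c3 * a)) - c1 * c3 * b) + (c0 * c3 - c1 * c2) * z"
      unfolding z by simp
    finally have Nw: "N * w = (- (c0 * (c2 - c3 * a)) - c1 * c3 * b) + (c0 * c3 - c1 * c2) * z" .
    have "w = N * w / N" using N0 by simp
    also have "\<dots> = (- (c0 * (c2 - c3 * a)) - c1 * c3 * b) / N + (c0 * c3 - c1 * c2) / N * z"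
      unfolding Nw add_divide_distrib by simp
    finally have "w = (- (c0 * (c2 - c3 * a)) - c1 * c3 * b) / N + (c0 * c3 - c1 * c2) / N * z" .
    moreover have "N \<in> F" using c a b by (simp add: N_def)
    ultimately show False
      using w[rule_format, of "(- (c0 * (c2 - c3 * a)) - c1 * c3 * b) / N" "(c0 * c3 - c1 * c2) / N"] c a b by simp
  qed
qed

lemma sqrt_in_F:
  assumes "z^2 \<in> F" shows "z \<in> F"
  by (rule quadratic_in_F[of 0 "- (z^2)"]) (use assms in simp_all)

lemma F_linear_relation:
  assumes "c0 \<in> F" "c1 \<in> F" "c2 \<in> F" "c0 \<noteq> 0 \<or> c1 \<noteq> 0 \<or> c2 \<noteq> 0" "c0 + c1 * z + c2 * z^2 = 0"
  shows "z \<in> F"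
proof (cases "c2 = 0")
  case True
  then have "c1 \<noteq> 0" using assms by auto
  then have "z = - c0 / c1" using assms(5) True by (simp add: field_simps eq_neg_iff_add_eq_0)
  then show ?thesis using assms by (metis F_divide F_uminus)
next
  case False
  have "z^2 + c1 / c2 * z + c0 / c2 = (c2 * z^2 + c1 * z + c0) / c2"
    unfolding add_divide_distrib using False by simp
  also have "c2 * z^2 + c1 * z + c0 = 0" using assms(5) by algebra
  finally have "z^2 + c1 / c2 * z + c0 / c2 = 0" by (simp only: div_0)
  then show ?thesis by (rule quadratic_in_F[OF F_divide[OF assms(2,3)] F_divide[OF assms(1,3)]])
qed

text \<open>Over \<open>F\<close> the minimal polynomial of an element has degree one or three, so a quartic with a root
  in the field has a linear factor over \<open>F\<close>.\<close>

lemma quartic_root_in_F: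
  assumes F: "p3 \<in> F" "p2 \<in> F" "p1 \<in> F" "p0 \<in> F"
    and z: "z^4 + p3 * z^3 + p2 * z^2 + p1 * z + p0 = 0"
  shows "\<exists>r\<in>F. r^4 + p3 * r^3 + p2 * r^2 + p1 * r + p0 = 0"
proof (cases "z \<in> F")
  case False
  obtain c0 c1 c2 c3 where c: "c0 \<in> F" "c1 \<in> F" "c2 \<in> F" "c3 \<in> F"
    "c0 \<noteq> 0 \<or> c1 \<noteq> 0 \<or> c2 \<noteq> 0 \<or> c3 \<noteq> 0" "c0 * 1 + c1 * z + c2 * z^2 + c3 * z^3 = 0"
    by (rule F_relation4[of 1 z "z^2" "z^3"])
  have c3: "c3 \<noteq> 0"
  proof
    assume "c3 = 0"
    then have "c0 + c1 * z + c2 * z^2 = 0" using c(6) by algebra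
    moreover have "c0 \<noteq> 0 \<or> c1 \<noteq> 0 \<or> c2 \<noteq> 0" using c(5) \<open>c3 = 0\<close> by blast
    ultimately have "z \<in> F" using F_linear_relation c(1-3) by blast
    then show False using False by simp
  qed
  define b0 where "b0 = c0 / c3"
  define b1 where "b1 = c1 / c3"
  define b2 where "b2 = c2 / c3"
  have bF: "b0 \<in> F" "b1 \<in> F" "b2 \<in> F" using c by (simp_all add: b0_def b1_def b2_def)
  have cubic: "z^3 + b2 * z^2 + b1 * z + b0 = 0"
  proof -
    have cb: "c3 * b0 = c0" "c3 * b1 = c1" "c3 * b2 = c2" using c3 by (simp_all add: b0_def b1_def b2_def)
    have "c3 * (z^3 + b2 * z^2 + b1 * z + b0) = (c3 * b0) * 1 + (c3 * b1) * z + (c3 * b2) * z^2 + c3 * z^3"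
      by algebra
    then have "c3 * (z^3 + b2 * z^2 + b1 * z + b0) = 0" unfolding cb c(6) .
    then show ?thesis using c3 by simp
  qed
  define r where "r = b2 - p3"
  define d2 where "d2 = p2 - b1 + r * b2"
  define d1 where "d1 = p1 - b0 + r * b1"
  define d0 where "d0 = p0 + r * b0"
  have div: "T^4 + p3 * T^3 + p2 * T^2 + p1 * T + p0 =
      (T - r) * (T^3 + b2 * T^2 + b1 * T + b0) + (d0 + d1 * T + d2 * T^2)" for T
    unfolding d0_def d1_def d2_def r_def by algebra
  have "d0 + d1 * z + d2 * z^2 = 0"
    using div[of z] unfolding z cubic by (simp only: mult_zero_right add_0)
  moreover have "r \<in> F" "d0 \<in> F" "d1 \<in> F" "d2 \<in> F"
    using F bF by (auto simp: r_def d0_def d1_def d2_def)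
  ultimately have d: "d0 = 0" "d1 = 0" "d2 = 0" using F_linear_relation[of d0 d1 d2 z] False by blast+
  have "r^4 + p3 * r^3 + p2 * r^2 + p1 * r + p0 = 0" unfolding div d by algebra
  then show ?thesis using \<open>r \<in> F\<close> by blast
qed (use z in blast)

end

section \<open>The descent for the curve 48a1\<close>

text \<open>If \<open>p/q\<close> in lowest terms has an integral square, then \<open>q\<^sup>2\<close> divides \<open>p\<^sup>2\<close> and \<open>q\<close> divides \<open>p\<close>.\<close>

lemma rat_square_int:
  fixes z :: rat
  assumes "z^2 = of_int m"
  obtains j where "z = of_int j" "m = j^2"
proof -
  obtain p q where pq: "quotient_of z = (p, q)" by (cases "quotient_of z")
  then have q: "q > 0" and cop: "coprime p q" and z: "z = of_int p / of_int q"
    using quotient_of_denom_pos quotient_of_coprime quotient_of_div by auto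
  have "of_int (p^2) = (of_int (m * q^2) :: rat)"
    using assms q unfolding z by (simp add: power_divide divide_eq_eq)
  then have "p^2 = m * q^2" by (simp only: of_int_eq_iff)
  then have "q^2 dvd p^2" by simp
  then have "q dvd p" by simp
  then have "is_unit q" using cop by (metis coprime_common_divisor dvd_refl)
  then have "q = 1" using q by (simp add: zdvd1_eq)
  then have "z = of_int p" using z by simp
  moreover from this have "m = p^2" using assms by (metis of_int_eq_iff of_int_power)
  ultimately show ?thesis by (rule that)
qed

lemma two_three_not_rat_square:
  fixes z :: rat
  shows "z^2 \<noteq> 2" "z^2 \<noteq> 3"
proof -
  have "z^2 \<noteq> of_int m" if m: "1 < m" "m < 4" for m
  proof
    assume "z^2 = of_int m"
    then obtain j where j: "m = j^2" using rat_square_int by metis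
    have "\<bar>j\<bar> \<le> 1 \<or> \<bar>j\<bar> \<ge> 2" by linarith
    then have "\<bar>j\<bar>^2 \<le> 1^2 \<or> 2^2 \<le> \<bar>j\<bar>^2" by (metis abs_ge_zero power_mono zero_le_numeral)
    then show False using m unfolding j by simp
  qed
  from this[of 2] this[of 3] show "z^2 \<noteq> 2" "z^2 \<noteq> 3" by simp_all
qed

lemma coprime_mult_square:
  fixes u v w :: int
  assumes "coprime u v" "u * v = w^2" "u \<ge> 0" "v \<ge> 0"
  obtains a b where "u = a^2" "v = b^2" "a \<ge> 0" "b \<ge> 0"
proof -
  define u' v' w' where "u' = nat u" and "v' = nat v" and "w' = nat \<bar>w\<bar>"
  have uv: "u = int u'" "v = int v'" "\<bar>w\<bar> = int w'"
    using assms by (simp_all add: u'_def v'_def w'_def)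
  have "int (u' * v') = int (w'^2)" using assms(2) uv by (metis of_nat_mult of_nat_power power2_abs)
  then have "u' * v' = w'^2" by (simp only: of_nat_eq_iff)
  then have "is_nth_power 2 (u' * v')" by (metis is_nth_power_nth_power)
  moreover have "coprime u' v'" using assms(1) uv by simp
  ultimately have "is_nth_power 2 u'" "is_nth_power 2 v'"
    using is_nth_power_mult_coprime_nat_iff[of u' v' 2] by auto
  then obtain a b where "u' = a^2" "v' = b^2" by (auto elim!: is_nth_powerE)
  then show ?thesis using uv by (intro that[of "int a" "int b"]) simp_all
qed

lemma square_mod_4: "(x::int)^2 mod 4 = (if even x then 0 else 1)"
proof (cases "even x")
  case True
  then obtain k where "x = 2 * k" by blast
  then show ?thesis using True by (simp add: power_mult_distrib)
next
  case False
  then obtain k where "x = 2 * k + 1" by (elim oddE)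
  then have x: "x^2 = 1 + 4 * (k^2 + k)" by (simp add: power2_eq_square algebra_simps)
  show ?thesis using False unfolding x mod_mult_self2 by simp
qed

lemma odd_square_mod_8: "odd (x::int) \<Longrightarrow> x^2 mod 8 = 1"
proof -
  assume "odd x"
  then obtain k where "x = 2 * k + 1" by (elim oddE)
  then have "x^2 = 1 + 4 * (k * (k + 1))" by (simp add: power2_eq_square algebra_simps)
  moreover have "even (k * (k + 1))" by simp
  then obtain m where "k * (k + 1) = 2 * m" by blast
  ultimately have x: "x^2 = 1 + 8 * m" by simp
  show "x^2 mod 8 = 1" unfolding x mod_mult_self2 by simp
qed

lemma sum_two_squares_4_even:
  assumes "4 * x = y^2 + (z::int)^2"
  shows "even y" "even z"
proof -
  have "(y^2 + z^2) mod 4 = 0" using assms by (metis mod_mult_self1_is_0)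
  then have "(y^2 mod 4 + z^2 mod 4) mod 4 = 0" by (simp add: mod_add_eq)
  then show "even y" "even z" by (simp_all add: square_mod_4 split: if_splits)
qed

definition concordant :: "int \<Rightarrow> int \<Rightarrow> bool" where
  "concordant M e \<longleftrightarrow> M > 0 \<and> e > 0 \<and> (\<exists>A B. M^2 = e^2 + A^2 \<and> M^2 = 4 * e^2 + B^2)"

lemma concordantI:
  assumes "M > 0" "e \<noteq> 0" "M^2 = e^2 + A^2" "M^2 = 4 * e^2 + B^2"
  shows "concordant M \<bar>e\<bar>"
  using assms unfolding concordant_def by auto

text \<open>The four systems with \<open>k = \<plusminus> 1\<close>, \<open>\<plusminus> 3\<close> are the two-coverings of 48a1 that come from its points of order two.
  Translation by those points identifies them with one another, so each yields a solution of the untwisted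
  system with \<open>M\<close> one of \<open>a\<close>, \<open>b\<close>, \<open>c\<close>, \<open>d\<close>.\<close>

lemma twisted_concordant:
  fixes a b c d k :: int
  assumes pos: "a > 0" "b > 0" "c > 0" "d > 0" and k: "k \<in> {1, - 1, 3, - 3}"
    and eq1: "b^2 - c^2 = k * d^2" and eq2: "4 * b^2 - c^2 = k * a^2"
  obtains M e where "M \<in> {a, b, c, d}" "concordant M e"
proof -
  from k consider "k = 1" | "k = - 1" | "k = 3" | "k = - 3" by blast
  then show ?thesis
  proof cases
    case 1
    have "4 * b^2 = c^2 + a^2" using eq2 1 by simp
    then obtain c' a' where ac: "c = 2 * c'" "a = 2 * a'"
      using sum_two_squares_4_even[of "b^2" c a] by (auto elim!: evenE)
    have "4 * b^2 = 4 * (c'^2 + a'^2)" using \<open>4 * b^2 = c^2 + a^2\<close> ac by (simp add: power_mult_distrib)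
    then have "b^2 = c'^2 + a'^2" by simp
    moreover have "b^2 = 4 * c'^2 + d^2" using eq1 1 ac by (simp add: power_mult_distrib)
    ultimately show ?thesis using pos ac concordantI[of b c' a' d] by (intro that[of b]) auto
  next
    case 2
    then have "c^2 = b^2 + d^2" "c^2 = 4 * b^2 + a^2" using eq1 eq2 by simp_all
    then show ?thesis using pos concordantI[of c b d a] by (intro that[of c]) auto
  next
    case 3
    then have "a^2 = d^2 + b^2" "a^2 = 4 * d^2 + c^2" using eq1 eq2 by simp_all
    then show ?thesis using pos concordantI[of a d b c] by (intro that[of a]) auto
  next
    case 4
    have "4 * d^2 = c^2 + a^2" using eq1 eq2 4 by simp
    then obtain c' a' where ac: "c = 2 * c'" "a = 2 * a'"
      using sum_two_squares_4_even[of "d^2" c a] by (auto elim!: evenE)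
    have "4 * d^2 = 4 * (c'^2 + a'^2)" using \<open>4 * d^2 = c^2 + a^2\<close> ac by (simp add: power_mult_distrib)
    then have "d^2 = a'^2 + c'^2" by simp
    moreover have "d^2 = 4 * a'^2 + b^2" using eq1 eq2 4 ac by (simp add: power_mult_distrib)
    ultimately show ?thesis using pos ac concordantI[of d a' c' b] by (intro that[of d]) auto
  qed
qed

text \<open>The two factors in \<open>(M - N)/2 \<cdot> (M + N)/2 = w\<^sup>2\<close> are coprime.\<close>

lemma pythagorean_halves:
  fixes M N w :: int
  assumes odd: "odd M" "odd N" and M: "M > 0" and sq: "M^2 - N^2 = 4 * w^2" and cop: "coprime M w"
  obtains a b where "a \<ge> 0" "b \<ge> 0" "M = a^2 + b^2" "\<bar>w\<bar> = a * b" "coprime a b"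
proof -
  have "even (M - N)" "even (M + N)" using odd by simp_all
  then obtain u v where uv: "M - N = 2 * u" "M + N = 2 * v" by (elim evenE)
  have MN: "M = u + v" "N = v - u" using uv by linarith+
  have w: "u * v = w^2" using sq unfolding MN by (simp add: power2_eq_square algebra_simps)
  have "coprime u v"
  proof (rule coprimeI)
    fix g assume g: "g dvd u" "g dvd v"
    then have "g dvd M" "g dvd w^2" using MN w by (auto simp flip: w)
    moreover have "coprime M (w^2)" using cop by simp
    ultimately show "is_unit g" by (metis coprime_common_divisor)
  qed
  have "0 \<le> u * v" using w by simp
  then have "0 \<le> u \<and> 0 \<le> v" using M MN(1) by (auto simp: zero_le_mult_iff)
  then obtain a b where ab: "u = a^2" "v = b^2" "a \<ge> 0" "b \<ge> 0"
    using coprime_mult_square[OF \<open>coprime u v\<close> w] by metis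
  have "(a * b)^2 = \<bar>w\<bar>^2" using w ab by (simp add: power_mult_distrib)
  then have "\<bar>w\<bar> = a * b" using ab by (metis abs_ge_zero mult_nonneg_nonneg power2_eq_iff_nonneg)
  moreover have "coprime a b" using \<open>coprime u v\<close> ab by simp
  ultimately show ?thesis using ab MN by (intro that[of a b]) auto
qed

lemma dvd_three_of_coprime:
  fixes g x y :: int
  assumes "coprime x y" "g dvd 3 * x" "g dvd 3 * y"
  shows "g dvd 3"
proof -
  have "g dvd gcd (3 * x) (3 * y)" using assms by simp
  also have "gcd (3 * x) (3 * y) = 3" using assms(1) by (simp add: gcd_mult_distrib_int[symmetric])
  finally show ?thesis .
qed

lemma dvd_three_cases:
  fixes k :: int
  assumes "k dvd 3"
  shows "k \<in> {1, - 1, 3, - 3}"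
proof -
  have "\<bar>k\<bar> dvd 3" using assms by simp
  moreover from this have "\<bar>k\<bar> \<le> 3" by (simp add: zdvd_imp_le)
  ultimately show ?thesis by (cases "\<bar>k\<bar> = 0"; cases "\<bar>k\<bar> = 1"; cases "\<bar>k\<bar> = 2"; auto)
qed

text \<open>For a coprime solution both equations are Pythagorean and give \<open>M = a\<^sup>2 + b\<^sup>2 = p\<^sup>2 + 4 q\<^sup>2\<close> with \<open>a b = p q\<close>.
  Splitting \<open>a\<close>, \<open>b\<close>, \<open>p\<close>, \<open>q\<close> into the common factors \<open>x\<close>, \<open>y\<close>, \<open>z\<close>, \<open>t\<close> turns the equality of the two
  expressions for \<open>M\<close> into a twisted system in numbers smaller than \<open>M\<close>.\<close>

lemma no_concordant: "\<not> concordant M e"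
proof (induction "nat M" arbitrary: M e rule: less_induct)
  case less
  show ?case
  proof
    assume "concordant M e"
    then obtain A B where pos: "M > 0" "e > 0" and A: "M^2 = e^2 + A^2" and B: "M^2 = 4 * e^2 + B^2"
      unfolding concordant_def by blast
    have IH: "\<not> concordant m f" if "m < M" for m f
      using less[of m f] that pos by simp
    show False
    proof (cases "coprime M e")
      case False
      define g where "g = gcd M e"
      have g: "g > 1" using False pos unfolding g_def
        by (metis coprime_iff_gcd_eq_1 gcd_pos_int less_irrefl linorder_neqE_linordered_idom zero_less_iff_neq_zero int_one_le_iff_zero_less order_le_less)
      obtain m f where mf: "M = g * m" "e = g * f"
        unfolding g_def by (metis dvd_def gcd_dvd1 gcd_dvd2)
      have "A^2 = g^2 * (m^2 - f^2)" using A mf by (simp add: power_mult_distrib algebra_simps)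
      then have "g^2 dvd A^2" by simp
      then obtain A' where A': "A = g * A'" by (auto elim: dvdE)
      have "B^2 = g^2 * (m^2 - 4 * f^2)" using B mf by (simp add: power_mult_distrib algebra_simps)
      then have "g^2 dvd B^2" by simp
      then obtain B' where B': "B = g * B'" by (auto elim: dvdE)
      have "g^2 * m^2 = g^2 * (f^2 + A'^2)" "g^2 * m^2 = g^2 * (4 * f^2 + B'^2)"
        using A B unfolding mf A' B' by (simp_all add: power_mult_distrib algebra_simps)
      then have "m^2 = f^2 + A'^2" "m^2 = 4 * f^2 + B'^2" using g by simp_all
      moreover have "m > 0" "f > 0" using pos g mf by (simp_all add: zero_less_mult_iff)
      ultimately have "concordant m f" unfolding concordant_def by blast
      moreover have "m < M" using g \<open>m > 0\<close> mf by simp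
      ultimately show False using IH by blast
    next
      case cop: True
      have "odd M"
      proof
        assume "even M"
        then have "odd e" using cop by (metis coprime_common_divisor odd_one)
        then have "(e^2 + A^2) mod 4 \<noteq> 0"
          using mod_add_eq[of "e^2" 4 "A^2"] by (simp add: square_mod_4 split: if_splits)
        then show False using \<open>even M\<close> A square_mod_4[of M] by simp
      qed
      have "odd B" using \<open>odd M\<close> B by (metis dvd_add_left_iff dvd_mult2 even_numeral even_power zero_less_numeral)
      have "even e"
      proof (rule ccontr)
        assume "odd e"
        have "4 * e^2 mod 8 = 4 * (e^2 mod 8) mod 8" by (rule mod_mult_right_eq[symmetric])
        then have "4 * e^2 mod 8 = 4" using \<open>odd e\<close> by (simp add: odd_square_mod_8)
        moreover have "(4 * e^2 + B^2) mod 8 = (4 * e^2 mod 8 + B^2 mod 8) mod 8"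
          by (rule mod_add_eq[symmetric])
        ultimately have "(4 * e^2 + B^2) mod 8 = 5" using \<open>odd B\<close> by (simp add: odd_square_mod_8)
        then show False using odd_square_mod_8[OF \<open>odd M\<close>] unfolding B by simp
      qed
      then obtain e' where e': "e = 2 * e'" by blast
      have "odd A"
      proof
        assume "even A"
        then have "even (M^2)" using A e' by simp
        then show False using \<open>odd M\<close> by simp
      qed
      obtain a b where ab: "a \<ge> 0" "b \<ge> 0" "M = a^2 + b^2" "\<bar>e'\<bar> = a * b" "coprime a b"
      proof (rule pythagorean_halves[OF \<open>odd M\<close> \<open>odd A\<close> pos(1)])
        show "M^2 - A^2 = 4 * e'^2" using A e' by (simp add: power_mult_distrib)
        show "coprime M e'" using cop e' by simp
      qed
      obtain r s where rs: "r \<ge> 0" "s \<ge> 0" "M = r^2 + s^2" "\<bar>e\<bar> = r * s" "coprime r s"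
      proof (rule pythagorean_halves[OF \<open>odd M\<close> \<open>odd B\<close> pos(1) _ cop])
        show "M^2 - B^2 = 4 * e^2" using B by simp
      qed
      have prod: "2 * (a * b) = r * s" using ab rs e' pos by (simp add: abs_mult)
      \<comment> \<open>By symmetry the even one of \<open>r\<close> and \<open>s\<close> may be taken to be \<open>s\<close>.\<close>
      obtain p q where pq: "p \<ge> 0" "q \<ge> 0" "M = p^2 + 4 * q^2" "a * b = p * q" "coprime p (2 * q)"
      proof -
        have "even (r * s)" using prod by (metis dvd_triv_left)
        then consider q where "s = 2 * q" | q where "r = 2 * q" by (auto elim!: evenE)
        then show ?thesis
        proof cases
          case 1
          then show ?thesis using rs prod by (intro that[of r q]) (simp_all add: power_mult_distrib)
        next
          case 2
          then show ?thesis using rs prod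
            by (intro that[of s q]) (simp_all add: power_mult_distrib coprime_commute)
        qed
      qed
      have abpos: "a > 0" "b > 0" using ab pos e' by (auto simp: order_le_less)
      have "0 < p * q" using abpos pq(4) by (metis mult_pos_pos)
      then have pqpos: "p > 0" "q > 0" using pq(1,2) by (auto simp: zero_less_mult_iff)
      define x where "x = gcd a p"
      have "x > 0" using abpos by (simp add: x_def)
      obtain y z where yz: "a = x * y" "p = x * z" unfolding x_def by (metis dvd_def gcd_dvd1 gcd_dvd2)
      have "coprime y z"
        using gcd_coprime[of a p y z] abpos yz unfolding x_def by (simp add: mult.commute)
      have "y * b = z * q" using pq(4) \<open>x > 0\<close> unfolding yz by simp
      then have "z dvd b" using \<open>coprime y z\<close>
        by (metis coprime_commute coprime_dvd_mult_right_iff dvd_triv_left)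
      then obtain t where t: "b = z * t" by blast
      have xyz: "y > 0" "z > 0" using yz abpos pqpos \<open>x > 0\<close> by (simp_all add: zero_less_mult_iff)
      have "t > 0" using t abpos xyz by (simp add: zero_less_mult_iff)
      have q: "q = y * t" using \<open>y * b = z * q\<close> xyz unfolding t by simp
      have key: "x^2 * (y^2 - z^2) = t^2 * (4 * y^2 - z^2)"
      proof -
        have "a^2 + b^2 = p^2 + 4 * q^2" using ab(3) pq(3) by simp
        then show ?thesis unfolding yz t q by (simp add: power_mult_distrib algebra_simps)
      qed
      have "coprime x t" using pq(5) unfolding yz q by simp
      then have "coprime (t^2) (x^2)" by (simp add: coprime_commute)
      moreover have "t^2 dvd x^2 * (y^2 - z^2)" using key by simp
      ultimately have "t^2 dvd y^2 - z^2" by (simp add: coprime_dvd_mult_right_iff)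
      then obtain k where k: "y^2 - z^2 = k * t^2" by (metis dvd_def mult.commute)
      have "t^2 * (4 * y^2 - z^2) = t^2 * (k * x^2)" using key unfolding k by algebra
      then have k': "4 * y^2 - z^2 = k * x^2" using \<open>t > 0\<close> by simp
      have "k \<in> {1, - 1, 3, - 3}"
      proof -
        have "3 * y^2 = (4 * y^2 - z^2) - (y^2 - z^2)" "3 * z^2 = (4 * y^2 - z^2) - 4 * (y^2 - z^2)"
          by simp_all
        then have "k dvd 3 * y^2" "k dvd 3 * z^2" unfolding k k' by simp_all
        moreover have "coprime (y^2) (z^2)" using \<open>coprime y z\<close> by simp
        ultimately have "k dvd 3" by (metis dvd_three_of_coprime)
        then show ?thesis by (rule dvd_three_cases)
      qed
      from twisted_concordant[OF \<open>x > 0\<close> xyz(1) xyz(2) \<open>t > 0\<close> this k k']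
      obtain m f where mf: "m \<in> {x, y, z, t}" "concordant m f" by blast
      have "x \<le> a" "y \<le> a" "z \<le> b" "t \<le> b" using yz t \<open>x > 0\<close> xyz \<open>t > 0\<close> by simp_all
      moreover have "a \<le> a^2" "b \<le> b^2" using abpos by (simp_all add: power2_eq_square)
      moreover have "0 < a^2" "0 < b^2" using abpos by simp_all
      ultimately have "x < M" "y < M" "z < M" "t < M" unfolding ab(3) by linarith+
      then have "m < M" using mf(1) by blast
      then show False using IH mf(2) by blast
    qed
  qed
qed

lemma no_twisted_concordant:
  fixes a b c d k :: int
  assumes "a \<noteq> 0" "b \<noteq> 0" "c \<noteq> 0" "d \<noteq> 0" "k \<in> {1, - 1, 3, - 3}"
    and "b^2 - c^2 = k * d^2" "4 * b^2 - c^2 = k * a^2"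
  shows False
  using twisted_concordant[of "\<bar>a\<bar>" "\<bar>b\<bar>" "\<bar>c\<bar>" "\<bar>d\<bar>" k] assms no_concordant by auto

text \<open>The common divisors of \<open>M\<^sup>2 - e\<^sup>2\<close> and \<open>M\<^sup>2 - 4 e\<^sup>2\<close> divide \<open>3\<close>, so if the product is a square, both are \<open>k\<close> times
  squares with \<open>k \<in> {\<plusminus> 1, \<plusminus> 3}\<close>.\<close>

theorem product_of_concordant_forms_not_square:
  fixes w n :: rat
  assumes eq: "(w^2 - 1) * (w^2 - 4) = n^2"
  shows "w = 0 \<or> n = 0"
proof (rule ccontr)
  assume "\<not> ?thesis"
  then have "w \<noteq> 0" "n \<noteq> 0" by simp_all
  obtain M e where Me: "quotient_of w = (M, e)" by (cases "quotient_of w")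
  then have e: "e > 0" and cop: "coprime M e" and w: "w = of_int M / of_int e"
    using quotient_of_denom_pos quotient_of_coprime quotient_of_div by auto
  have "M \<noteq> 0" using \<open>w \<noteq> 0\<close> w by auto
  define X where "X = M^2 - e^2"
  define Y where "Y = M^2 - 4 * e^2"
  have ew: "of_int e * w = of_int M" using w e by simp
  have "(n * of_int e ^ 2)^2 = n^2 * (of_int e ^ 2)^2" by (simp only: power_mult_distrib)
  also have "\<dots> = (of_int e ^ 2 * (w^2 - 1)) * (of_int e ^ 2 * (w^2 - 4))"
    unfolding eq[symmetric] by algebra
  also have "of_int e ^ 2 * (w^2 - 1) = of_int X"
    using ew[symmetric] by (simp add: X_def power_mult_distrib algebra_simps)
  also have "of_int e ^ 2 * (w^2 - 4) = of_int Y"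
    using ew[symmetric] by (simp add: Y_def power_mult_distrib algebra_simps)
  finally have sq: "(n * of_int e ^ 2)^2 = of_int (X * Y)" by simp
  then obtain j where j: "n * of_int e ^ 2 = of_int j" "X * Y = j^2" by (rule rat_square_int)
  have "j \<noteq> 0" using j(1) \<open>n \<noteq> 0\<close> e by auto
  have comb: "X - Y = 3 * e^2" "4 * X - Y = 3 * M^2" by (simp_all add: X_def Y_def)
  have cop2: "coprime (M^2) (e^2)" using cop by simp
  \<comment> \<open>Up to a common factor \<open>3\<close> the two forms are coprime, hence squares up to sign.\<close>
  obtain k X' Y' j' where split: "k = 1 \<or> k = 3" "X = k * X'" "Y = k * Y'" "coprime X' Y'" "X' * Y' = j'^2"
  proof (cases "3 dvd X")
    case True
    have "Y = X - 3 * e^2" using comb by simp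
    then have "3 dvd Y" using True by simp
    then obtain X' Y' where XY: "X = 3 * X'" "Y = 3 * Y'" using \<open>3 dvd X\<close> by (elim dvdE)
    have "j^2 = 3^2 * (X' * Y')" using j(2) XY by simp
    then have "3^2 dvd j^2" by (metis dvd_triv_left)
    then have "3 dvd j" by (simp only: pow_divides_pow_iff zero_less_numeral)
    then obtain j' where j': "j = 3 * j'" by (elim dvdE)
    have "X' * Y' = j'^2" using j(2) XY j' by (simp add: power_mult_distrib)
    moreover have "coprime X' Y'"
    proof (rule coprimeI)
      fix g assume "g dvd X'" "g dvd Y'"
      moreover have "e^2 = X' - Y'" "M^2 = 4 * X' - Y'" using comb XY by simp_all
      ultimately have "g dvd e^2" "g dvd M^2" by simp_all
      then show "is_unit g" using cop2 by (metis coprime_common_divisor)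
    qed
    ultimately show ?thesis using XY by (intro that[of 3 X' Y' j']) simp_all
  next
    case False
    have "coprime X Y"
    proof (rule coprimeI)
      fix g assume g: "g dvd X" "g dvd Y"
      then have "g dvd X - Y" "g dvd 4 * X - Y" by simp_all
      then have "g dvd 3" using dvd_three_of_coprime[OF cop2] unfolding comb by blast
      then have "g \<in> {1, - 1, 3, - 3}" by (rule dvd_three_cases)
      then have "is_unit g \<or> 3 dvd g" by auto
      then show "is_unit g" using False g(1) by (metis dvd_trans)
    qed
    then show ?thesis using j by (intro that[of 1 X Y j]) simp_all
  qed
  have nz: "X' \<noteq> 0" "Y' \<noteq> 0" using split j \<open>j \<noteq> 0\<close> by auto
  have "0 \<le> X' * Y'" using split(5) by simp
  then consider "X' \<ge> 0" "Y' \<ge> 0" | "- X' \<ge> 0" "- Y' \<ge> 0" by (auto simp: zero_le_mult_iff)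
  then show False
  proof cases
    case 1
    obtain a b where "X' = a^2" "Y' = b^2" by (rule coprime_mult_square[OF split(4,5) 1])
    then show False
      using no_twisted_concordant[of b e M a "- k"] nz e \<open>M \<noteq> 0\<close> split X_def Y_def by auto
  next
    case 2
    have "coprime (- X') (- Y')" "(- X') * (- Y') = j'^2" using split by simp_all
    then obtain a b where "- X' = a^2" "- Y' = b^2" using 2 by (elim coprime_mult_square)
    then have "X' = - (a^2)" "Y' = - (b^2)" by simp_all
    then show False
      using no_twisted_concordant[of b e M a k] nz e \<open>M \<noteq> 0\<close> split X_def Y_def by auto
  qed
qed

text \<open>The curve \<open>y\<^sup>2 = x (x - 1) (x - 4)\<close> has no rational points besides those of order two: the abscissa
  of the double of a point is a square \<open>w\<^sup>2\<close>, so that the preceding result applies to it.\<close>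

theorem curve_48a1_points:
  fixes x y :: rat
  assumes eq: "y^2 = x * (x - 1) * (x - 4)"
  shows "y = 0"
proof (rule ccontr)
  assume y: "y \<noteq> 0"
  define w where "w = (x^2 - 4) / (2 * y)"
  define n where "n = (x^2 - 2 * x + 4) * (x^2 - 8 * x + 4) / (2 * y)^2"
  have wy: "w * (2 * y) = x^2 - 4" using y by (simp add: w_def)
  have y2: "(2 * y)^2 = 4 * (x * (x - 1) * (x - 4))" using eq by algebra
  have y0: "(2 * y)^2 \<noteq> 0" using y by simp
  have "(2 * y)^2 * (w^2 - 1) = (w * (2 * y))^2 - (2 * y)^2" by algebra
  also have "\<dots> = (x^2 - 2 * x + 4)^2" unfolding wy y2 by algebra
  finally have w1: "(2 * y)^2 * (w^2 - 1) = (x^2 - 2 * x + 4)^2" .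
  have "(2 * y)^2 * (w^2 - 4) = (w * (2 * y))^2 - 4 * (2 * y)^2" by algebra
  also have "\<dots> = (x^2 - 8 * x + 4)^2" unfolding wy y2 by algebra
  finally have w4: "(2 * y)^2 * (w^2 - 4) = (x^2 - 8 * x + 4)^2" .
  have n: "(2 * y)^2 * n = (x^2 - 2 * x + 4) * (x^2 - 8 * x + 4)" using y0 by (simp add: n_def)
  have "((2 * y)^2)^2 * ((w^2 - 1) * (w^2 - 4)) = ((2 * y)^2 * (w^2 - 1)) * ((2 * y)^2 * (w^2 - 4))" by algebra
  also have "\<dots> = ((2 * y)^2 * n)^2" unfolding w1 w4 n by algebra
  finally have "((2 * y)^2)^2 * ((w^2 - 1) * (w^2 - 4)) = ((2 * y)^2)^2 * n^2"
    by (simp only: power_mult_distrib)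
  then have "(w^2 - 1) * (w^2 - 4) = n^2" using y0 by simp
  then consider "w = 0" | "n = 0" using product_of_concordant_forms_not_square by blast
  then show False
  proof cases
    case 1
    then have "(x - 2) * (x + 2) = 0" using wy by algebra
    then have "x = 2 \<or> x = - 2" by (auto simp: eq_neg_iff_add_eq_0)
    then have "y^2 < 0" using eq by auto
    then show False by (simp add: not_less flip: power2_less_0)
  next
    case 2
    then have "(x^2 - 2 * x + 4) * (x^2 - 8 * x + 4) = 0" using n by simp
    moreover have "x^2 - 2 * x + 4 \<noteq> 0"
    proof -
      have "x^2 - 2 * x + 4 = (x - 1)^2 + 3" by algebra
      moreover have "0 \<le> (x - 1)^2" by simp
      ultimately show ?thesis by linarith
    qed
    ultimately have "x^2 - 8 * x + 4 = 0" by simp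
    then have "(x - 4)^2 = 12" by algebra
    then have "((x - 4) / 2)^2 = 3" by (simp add: power_divide)
    then show False using two_three_not_rat_square by blast
  qed
qed

section \<open>Three-isogenies and the two curves of rank zero\<close>

text \<open>A root \<open>X\<close> of the third division polynomial is the abscissa of a flex. There \<open>f(X + r)\<close> is the
  cube \<open>r\<^sup>3\<close> plus a multiple of the square of the linear form \<open>2 r + k X\<close> (\<open>cubic_at_flex\<close>).\<close>

lemma three_isogeny_normal_form:
  fixes A B X :: "'a::field_char_0"
  assumes psi: "3 * X^4 + 6 * A * X^2 + 12 * B * X - A^2 = 0" and X: "X \<noteq> 0"
  obtains k where "A = 3 * X^2 * (k - 1)" "4 * B = X^3 * (3 * k^2 - 12 * k + 8)"
proof -
  define k where "k = A / (3 * X^2) + 1"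
  have A: "A = 3 * X^2 * (k - 1)" using X by (simp add: k_def)
  have "3 * X * (4 * B) = 3 * X * (X^3 * (3 * k^2 - 12 * k + 8))"
    using psi unfolding A by algebra
  then have "4 * B = X^3 * (3 * k^2 - 12 * k + 8)" using X by simp
  with A show ?thesis by (rule that)
qed

lemma cubic_at_flex:
  fixes A B X :: "'a::field_char_0"
  assumes "A = 3 * X^2 * (k - 1)" "4 * B = X^3 * (3 * k^2 - 12 * k + 8)"
  shows "4 * ((X + r)^3 + A * (X + r) + B) = 4 * r^3 + 3 * X * (2 * r + X * k)^2"
proof -
  have "4 * ((X + r)^3 + A * (X + r) + B) = 4 * (X + r)^3 + 4 * A * (X + r) + 4 * B" by algebra
  then show ?thesis unfolding assms by algebra
qed

text \<open>Over the rationals a curve with a rational three-isogeny and full rational two-torsion cannot have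
  the product of two adjacent root gaps a square: at a flex the roots are \<open>X - 3 X \<sigma>\<^sup>2\<close> with
  \<open>\<sigma>\<^sup>3 - \<sigma>\<^sup>2 + \<nu> = 0\<close>, and \<open>- 2 \<sigma>\<^sub>1 / \<sigma>\<^sub>2\<close> is the abscissa of a point of \<open>y\<^sup>2 = x (x - 1) (x - 4)\<close>.\<close>

lemma three_isogeny_gap_product_not_square:
  fixes e1 e2 e3 X w :: rat
  assumes sum: "e1 + e2 + e3 = 0" and ne: "e1 \<noteq> e2" "e2 \<noteq> e3" "e3 \<noteq> e1"
    and A: "A = e1 * e2 + e1 * e3 + e2 * e3" and B: "B = - (e1 * e2 * e3)"
    and psi: "3 * X^4 + 6 * A * X^2 + 12 * B * X - A^2 = 0"
  shows "(e3 - e2) * (e1 - e3) \<noteq> w^2"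
proof
  assume w: "(e3 - e2) * (e1 - e3) = w^2"
  have w0: "w \<noteq> 0" using w ne by auto
  have e3: "e3 = - e1 - e2" using sum by algebra
  have X: "X \<noteq> 0"
  proof
    assume "X = 0"
    then have "A = 0" using psi by simp
    moreover have "- 4 * A = (2 * e1 + e2)^2 + 3 * e2^2" unfolding A e3 by algebra
    ultimately have "(2 * e1 + e2)^2 + 3 * e2^2 = 0" by simp
    then have "(2 * e1 + e2)^2 = 0" "e2^2 = 0"
      using zero_le_power2[of "2 * e1 + e2"] zero_le_power2[of e2] by linarith+
    then show False using ne by simp
  qed
  obtain k where k: "A = 3 * X^2 * (k - 1)" "4 * B = X^3 * (3 * k^2 - 12 * k + 8)"
    by (rule three_isogeny_normal_form[OF psi X])
  define h where "h = X * k / 2"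
  have root: "r^3 = - (3 * X * (r + h)^2)" if "X + r \<in> {e1, e2, e3}" for r
  proof -
    have "(X + r - e1) * (X + r - e2) * (X + r - e3) = 0" using that by auto
    moreover have "(X + r - e1) * (X + r - e2) * (X + r - e3) = (X + r)^3 + A * (X + r) + B"
      unfolding A B e3 by algebra
    ultimately have "4 * r^3 + 3 * X * (2 * r + X * k)^2 = 0"
      using cubic_at_flex[OF k, of r] by simp
    moreover have "2 * r + X * k = 2 * (r + h)" by (simp add: h_def)
    ultimately have "4 * (r^3 + 3 * X * (r + h)^2) = 0"
      by (simp only: power_mult_distrib) algebra
    then show ?thesis by (simp add: eq_neg_iff_add_eq_0)
  qed
  define r1 r2 r3 where "r1 = e1 - X" and "r2 = e2 - X" and "r3 = e3 - X"
  have r: "r1^3 = - (3 * X * (r1 + h)^2)" "r2^3 = - (3 * X * (r2 + h)^2)" "r3^3 = - (3 * X * (r3 + h)^2)"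
    by (rule root; simp add: r1_def r2_def r3_def)+
  have rne: "r1 \<noteq> r2" "r2 \<noteq> r3" "r3 \<noteq> r1" using ne by (simp_all add: r1_def r2_def r3_def)
  have h: "h \<noteq> 0"
  proof
    assume "h = 0"
    then have "r1^2 * (r1 + 3 * X) = 0" "r2^2 * (r2 + 3 * X) = 0" "r3^2 * (r3 + 3 * X) = 0"
      using r by algebra+
    then show False using rne by (auto simp: eq_neg_iff_add_eq_0[symmetric])
  qed
  then have r0: "r1 \<noteq> 0" "r2 \<noteq> 0" "r3 \<noteq> 0" using r X by auto
  define s1 s2 s3 where "s1 = (r1 + h) / r1" and "s2 = (r2 + h) / r2" and "s3 = (r3 + h) / r3"
  have sr: "s1 * r1 = r1 + h" "s2 * r2 = r2 + h" "s3 * r3 = r3 + h"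
    using r0 by (simp_all add: s1_def s2_def s3_def)
  have rs: "p = - (3 * X * s^2)" if "p^3 = - (3 * X * (p + h)^2)" "s * p = p + h" "p \<noteq> 0" for p s
  proof -
    have "p^2 * (p + 3 * X * s^2) = 0" using that(1) unfolding that(2)[symmetric] by algebra
    then show ?thesis using that(3) by (simp add: eq_neg_iff_add_eq_0)
  qed
  have rs1: "r1 = - (3 * X * s1^2)" and rs2: "r2 = - (3 * X * s2^2)" and rs3: "r3 = - (3 * X * s3^2)"
    using rs r sr r0 by blast+
  have sne: "s1 \<noteq> s2" "s2 \<noteq> s3" "s3 \<noteq> s1" using rne rs1 rs2 rs3 by auto
  have s0: "s1 \<noteq> 0" "s2 \<noteq> 0" using r0 rs1 rs2 by auto
  have cubic: "3 * X * (s1^3 - s1^2) = - h" "3 * X * (s2^3 - s2^2) = - h" "3 * X * (s3^3 - s3^2) = - h"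
    using sr unfolding rs1 rs2 rs3 by algebra+
  have "3 * X * (s1 - s2) * (s1^2 + s1 * s2 + s2^2 - (s1 + s2)) = 3 * X * (s1^3 - s1^2) - 3 * X * (s2^3 - s2^2)"
    by algebra
  then have s12: "s1^2 + s1 * s2 + s2^2 - (s1 + s2) = 0" using cubic sne X by simp
  have "3 * X * (s1 - s3) * (s1^2 + s1 * s3 + s3^2 - (s1 + s3)) = 3 * X * (s1^3 - s1^2) - 3 * X * (s3^3 - s3^2)"
    by algebra
  then have s13: "s1^2 + s1 * s3 + s3^2 - (s1 + s3) = 0" using cubic sne X by simp
  have "(s2 - s3) * (s1 + s2 + s3 - 1) = (s1^2 + s1 * s2 + s2^2 - (s1 + s2)) - (s1^2 + s1 * s3 + s3^2 - (s1 + s3))"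
    by algebra
  then have "(s2 - s3) * (s1 + s2 + s3 - 1) = 0" unfolding s12 s13 by simp
  then have "s1 + s2 + s3 - 1 = 0" using sne by simp
  then have s3: "s3 = 1 - s1 - s2" by simp
  define s where "s = s1 + s2"
  have s3s: "s3 * s = - (s1 * s2)" using s12 unfolding s_def s3 by algebra
  have s: "s \<noteq> 0" using s3s s0 by auto
  have gaps: "e3 - e2 = 3 * X * (s2^2 - s3^2)" "e1 - e3 = 3 * X * (s3^2 - s1^2)"
    using rs1 rs2 rs3 unfolding r1_def r2_def r3_def by algebra+
  have "s^2 * (s2^2 - s3^2) = s^2 * s2^2 - (s3 * s)^2" by algebra
  then have g1: "s^2 * (s2^2 - s3^2) = s2^3 * (2 * s1 + s2)" unfolding s3s unfolding s_def by algebra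
  have "s^2 * (s3^2 - s1^2) = (s3 * s)^2 - s^2 * s1^2" by algebra
  then have g2: "s^2 * (s3^2 - s1^2) = - (s1^3 * (s1 + 2 * s2))" unfolding s3s unfolding s_def by algebra
  have "s^4 * w^2 = 9 * X^2 * (s^2 * (s2^2 - s3^2)) * (s^2 * (s3^2 - s1^2))"
    unfolding w[symmetric] gaps by algebra
  then have sw: "s^4 * w^2 = - (9 * X^2 * (s2^3 * (2 * s1 + s2)) * (s1^3 * (s1 + 2 * s2)))"
    unfolding g1 g2 by simp
  define x where "x = - 2 * s1 / s2"
  define y where "y = 2 * w * s^2 / (3 * X * s1 * s2^3)"
  have xs: "s2 * x = - 2 * s1" using s0 by (simp add: x_def)
  have "s2^3 * (x * (x - 1) * (x - 4)) = (s2 * x) * (s2 * x - s2) * (s2 * x - 4 * s2)" by algebra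
  then have xx: "s2^3 * (x * (x - 1) * (x - 4)) = - 4 * s1 * (2 * s1 + s2) * (s1 + 2 * s2)"
    unfolding xs by algebra
  have ys: "(3 * X * s1 * s2^3) * y = 2 * w * s^2" using X s0 by (simp add: y_def)
  have "9 * X^2 * s1^2 * s2^6 * y^2 = ((3 * X * s1 * s2^3) * y)^2" by algebra
  also have "\<dots> = 4 * (s^4 * w^2)" unfolding ys by algebra
  also have "\<dots> = 9 * X^2 * s1^2 * s2^3 * (s2^3 * (x * (x - 1) * (x - 4)))"
    unfolding sw xx by algebra
  also have "\<dots> = 9 * X^2 * s1^2 * s2^6 * (x * (x - 1) * (x - 4))" by algebra
  finally have "y^2 = x * (x - 1) * (x - 4)" using X s0 by simp
  then have "y = 0" by (rule curve_48a1_points)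
  then show False using ys w0 s by simp
qed

text \<open>The curve \<open>y\<^sup>2 = x\<^sup>3 - 14 x\<^sup>2 + 81 x\<close> maps to \<open>y\<^sup>2 = x (x - 1) (x - 4)\<close> by an
  isogeny of degree four. The image has as abscissa the square of \<open>w = y (x + 9)/(4 x (x - 9))\<close>.\<close>

lemma curve_Z8_points:
  fixes x y :: rat
  assumes eq: "y^2 = x * (x^2 - 14 * x + 81)"
  shows "x \<in> {0, 3, 9, 27}"
proof (rule ccontr)
  assume x: "x \<notin> {0, 3, 9, 27}"
  then have x0: "x \<noteq> 0" "x - 9 \<noteq> 0" by auto
  define D where "D = 16 * x * (x - 9)^2"
  have D: "D \<noteq> 0" using x0 by (simp add: D_def)
  define w where "w = y * (x + 9) / (4 * x * (x - 9))"
  define n where "n = (x^2 - 6 * x + 81) * (x^2 - 30 * x + 81) / D"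
  have w: "w * (4 * x * (x - 9)) = y * (x + 9)" using x0 by (simp add: w_def)
  have n: "D * n = (x^2 - 6 * x + 81) * (x^2 - 30 * x + 81)" using D by (simp add: n_def)
  have "x * (D * w^2) = (w * (4 * x * (x - 9)))^2" unfolding D_def by algebra
  also have "\<dots> = y^2 * (x + 9)^2" unfolding w by algebra
  also have "\<dots> = x * ((x^2 - 14 * x + 81) * (x + 9)^2)" unfolding eq by algebra
  finally have Dw: "D * w^2 = (x^2 - 14 * x + 81) * (x + 9)^2" using x0 by simp
  have "D * (w^2 - 1) = D * w^2 - D" by algebra
  also have "\<dots> = (x^2 - 6 * x + 81)^2" unfolding Dw unfolding D_def by algebra
  finally have w1: "D * (w^2 - 1) = (x^2 - 6 * x + 81)^2" .
  have "D * (w^2 - 4) = D * w^2 - 4 * D" by algebra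
  also have "\<dots> = (x^2 - 30 * x + 81)^2" unfolding Dw unfolding D_def by algebra
  finally have w4: "D * (w^2 - 4) = (x^2 - 30 * x + 81)^2" .
  have "D^2 * ((w^2 - 1) * (w^2 - 4)) = (D * (w^2 - 1)) * (D * (w^2 - 4))" by algebra
  also have "\<dots> = (D * n)^2" unfolding w1 w4 n by algebra
  finally have "D^2 * ((w^2 - 1) * (w^2 - 4)) = D^2 * n^2" by (simp only: power_mult_distrib)
  then have "(w^2 - 1) * (w^2 - 4) = n^2" using D by simp
  then consider "w = 0" | "n = 0" using product_of_concordant_forms_not_square by blast
  then show False
  proof cases
    case 1
    then have "y = 0 \<or> x = - 9" using w by (auto simp: eq_neg_iff_add_eq_0)
    then show False
    proof
      assume "y = 0"
      then have "x^2 - 14 * x + 81 = 0" using eq x0 by simp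
      moreover have "x^2 - 14 * x + 81 = (x - 7)^2 + 32" by algebra
      moreover have "0 \<le> (x - 7)^2" by simp
      ultimately show False by linarith
    next
      assume "x = - 9"
      then have "y^2 = - 2592" using eq by simp
      moreover have "0 \<le> y^2" by simp
      ultimately show False by linarith
    qed
  next
    case 2
    have "x^2 - 6 * x + 81 = (x - 3)^2 + 72" by algebra
    moreover have "0 \<le> (x - 3)^2" by simp
    ultimately have "x^2 - 6 * x + 81 \<noteq> 0" by linarith
    then have "x^2 - 30 * x + 81 = 0" using 2 n by simp
    then have "(x - 3) * (x - 27) = 0" by algebra
    then show False using x by simp
  qed
qed

section \<open>Rational points of the genus one curve\<close>

lemma rational_sqrt_of_fourth_power:
  fixes x y :: rat
  assumes "y^2 = x^4" shows "y = x^2 \<or> y = - (x^2)"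
proof -
  have "(y - x^2) * (y + x^2) = y^2 - x^4" by algebra
  then show ?thesis using assms by (auto simp: eq_neg_iff_add_eq_0)
qed

lemma square_eq_three_squares:
  fixes x y :: rat
  assumes "x^2 = 3 * y^2" shows "y = 0"
proof (rule ccontr)
  assume "y \<noteq> 0"
  then have "(x / y)^2 = 3" using assms by (simp add: power_divide)
  then show False using two_three_not_rat_square by blast
qed

text \<open>Eliminating \<open>s\<close> leaves a quadratic equation for \<open>k\<close> over \<open>\<rat>(G)\<close>. Its discriminant is
  \<open>(G\<^sup>2 - 2 G - 2)\<^sup>2 ((G\<^sup>2 + 2 G + 6)\<^sup>2 + 96 G)\<close>, so \<open>G\<close> is the parameter of a point on the genus one curve
  \<open>Z\<^sup>2 = (G\<^sup>2 + 2 G + 6)\<^sup>2 + 96 G\<close>, which is birational to the curve of \<open>curve_Z8_points\<close>.\<close>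

lemma genus_one_fibre:
  fixes k s G :: rat
  assumes k: "k \<noteq> 0" and G: "G \<noteq> 0"
    and G3: "s * (9 * k - 8) = - (G^3)" and Gk: "G * (k * (s + 4)) = 12 * (k - 1)"
  shows "k \<in> {32/9, - 1/9, - 8/3}"
proof -
  have "(9 * k - 8) * (G * (k * (s + 4))) = G * k * (s * (9 * k - 8)) + 4 * G * k * (9 * k - 8)" by algebra
  then have quad: "k^2 * (108 - 36 * G) + k * (G^4 + 32 * G - 204) + 96 = 0"
    unfolding Gk G3 by algebra
  define D where "D = G^2 - 2 * G - 2"
  define N where "N = 2 * k * (108 - 36 * G) + (G^4 + 32 * G - 204)"
  define H where "H = G^2 + 2 * G + 6"
  have D: "D \<noteq> 0"
  proof
    assume "D = 0"
    then have "(G - 1)^2 = 3" unfolding D_def by algebra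
    then show False using two_three_not_rat_square by blast
  qed
  define Z where "Z = N / D"
  have ZD: "Z * D = N" using D by (simp add: Z_def)
  have "D^2 * Z^2 = (Z * D)^2" by algebra
  also have "\<dots> = 4 * (108 - 36 * G) * (k^2 * (108 - 36 * G) + k * (G^4 + 32 * G - 204) + 96)
      + ((G^4 + 32 * G - 204)^2 - 384 * (108 - 36 * G))"
    unfolding ZD N_def by algebra
  also have "\<dots> = D^2 * (H^2 + 96 * G)" unfolding quad unfolding D_def H_def by algebra
  finally have Z: "Z^2 = H^2 + 96 * G" using D by simp
  define x where "x = (Z + H) / 2 + 3"
  define y where "y = (x - 3) * (G + 1) + 12"
  have "2 * x = Z + H + 6" unfolding x_def by simp
  then have Zx: "Z = 2 * x - 6 - H" by linarith
  have rel: "(x - 9 - G^2 - 2 * G) * (x - 3) = 24 * G"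
    using Z unfolding Zx H_def by algebra
  have "y^2 = (x - 3) * ((x - 3) * (x - 8) - (x - 9 - G^2 - 2 * G) * (x - 3)) + 24 * G * (x - 3) + 24 * (x - 3) + 144"
    unfolding y_def by algebra
  also have "\<dots> = x * (x^2 - 14 * x + 81)" unfolding rel by algebra
  finally have "x \<in> {0, 3, 9, 27}" by (rule curve_Z8_points)
  then consider "x = 0" | "x = 3" | "x = 9" | "x = 27" by blast
  then have "G = 3 \<or> G = - 6"
  proof cases
    case 1
    then have "(G - 3)^2 = 0" using rel by algebra
    then show ?thesis by simp
  next
    case 2
    then show ?thesis using rel G by simp
  next
    case 3
    have "6 * (G * (G + 6)) = 0" using rel unfolding 3 by algebra
    then show ?thesis using G by (simp add: eq_neg_iff_add_eq_0)
  next
    case 4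
    have "24 * ((G - 3) * (G + 6)) = 0" using rel unfolding 4 by algebra
    then show ?thesis by (simp add: eq_neg_iff_add_eq_0)
  qed
  then show ?thesis
  proof
    assume "G = 3"
    then have "k = 32 / 9" using quad by simp
    then show ?thesis by simp
  next
    assume "G = - 6"
    then have "(9 * k + 1) * (3 * k + 8) = 0" using quad by algebra
    then have "9 * k = - 1 \<or> 3 * k = - 8" by (simp add: eq_neg_iff_add_eq_0)
    then show ?thesis by auto
  qed
qed

text \<open>The parameters \<open>m\<close> and \<open>k\<close> compute the \<open>j\<close>-invariant in two ways, as \<open>- 64 s (s + 4)\<^sup>3\<close> with \<open>s = m\<^sup>3/q\<close> and
  as \<open>1728 \<cdot> 64 (k - 1)\<^sup>3/(k\<^sup>3 (9 k - 8))\<close>. Equality says that \<open>- s (9 k - 8)\<close> is the cube of \<open>12 (k - 1)/(k (s + 4))\<close>.\<close>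

lemma three_isogeny_fourth_power_curve:
  fixes A B q m X :: rat
  assumes q: "q \<noteq> 0" and m: "m^4 + 4 * q * m + 3 * A = 0"
    and disc: "4 * A^3 + 27 * B^2 = 4 * q^4"
    and psi: "3 * X^4 + 6 * A * X^2 + 12 * B * X - A^2 = 0"
  obtains k where "A = 3 * X^2 * (k - 1)" "4 * B = X^3 * (3 * k^2 - 12 * k + 8)"
    "27 * X^6 * (k^3 * (9 * k - 8)) = 64 * q^4" "k \<in> {32/9, - 1/9, - 8/3}" "X \<noteq> 0"
proof -
  have A: "A \<noteq> 0"
  proof
    assume "A = 0"
    then have "27 * B^2 = 4 * q^4" using disc by simp
    then have "(9 * B)^2 = 3 * (2 * q^2)^2" by algebra
    then have "2 * q^2 = 0" by (rule square_eq_three_squares)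
    then show False using q by simp
  qed
  then have X: "X \<noteq> 0" using psi by auto
  obtain k where k: "A = 3 * X^2 * (k - 1)" "4 * B = X^3 * (3 * k^2 - 12 * k + 8)"
    by (rule three_isogeny_normal_form[OF psi X])
  have "64 * q^4 = 64 * A^3 + 27 * (4 * B)^2" using disc by algebra
  then have disc': "27 * X^6 * (k^3 * (9 * k - 8)) = 64 * q^4" unfolding k by algebra
  then have k0: "k \<noteq> 0" "9 * k - 8 \<noteq> 0" using q by auto
  have k1: "k - 1 \<noteq> 0" using A k by auto
  define s where "s = m^3 / q"
  have s: "m^3 = q * s" using q by (simp add: s_def)
  have A3: "3 * A = - (m * (q * (s + 4)))"
  proof -
    have "3 * A = - (m * (m^3 + 4 * q))" using m by algebra
    then show ?thesis unfolding s by (simp add: distrib_left)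
  qed
  have s4: "k * (s + 4) \<noteq> 0" using A3 A k0 by auto
  define G where "G = 12 * (k - 1) / (k * (s + 4))"
  have Gk: "G * (k * (s + 4)) = 12 * (k - 1)" using s4 by (simp add: G_def)
  have G0: "G \<noteq> 0" using k1 s4 by (simp add: G_def)
  have G3: "s * (9 * k - 8) = - (G^3)"
  proof -
    have "64 * (9 * X^2 * (k - 1))^3 = 64 * (3 * A)^3" unfolding k by algebra
    also have "\<dots> = - (m^3 * q^3 * (s + 4)^3 * 64)" unfolding A3 by algebra
    also have "\<dots> = - (s * (s + 4)^3 * (64 * q^4))" unfolding s by algebra
    also have "\<dots> = - (s * (s + 4)^3 * (27 * X^6 * (k^3 * (9 * k - 8))))" unfolding disc' ..
    finally have "27 * X^6 * ((12 * (k - 1))^3 + s * (9 * k - 8) * (k * (s + 4))^3) = 0" by algebra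
    then have "(12 * (k - 1))^3 + s * (9 * k - 8) * (k * (s + 4))^3 = 0"
      using X by (metis mult_eq_0_iff power_eq_0_iff zero_neq_numeral)
    then have "(k * (s + 4))^3 * (s * (9 * k - 8) + G^3) = 0" unfolding Gk[symmetric] by algebra
    then have "s * (9 * k - 8) + G^3 = 0" using s4 by (metis mult_eq_0_iff power_eq_0_iff)
    then show ?thesis by (simp only: eq_neg_iff_add_eq_0)
  qed
  have "k \<in> {32/9, - 1/9, - 8/3}" by (rule genus_one_fibre[OF k0(1) G0 G3 Gk])
  then show ?thesis using that k disc' X by blast
qed

text \<open>The parameter \<open>k = - 8/3\<close> belongs to \<open>x\<^sup>3 - 11 x + 46/3\<close> and its twists. In a rational root the prime \<open>3\<close> would
  divide the denominator and then the numerator.\<close>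

lemma cubic_no_rational_root:
  fixes t :: rat
  shows "3 * t^3 - 33 * t + 46 \<noteq> 0"
proof
  assume eq: "3 * t^3 - 33 * t + 46 = 0"
  obtain p q where pq: "quotient_of t = (p, q)" by (cases "quotient_of t")
  then have q: "q > 0" and cop: "coprime p q" and t: "t = of_int p / of_int q"
    using quotient_of_denom_pos quotient_of_coprime quotient_of_div by auto
  have tq: "t * of_int q = of_int p" using t q by simp
  have "3 * (t * of_int q)^3 - 33 * (t * of_int q) * of_int q ^ 2 + 46 * of_int q ^ 3 =
      (3 * t^3 - 33 * t + 46) * of_int q ^ 3" by algebra
  then have "of_int (3 * p^3 - 33 * p * q^2 + 46 * q^3) = (0 :: rat)"
    unfolding tq eq by simp
  then have *: "3 * p^3 - 33 * p * q^2 + 46 * q^3 = 0" by (simp only: of_int_eq_0_iff)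
  then have "q^3 = 3 * (11 * p * q^2 - p^3 - 15 * q^3)" by simp
  then have "3 dvd q^3" by (metis dvd_triv_left)
  then have q3: "3 dvd q" by (rule prime_dvd_power[rotated]) simp
  then obtain r where r: "q = 3 * r" by blast
  have "3 * p^3 = 3 * (3 * (33 * p * r^2 - 138 * r^3))" using * unfolding r by algebra
  then have "p^3 = 3 * (33 * p * r^2 - 138 * r^3)" by simp
  then have "3 dvd p^3" by (metis dvd_triv_left)
  then have "3 dvd p" by (rule prime_dvd_power[rotated]) simp
  then have "is_unit (3::int)" using q3 cop by (metis coprime_common_divisor)
  then show False by simp
qed

text \<open>The disjunction on \<open>X\<close> serves to exclude \<open>k = - 8/3\<close>, where \<open>X\<close> is plus or minus a square and \<open>f\<close> is
  irreducible.\<close>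

theorem rational_points_classified:
  fixes A B q m X :: rat
  assumes q: "q \<noteq> 0" and m: "m^4 + 4 * q * m + 3 * A = 0"
    and disc: "4 * A^3 + 27 * B^2 = 4 * q^4"
    and psi: "3 * X^4 + 6 * A * X^2 + 12 * B * X - A^2 = 0"
    and extra: "(\<exists>c. 3 * X = c^2 \<or> 3 * X = - (c^2)) \<or> (\<exists>t. t^3 + A * t + B = 0)"
  obtains u where "u \<noteq> 0" "A = 69 * u^4" "B = 22 * u^6 \<or> B = - 22 * u^6"
proof -
  obtain k where k: "A = 3 * X^2 * (k - 1)" "4 * B = X^3 * (3 * k^2 - 12 * k + 8)"
    "27 * X^6 * (k^3 * (9 * k - 8)) = 64 * q^4" "k \<in> {32/9, - 1/9, - 8/3}" and X: "X \<noteq> 0"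
    by (rule three_isogeny_fourth_power_curve[OF q m disc psi])
  from k(4) consider "k = 32/9" | "k = - 1/9" | "k = - 8/3" by blast
  then show ?thesis
  proof cases
    case 1
    have c: "(32/9::rat)^3 * (9 * (32/9) - 8) = 262144/243" by (simp add: power_divide)
    have "27 * X^6 * (262144/243) = 64 * q^4" using k(3) unfolding 1 c .
    then have "(64 * X^3)^2 = 9 * q^4" by simp
    have "(64 * X^3 / 3)^2 = q^4"
    proof -
      have "(64 * X^3 / 3)^2 = (64 * X^3)^2 / 9" by (simp add: power_divide)
      then show ?thesis using \<open>(64 * X^3)^2 = 9 * q^4\<close> by simp
    qed
    then have "64 * X^3 / 3 = q^2 \<or> 64 * X^3 / 3 = - (q^2)" by (rule rational_sqrt_of_fourth_power)
    then obtain d where d: "64 * X^3 = 3 * (d * q^2)" "d = 1 \<or> d = - 1" by force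
    have dd: "d^2 = 1" using d(2) by auto
    define u where "u = q / (8 * X)"
    have u0: "u \<noteq> 0" using q X by (simp add: u_def)
    have qu: "q = 8 * X * u" using X by (simp add: u_def)
    have "64 * X^2 * X = 64 * X^2 * (3 * d * u^2)" using d(1) unfolding qu by algebra
    then have Xu: "X = 3 * d * u^2" using X by simp
    have k9: "9 * k = 32" using 1 by simp
    have "9 * A = 3 * X^2 * (9 * k - 9)" unfolding k(1) by algebra
    also have "\<dots> = 621 * d^2 * u^4" unfolding k9 Xu by algebra
    finally have "A = 69 * u^4" unfolding dd by simp
    moreover have "27 * (4 * B) = X^3 * ((9 * k)^2 - 36 * (9 * k) + 216)" unfolding k(2) by algebra
    then have "27 * (4 * B) = 2376 * (d^2 * d) * u^6" unfolding k9 Xu by algebra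
    then have "B = 22 * d * u^6" unfolding dd by simp
    ultimately show ?thesis using that u0 d(2) by auto
  next
    case 2
    have c: "(- 1/9::rat)^3 * (9 * (- 1/9) - 8) = 1/81" by (simp add: power_divide)
    have "27 * X^6 * (1/81) = 64 * q^4" using k(3) unfolding 2 c .
    then have "(X^3)^2 = 3 * (8 * q^2)^2" by simp
    then have "8 * q^2 = 0" by (rule square_eq_three_squares)
    then show ?thesis using q by simp
  next
    case 3
    have c: "(- 8/3::rat)^3 * (9 * (- 8/3) - 8) = 16384/27" by (simp add: power_divide)
    have "27 * X^6 * (16384/27) = 64 * q^4" using k(3) unfolding 3 c .
    then have "256 * X^6 = q^4" by simp
    then have "(16 * X^3)^2 = q^4" by simp
    then have "16 * X^3 = q^2 \<or> 16 * X^3 = - (q^2)" by (rule rational_sqrt_of_fourth_power)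
    then obtain d where d: "16 * X^3 = d * q^2" "d = 1 \<or> d = - 1" by force
    define v where "v = q / (4 * X)"
    have v0: "v \<noteq> 0" using q X by (simp add: v_def)
    have qv: "q = 4 * X * v" using X by (simp add: v_def)
    have "16 * X^2 * X = 16 * X^2 * (d * v^2)" using d(1) unfolding qv by algebra
    then have Xv: "X = d * v^2" using X by simp
    from extra show ?thesis
    proof
      assume "\<exists>c. 3 * X = c^2 \<or> 3 * X = - (c^2)"
      then obtain c where "3 * X = c^2 \<or> 3 * X = - (c^2)" by blast
      then have "3 * v^2 = c^2 \<or> 3 * v^2 = - (c^2)" using Xv d(2) by auto
      moreover have "3 * v^2 \<noteq> - (c^2)"
      proof -
        have "0 < v^2" "0 \<le> c^2" using v0 by simp_all
        then show ?thesis by linarith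
      qed
      ultimately have "c^2 = 3 * v^2" by simp
      then have "v = 0" by (rule square_eq_three_squares)
      then show ?thesis using v0 by simp
    next
      assume "\<exists>t. t^3 + A * t + B = 0"
      then obtain t where "t^3 + A * t + B = 0" by blast
      then have t: "4 * t^3 + 4 * A * t + 4 * B = 0" by algebra
      define z where "z = t / X"
      have tz: "t = z * X" using X by (simp add: z_def)
      have k3: "3 * k = - 8" using 3 by simp
      have "A = X^2 * (3 * k - 3)" unfolding k(1) by algebra
      then have A11: "A = - 11 * X^2" unfolding k3 by simp
      have "3 * (4 * B) = X^3 * ((3 * k)^2 - 12 * (3 * k) + 24)" unfolding k(2) by algebra
      then have B46: "3 * (4 * B) = 184 * X^3" unfolding k3 by simp
      have "4 * X^3 * (3 * z^3 - 33 * z + 46) = 12 * (z * X)^3 + 12 * (- 11 * X^2) * (z * X) + 184 * X^3"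
        by algebra
      also have "\<dots> = 3 * (4 * t^3 + 4 * A * t + 4 * B)"
        unfolding A11[symmetric] B46[symmetric] tz[symmetric] by algebra
      finally have "3 * z^3 - 33 * z + 46 = 0" unfolding t using X by simp
      then show ?thesis using cubic_no_rational_root by blast
    qed
  qed
qed

section \<open>From roots in the Gaussian field to rational numbers\<close>

lemma positive_definite_factor:
  fixes m n :: rat
  assumes "m \<noteq> 0"
  shows "9 * m^4 - 2 * m^2 * n^2 + n^4 \<noteq> 0"
proof -
  have "9 * m^4 - 2 * m^2 * n^2 + n^4 = (n^2 - m^2)^2 + 8 * (m^2)^2" by algebra
  moreover have "0 \<le> (n^2 - m^2)^2" "0 < (m^2)^2" using assms by simp_all
  ultimately show ?thesis by linarith
qed

text \<open>For a root \<open>m + n i\<close> with \<open>n \<noteq> 0\<close> the real quadratic factor of the quartic is known, and the rationality of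
  \<open>B\<close> makes the discriminant of the complementary factor a square.\<close>

lemma gaussian_root_gives_rational_root:
  fixes A B q m n :: rat
  assumes q: "q \<noteq> 0" and disc: "4 * A^3 + 27 * B^2 = 4 * q^4"
    and re: "m^4 - 6 * m^2 * n^2 + n^4 + 4 * q * m + 3 * A = 0"
    and im: "m^3 * n - m * n^3 + q * n = 0"
  shows "\<exists>m. m^4 + 4 * q * m + 3 * A = 0"
proof (cases "n = 0")
  case True
  then show ?thesis using re by auto
next
  case n: False
  have "n * (q + m * (m^2 - n^2)) = 0" using im by algebra
  then have qq: "q = - (m * (m^2 - n^2))" using n by (simp add: eq_neg_iff_add_eq_0)
  then have m: "m \<noteq> 0" using q by auto
  have A: "3 * A = (3 * m^2 - n^2) * (m^2 + n^2)" using re unfolding qq by algebra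
  define g where "g = 9 * m^4 - 2 * m^2 * n^2 + n^4"
  have g: "g \<noteq> 0" unfolding g_def by (rule positive_definite_factor[OF m])
  have "(27 * B)^2 = 108 * q^4 - 4 * (3 * A)^3" using disc by algebra
  also have "\<dots> = (2 * n * g)^2 * (n^2 - 2 * m^2)" unfolding A qq g_def by algebra
  finally have "n^2 - 2 * m^2 = (27 * B / (2 * n * g))^2"
    using n g by (simp add: power_divide)
  then obtain t where t: "t^2 = n^2 - 2 * m^2" by metis
  have "(t - m)^4 + 4 * q * (t - m) + 3 * A = (t^2 - 4 * m * t + 4 * m^2 + n^2) * (t^2 - (n^2 - 2 * m^2))"
    unfolding A qq by algebra
  then have "(t - m)^4 + 4 * q * (t - m) + 3 * A = 0" unfolding t by simp
  then show ?thesis by blast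
qed

text \<open>A rational root of the quartic would express \<open>B\<^sup>2\<close> as a nonpositive number. For a root \<open>u + v i\<close> with \<open>v \<noteq> 0\<close> the
  rationality of \<open>B\<close> makes \<open>2 u\<^sup>2 - v\<^sup>2\<close> a square \<open>t\<^sup>2\<close>, the four roots are \<open>u \<plusminus> v i\<close> and \<open>- u \<plusminus> t i\<close>, and the
  differences of the roots of \<open>x\<^sup>3 + A x + B\<close> are, up to sign, squares of half sums of these.\<close>

lemma gaussian_root_gives_rational_two_torsion:
  fixes A B q u v :: rat
  assumes q: "q \<noteq> 0" and disc: "4 * A^3 + 27 * B^2 = - (q^4)" and B: "B \<noteq> 0"
    and re: "u^4 - 6 * u^2 * v^2 + v^4 - 8 * q * u - 12 * A = 0"
    and im: "u^3 * v - u * v^3 - 2 * q * v = 0"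
  obtains e1 e2 e3 w where "e1 + e2 + e3 = 0" "e1 \<noteq> e2" "e2 \<noteq> e3" "e3 \<noteq> e1"
    "A = e1 * e2 + e1 * e3 + e2 * e3" "B = - (e1 * e2 * e3)" "(e3 - e2) * (e1 - e3) = w^2"
proof -
  have v: "v \<noteq> 0"
  proof
    assume "v = 0"
    then have A: "12 * A = u^4 - 8 * q * u" using re by simp
    have "46656 * B^2 = - (4 * (12 * A)^3 + 1728 * q^4)" using disc by algebra
    also have "\<dots> = - (4 * (u^3 - 2 * q)^2 * ((u^3 - 10 * q)^2 + 8 * q^2))" unfolding A by algebra
    also have "\<dots> \<le> 0" by simp
    finally have "B^2 \<le> 0" by simp
    then show False using B by simp
  qed
  have "v * (2 * q - u * (u^2 - v^2)) = 0" using im by algebra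
  then have qq: "2 * q = u * (u^2 - v^2)" using v by simp
  then have u: "u \<noteq> 0" using q by auto
  have A: "12 * A = (v^2 - 3 * u^2) * (v^2 + u^2)"
  proof -
    have "12 * A = u^4 - 6 * u^2 * v^2 + v^4 - 4 * u * (2 * q)" using re by algebra
    then show ?thesis unfolding qq by algebra
  qed
  define g where "g = 9 * u^4 - 2 * u^2 * v^2 + v^4"
  have g: "g \<noteq> 0" unfolding g_def by (rule positive_definite_factor[OF u])
  have "(108 * B)^2 = - ((12 * A)^3) - 27 * (2 * q)^4" using disc by algebra
  also have "\<dots> = (v * g)^2 * (2 * u^2 - v^2)" unfolding A qq g_def by algebra
  finally have "2 * u^2 - v^2 = (108 * B / (v * g))^2"
    using v g by (simp add: power_divide)
  then obtain t where t: "t^2 = 2 * u^2 - v^2" by metis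
  define w1 where "w1 = (v + t) / 2"
  define w2 where "w2 = (v - t) / 2"
  have vt: "v = w1 + w2" "t = w1 - w2" unfolding w1_def w2_def by (simp_all add: field_simps)
  have uu: "u^2 = w1^2 + w2^2" using t unfolding vt by algebra
  have "u * (w1 * w2) = - q"
  proof -
    have "2 * (u * (w1 * w2)) = - (u * (u^2 - v^2))" unfolding vt uu by algebra
    then show ?thesis unfolding qq[symmetric] by simp
  qed
  then have w0: "w1 \<noteq> 0" "w2 \<noteq> 0" using q by auto
  define e1 where "e1 = (w1^2 + 2 * w2^2) / 3"
  define e2 where "e2 = - (2 * w1^2 + w2^2) / 3"
  define e3 where "e3 = (w1^2 - w2^2) / 3"
  have e: "3 * e1 = w1^2 + 2 * w2^2" "3 * e2 = - (2 * w1^2 + w2^2)" "3 * e3 = w1^2 - w2^2"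
    by (simp_all add: e1_def e2_def e3_def)
  have d: "e1 - e2 = w1^2 + w2^2" "e3 - e2 = w1^2" "e1 - e3 = w2^2"
    by (simp_all add: e1_def e2_def e3_def field_simps)
  have sum: "e1 + e2 + e3 = 0" using e by linarith
  have "e1 - e2 \<noteq> 0" "e3 - e2 \<noteq> 0" "e1 - e3 \<noteq> 0" unfolding d uu[symmetric] using w0 u by simp_all
  then have ne: "e1 \<noteq> e2" "e2 \<noteq> e3" "e3 \<noteq> e1" by auto
  have Ae: "A = e1 * e2 + e1 * e3 + e2 * e3"
  proof -
    have "36 * A = 3 * (12 * A)" by simp
    also have "\<dots> = 4 * ((3 * e1) * (3 * e2) + (3 * e1) * (3 * e3) + (3 * e2) * (3 * e3))"
      unfolding A e unfolding uu vt by algebra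
    also have "\<dots> = 36 * (e1 * e2 + e1 * e3 + e2 * e3)" by simp
    finally show ?thesis by simp
  qed
  have e3': "e3 = - e1 - e2" using sum by simp
  have "27 * (e1 * e2 * e3)^2 = - 4 * (e1 * e2 + e1 * e3 + e2 * e3)^3 - ((e1 - e2) * (e3 - e2) * (e1 - e3))^2"
    unfolding e3' by algebra
  also have "\<dots> = - 4 * A^3 - (u * (w1 * w2))^4" unfolding Ae[symmetric] d uu[symmetric] by algebra
  also have "\<dots> = 27 * B^2" unfolding \<open>u * (w1 * w2) = - q\<close> using disc by algebra
  finally have "(B - e1 * e2 * e3) * (B + e1 * e2 * e3) = 0" by algebra
  then consider "B = - (e1 * e2 * e3)" | "B = - ((- e1) * (- e2) * (- e3))"
    by (auto simp: eq_neg_iff_add_eq_0)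
  then show ?thesis
  proof cases
    case 1
    moreover have "(e3 - e2) * (e1 - e3) = (w1 * w2)^2" unfolding d by (simp add: power_mult_distrib)
    ultimately show ?thesis using that[of e1 e2 e3 "w1 * w2"] sum ne Ae by blast
  next
    case 2
    have "(- e3 - - e2) * (- e1 - - e3) = (e3 - e2) * (e1 - e3)" by algebra
    then have "(- e3 - - e2) * (- e1 - - e3) = (w1 * w2)^2" unfolding d by (simp add: power_mult_distrib)
    moreover have "A = - e1 * - e2 + - e1 * - e3 + - e2 * - e3" using Ae by simp
    moreover have "- e1 + - e2 + - e3 = 0" using sum by simp
    ultimately show ?thesis using that[of "- e1" "- e2" "- e3" "w1 * w2"] ne 2 by simp
  qed
qed

text \<open>If the root \<open>a + b i\<close> is not rational, the third root besides it and its conjugate is \<open>- 2 a\<close>.\<close>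

lemma gaussian_root_of_cubic:
  fixes A B a b :: rat
  assumes re: "a^3 - 3 * a * b^2 + A * a + B = 0" and im: "3 * a^2 * b - b^3 + A * b = 0"
  shows "\<exists>t. t^3 + A * t + B = 0"
proof (cases "b = 0")
  case True
  then show ?thesis using re by auto
next
  case False
  have "b * (A - (b^2 - 3 * a^2)) = 0" using im by algebra
  then have "A = b^2 - 3 * a^2" using False by simp
  then have "(- 2 * a)^3 + A * (- 2 * a) + B = 0" using re by algebra
  then show ?thesis by blast
qed

context gaussian_sextic_field
begin

lemma gauss_split:
  assumes "of_rat a + of_rat b * i = 0"
  shows "a = 0" "b = 0"
  by (rule conjunct1[OF iffD1[OF gauss_eq_0_iff assms]], rule conjunct2[OF iffD1[OF gauss_eq_0_iff assms]])

lemma two_not_square: "(z::'k)^2 \<noteq> - 2"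
proof
  assume z: "z^2 = - 2"
  have "z^2 \<in> F" unfolding z by (intro F_uminus F_const)
  then have "z \<in> F" by (rule sqrt_in_F)
  then obtain a b where ab: "z = of_rat a + of_rat b * i" by (elim F_E)
  have "of_rat (a^2 - b^2 + 2) + of_rat (2 * a * b) * i = z^2 + 2 - (of_rat b)^2 * (i^2 + 1)"
    unfolding ab of_rat_add of_rat_diff of_rat_mult of_rat_power of_rat_numeral_eq by algebra
  also have "\<dots> = 0" unfolding z i by simp
  finally have "a^2 - b^2 + 2 = 0" "2 * a * b = 0" by (rule gauss_split)+
  then have "a = 0 \<and> b^2 = 2 \<or> b = 0 \<and> a^2 + 2 = 0" by auto
  moreover have "a^2 + 2 \<noteq> 0" using zero_le_power2[of a] by linarith
  ultimately show False using two_three_not_rat_square by blast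
qed

lemma gauss_cubic:
  "(of_rat a + of_rat b * i)^3 + of_rat A * (of_rat a + of_rat b * i) + of_rat B =
    of_rat (a^3 - 3 * a * b^2 + A * a + B) + of_rat (3 * a^2 * b - b^3 + A * b) * i"
proof -
  have "(of_rat a + of_rat b * i)^3 + of_rat A * (of_rat a + of_rat b * i) + of_rat B -
      (of_rat (a^3 - 3 * a * b^2 + A * a + B) + of_rat (3 * a^2 * b - b^3 + A * b) * i) =
      (i^2 + 1) * (3 * of_rat a * (of_rat b)^2 + (of_rat b)^3 * i)"
    unfolding of_rat_add of_rat_diff of_rat_mult of_rat_power of_rat_numeral_eq by algebra
  also have "\<dots> = 0" unfolding i by simp
  finally show ?thesis by simp
qed

lemma gauss_quartic:
  "(of_rat a + of_rat b * i)^4 + of_rat c2 * (of_rat a + of_rat b * i)^2 + of_rat c1 * (of_rat a + of_rat b * i) + of_rat c0 =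
    of_rat (a^4 - 6 * a^2 * b^2 + b^4 + c2 * (a^2 - b^2) + c1 * a + c0)
      + of_rat (4 * a^3 * b - 4 * a * b^3 + 2 * c2 * a * b + c1 * b) * i"
proof -
  have "(of_rat a + of_rat b * i)^4 + of_rat c2 * (of_rat a + of_rat b * i)^2 + of_rat c1 * (of_rat a + of_rat b * i) + of_rat c0 -
      (of_rat (a^4 - 6 * a^2 * b^2 + b^4 + c2 * (a^2 - b^2) + c1 * a + c0)
      + of_rat (4 * a^3 * b - 4 * a * b^3 + 2 * c2 * a * b + c1 * b) * i) =
      (i^2 + 1) * (6 * (of_rat a)^2 * (of_rat b)^2 + 4 * of_rat a * (of_rat b)^3 * i
        + (of_rat b)^4 * (i^2 - 1) + of_rat c2 * (of_rat b)^2)"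
    unfolding of_rat_add of_rat_diff of_rat_mult of_rat_power of_rat_numeral_eq by algebra
  also have "\<dots> = 0" unfolding i by simp
  finally show ?thesis by simp
qed

lemma cubic_root_in_F_gives_rational:
  assumes "e \<in> F" "e^3 + of_rat A * e + of_rat B = 0"
  shows "\<exists>t::rat. t^3 + A * t + B = 0"
proof -
  obtain a b where e: "e = of_rat a + of_rat b * i" using assms(1) by (elim F_E)
  have "of_rat (a^3 - 3 * a * b^2 + A * a + B) + of_rat (3 * a^2 * b - b^3 + A * b) * i = 0"
    using assms(2) unfolding e gauss_cubic .
  from gauss_split[OF this] show ?thesis by (rule gaussian_root_of_cubic)
qed

text \<open>If \<open>x1\<close> is not rational, the division polynomial is a product of two rational quadratics, and its roots in the
  field all lie in \<open>F\<close>, contrary to the choice of \<open>x0\<close>.\<close>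

lemma flex_root_in_F_gives_rational:
  fixes A B :: rat and x0 :: 'k
  assumes x1: "x1 \<in> F" "3 * x1^4 + 6 * of_rat A * x1^2 + 12 * of_rat B * x1 - (of_rat A)^2 = 0"
    and x0: "x0 \<notin> F" "3 * x0^4 + 6 * of_rat A * x0^2 + 12 * of_rat B * x0 - (of_rat A)^2 = 0"
  shows "\<exists>X::rat. 3 * X^4 + 6 * A * X^2 + 12 * B * X - A^2 = 0"
proof -
  obtain a b where ab: "x1 = of_rat a + of_rat b * i" using x1(1) by (elim F_E)
  have "3 * x1^4 + 6 * of_rat A * x1^2 + 12 * of_rat B * x1 - (of_rat A)^2 =
      3 * (x1^4 + of_rat (2 * A) * x1^2 + of_rat (4 * B) * x1 + of_rat (- (A^2 / 3)))"
    by (simp add: of_rat_mult of_rat_divide of_rat_minus of_rat_power distrib_left)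
  then have "x1^4 + of_rat (2 * A) * x1^2 + of_rat (4 * B) * x1 + of_rat (- (A^2 / 3)) = 0"
    using x1(2) by (metis mult_eq_0_iff zero_neq_numeral)
  from gauss_split[OF this[unfolded ab gauss_quartic]]
  have re: "a^4 - 6 * a^2 * b^2 + b^4 + 2 * A * (a^2 - b^2) + 4 * B * a + - (A^2 / 3) = 0"
    and im: "4 * a^3 * b - 4 * a * b^3 + 2 * (2 * A) * a * b + 4 * B * b = 0" by blast+
  show ?thesis
  proof (cases "b = 0")
    case True
    have "3 * a^4 + 6 * A * a^2 + 12 * B * a - A^2 = 0" using re True by simp
    then show ?thesis by blast
  next
    case False
    have "4 * b * (B + (a^3 - a * b^2 + A * a)) = 0" using im by algebra
    then have B: "B = - (a^3 - a * b^2 + A * a)" using False by (simp add: eq_neg_iff_add_eq_0)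
    \<comment> \<open>The division polynomial is the product of two rational quadratics, one of them the minimal
      polynomial of \<open>x1\<close>.\<close>
    define c where "c = 2 * A + 3 * a^2 - b^2"
    have c: "A^2 = - (3 * (a^2 + b^2) * c)"
    proof -
      have "A^2 = 3 * (a^4 - 6 * a^2 * b^2 + b^4 + 2 * A * (a^2 - b^2) + 4 * B * a)" using re by simp
      then show ?thesis unfolding B c_def by algebra
    qed
    have "of_rat (A^2) = (of_rat (- (3 * (a^2 + b^2) * c)) :: 'k)" unfolding c ..
    then have cK: "(of_rat A)^2 = - (3 * ((of_rat a)^2 + (of_rat b)^2) * of_rat c :: 'k)"
      unfolding of_rat_minus of_rat_add of_rat_mult of_rat_power of_rat_numeral_eq .
    have cK': "of_rat c = (2 * of_rat A + 3 * (of_rat a)^2 - (of_rat b)^2 :: 'k)"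
      unfolding c_def of_rat_diff of_rat_add of_rat_mult of_rat_power of_rat_numeral_eq ..
    have BK: "of_rat B = (- ((of_rat a)^3 - of_rat a * (of_rat b)^2 + of_rat A * of_rat a) :: 'k)"
      unfolding B of_rat_minus of_rat_diff of_rat_add of_rat_mult of_rat_power of_rat_numeral_eq ..
    have "3 * x0^4 + 6 * of_rat A * x0^2 + 12 * of_rat B * x0 - (of_rat A)^2 =
        3 * (x0^2 + of_rat (- 2 * a) * x0 + of_rat (a^2 + b^2)) * (x0^2 + of_rat (2 * a) * x0 + of_rat c)"
      unfolding cK BK of_rat_minus of_rat_add of_rat_mult of_rat_power of_rat_numeral_eq
      unfolding cK' by algebra
    then have "x0^2 + of_rat (- 2 * a) * x0 + of_rat (a^2 + b^2) = 0 \<or> x0^2 + of_rat (2 * a) * x0 + of_rat c = 0"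
      unfolding x0(2) by (metis mult_eq_0_iff zero_neq_numeral)
    then have "x0 \<in> F" using quadratic_in_F F_of_rat by blast
    then show ?thesis using x0(1) by blast
  qed
qed

text \<open>Stated for a subring \<open>S\<close> because it is applied both to the conjugation of \<open>F\<close> and to endomorphisms of the whole
  field.\<close>

lemma hom_preserves_flex:
  fixes h :: "'k \<Rightarrow> 'k" and A B :: rat
  assumes S: "\<And>a. of_rat a \<in> S" "\<And>x y. x \<in> S \<Longrightarrow> y \<in> S \<Longrightarrow> x + y \<in> S" "\<And>x y. x \<in> S \<Longrightarrow> y \<in> S \<Longrightarrow> x * y \<in> S"
    and h: "\<And>a. h (of_rat a) = of_rat a" "\<And>x y. x \<in> S \<Longrightarrow> y \<in> S \<Longrightarrow> h (x + y) = h x + h y"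
      "\<And>x y. x \<in> S \<Longrightarrow> y \<in> S \<Longrightarrow> h (x * y) = h x * h y"
    and xy: "x \<in> S" "y \<in> S"
    and curve: "y^2 = x^3 + of_rat A * x + of_rat B"
    and psi: "3 * x^4 + 6 * of_rat A * x^2 + 12 * of_rat B * x - (of_rat A)^2 = 0"
  shows "(h y)^2 = (h x)^3 + of_rat A * h x + of_rat B"
    and "3 * (h x)^4 + 6 * of_rat A * (h x)^2 + 12 * of_rat B * h x - (of_rat A)^2 = 0"
proof -
  have "h (y * y) = h (x * x * x + of_rat A * x + of_rat B)"
    using curve by (simp only: power2_eq_square power3_eq_cube)
  then show "(h y)^2 = (h x)^3 + of_rat A * h x + of_rat B"
    by (simp only: S h xy power2_eq_square power3_eq_cube)
  have "(of_rat 3 * (x * x * x * x) + of_rat (6 * A) * (x * x)) + (of_rat (12 * B) * x + of_rat (- (A * A))) =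
      3 * x^4 + 6 * of_rat A * x^2 + 12 * of_rat B * x - (of_rat A)^2"
    unfolding of_rat_mult of_rat_minus of_rat_numeral_eq by algebra
  then have "h ((of_rat 3 * (x * x * x * x) + of_rat (6 * A) * (x * x)) + (of_rat (12 * B) * x + of_rat (- (A * A)))) = h (of_rat 0)"
    unfolding psi by simp
  then have "(of_rat 3 * (h x * h x * h x * h x) + of_rat (6 * A) * (h x * h x)) + (of_rat (12 * B) * h x + of_rat (- (A * A))) = of_rat 0"
    by (simp only: S h xy)
  then show "3 * (h x)^4 + 6 * of_rat A * (h x)^2 + 12 * of_rat B * h x - (of_rat A)^2 = 0"
    unfolding of_rat_mult of_rat_minus of_rat_numeral_eq of_rat_0 by algebra
qed

lemma conjugation_F:
  obtains h where "\<And>a b. h (of_rat a + of_rat b * i) = of_rat a - of_rat b * i"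
    "\<And>a. h (of_rat a) = of_rat a"
    "\<And>x y. x \<in> F \<Longrightarrow> y \<in> F \<Longrightarrow> h (x + y) = h x + h y"
    "\<And>x y. x \<in> F \<Longrightarrow> y \<in> F \<Longrightarrow> h (x * y) = h x * h y"
proof -
  define h where "h x = (THE y. \<exists>a b. x = of_rat a + of_rat b * i \<and> y = of_rat a - of_rat b * i)" for x :: 'k
  have h: "h (of_rat a + of_rat b * i) = of_rat a - of_rat b * i" for a b
    unfolding h_def
  proof (rule the_equality)
    fix y assume "\<exists>a' b'. of_rat a + of_rat b * i = of_rat a' + of_rat b' * i \<and> y = of_rat a' - of_rat b' * i"
    then show "y = of_rat a - of_rat b * i" unfolding gauss_eq_iff by blast
  qed blast
  have hr: "h (of_rat a) = of_rat a" for a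
    using h[of a 0] unfolding of_rat_0 mult_zero_left add_0_right diff_0_right .
  have add: "h (x + y) = h x + h y" if mem: "x \<in> F" "y \<in> F" for x y
  proof -
    obtain a b c d where xy: "x = of_rat a + of_rat b * i" "y = of_rat c + of_rat d * i"
      using mem by (elim F_E)
    have "x + y = of_rat (a + c) + of_rat (b + d) * i"
      unfolding xy of_rat_add by algebra
    then have "h (x + y) = of_rat (a + c) - of_rat (b + d) * i" by (simp only: h)
    also have "\<dots> = h x + h y" unfolding xy h of_rat_add by algebra
    finally show ?thesis .
  qed
  have mult: "h (x * y) = h x * h y" if mem: "x \<in> F" "y \<in> F" for x y
  proof -
    obtain a b c d where xy: "x = of_rat a + of_rat b * i" "y = of_rat c + of_rat d * i"
      using mem by (elim F_E)
    have "x * y = of_rat (a * c - b * d) + of_rat (a * d + b * c) * i"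
      unfolding xy of_rat_add of_rat_mult of_rat_diff using i by algebra
    then have "h (x * y) = of_rat (a * c - b * d) - of_rat (a * d + b * c) * i" by (simp only: h)
    also have "\<dots> = h x * h y" unfolding xy h of_rat_add of_rat_mult of_rat_diff using i by algebra
    finally show ?thesis .
  qed
  show ?thesis by (rule that[of h]) (fact h hr add mult)+
qed

text \<open>For a cubic without roots in \<open>F\<close> the powers \<open>1\<close>, \<open>e1\<close>, \<open>e1\<^sup>2\<close> are a basis over \<open>F\<close>, and sending \<open>e1\<close> to another root
  \<open>e2\<close> of the cubic is an endomorphism of the field.\<close>

lemma cubic_conjugation:
  assumes A: "A \<in> F" and B: "B \<in> F" and no_root: "\<And>t. t \<in> F \<Longrightarrow> t^3 + A * t + B \<noteq> 0"
    and e1: "e1^3 + A * e1 + B = 0" and e2: "e2^3 + A * e2 + B = 0"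
  obtains h where "\<And>x y. h (x + y) = h x + h y" "\<And>x y. h (x * y) = h x * h y"
    "\<And>x. x \<in> F \<Longrightarrow> h x = x"
    "\<And>x. \<exists>a\<in>F. \<exists>b\<in>F. \<exists>c\<in>F. x = a + b * e1 + c * e1^2 \<and> h x = a + b * e2 + c * e2^2"
proof -
  have e1F: "e1 \<notin> F" using no_root e1 by blast
  have indep: "a = 0 \<and> b = 0 \<and> c = 0" if "a \<in> F" "b \<in> F" "c \<in> F" "a + b * e1 + c * e1^2 = 0" for a b c
    using F_linear_relation[of a b c e1] that e1F by blast
  have uniq: "a = a' \<and> b = b' \<and> c = c'"
    if F: "a \<in> F" "b \<in> F" "c \<in> F" "a' \<in> F" "b' \<in> F" "c' \<in> F"
      and eq: "a + b * e1 + c * e1^2 = a' + b' * e1 + c' * e1^2" for a b c a' b' c'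
  proof -
    have "(a - a') + (b - b') * e1 + (c - c') * e1^2 = 0" using eq by algebra
    then have "a - a' = 0 \<and> b - b' = 0 \<and> c - c' = 0" using F by (intro indep F_diff)
    then show ?thesis by simp
  qed
  have repr: "\<exists>a\<in>F. \<exists>b\<in>F. \<exists>c\<in>F. x = a + b * e1 + c * e1^2" for x
  proof -
    obtain c0 c1 c2 c3 where c: "c0 \<in> F" "c1 \<in> F" "c2 \<in> F" "c3 \<in> F"
      "c0 \<noteq> 0 \<or> c1 \<noteq> 0 \<or> c2 \<noteq> 0 \<or> c3 \<noteq> 0" "c0 * 1 + c1 * e1 + c2 * e1^2 + c3 * x = 0"
      by (rule F_relation4[of 1 e1 "e1^2" x])
    have c3: "c3 \<noteq> 0"
    proof
      assume "c3 = 0"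
      then have "c0 + c1 * e1 + c2 * e1^2 = 0" using c(6) by algebra
      then show False using indep[OF c(1-3)] c(5) \<open>c3 = 0\<close> by blast
    qed
    have "c3 * x = - c0 + - c1 * e1 + - c2 * e1^2" using c(6) by algebra
    moreover have "x = c3 * x / c3" using c3 by (rule nonzero_mult_div_cancel_left[symmetric])
    ultimately have "x = - c0 / c3 + - c1 / c3 * e1 + - c2 / c3 * e1^2"
      by (simp only: add_divide_distrib times_divide_eq_left)
    moreover have "- c0 / c3 \<in> F" "- c1 / c3 \<in> F" "- c2 / c3 \<in> F"
      using c(1-4) by (simp_all only: F_divide F_uminus)
    ultimately show ?thesis by blast
  qed
  define h where "h x = (THE y. \<exists>a\<in>F. \<exists>b\<in>F. \<exists>c\<in>F. x = a + b * e1 + c * e1^2 \<and> y = a + b * e2 + c * e2^2)" for x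
  have h: "h (a + b * e1 + c * e1^2) = a + b * e2 + c * e2^2" if F: "a \<in> F" "b \<in> F" "c \<in> F" for a b c
    unfolding h_def
  proof (rule the_equality)
    fix y assume "\<exists>a'\<in>F. \<exists>b'\<in>F. \<exists>c'\<in>F. a + b * e1 + c * e1^2 = a' + b' * e1 + c' * e1^2 \<and> y = a' + b' * e2 + c' * e2^2"
    then obtain a' b' c' where *: "a' \<in> F" "b' \<in> F" "c' \<in> F"
      "a + b * e1 + c * e1^2 = a' + b' * e1 + c' * e1^2" "y = a' + b' * e2 + c' * e2^2" by blast
    from uniq[OF F *(1-4)] show "y = a + b * e2 + c * e2^2" unfolding *(5) by (elim conjE) (simp only:)
  next
    show "\<exists>a'\<in>F. \<exists>b'\<in>F. \<exists>c'\<in>F. a + b * e1 + c * e1^2 = a' + b' * e1 + c' * e1^2 \<and>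
        a + b * e2 + c * e2^2 = a' + b' * e2 + c' * e2^2"
      by (rule bexI[OF _ F(1)], rule bexI[OF _ F(2)], rule bexI[OF _ F(3)], rule conjI[OF refl refl])
  qed
  have add: "h (x + y) = h x + h y" for x y
  proof -
    obtain a b c where x: "a \<in> F" "b \<in> F" "c \<in> F" "x = a + b * e1 + c * e1^2"
      using repr[of x] by (elim bexE)
    obtain a' b' c' where y: "a' \<in> F" "b' \<in> F" "c' \<in> F" "y = a' + b' * e1 + c' * e1^2"
      using repr[of y] by (elim bexE)
    have "x + y = (a + a') + (b + b') * e1 + (c + c') * e1^2" unfolding x(4) y(4) by algebra
    then have "h (x + y) = (a + a') + (b + b') * e2 + (c + c') * e2^2" using h x y by (simp only: F_add)
    also have "\<dots> = h x + h y" unfolding x(4) y(4) h[OF x(1-3)] h[OF y(1-3)] by algebra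
    finally show ?thesis .
  qed
  have mult: "h (x * y) = h x * h y" for x y
  proof -
    obtain a b c where x: "a \<in> F" "b \<in> F" "c \<in> F" "x = a + b * e1 + c * e1^2"
      using repr[of x] by (elim bexE)
    obtain a' b' c' where y: "a' \<in> F" "b' \<in> F" "c' \<in> F" "y = a' + b' * e1 + c' * e1^2"
      using repr[of y] by (elim bexE)
    define p q r where "p = a * a' - B * (b * c' + c * b')"
      and "q = a * b' + b * a' - A * (b * c' + c * b') - B * (c * c')"
      and "r = a * c' + b * b' + c * a' - A * (c * c')"
    have F: "p \<in> F" "q \<in> F" "r \<in> F"
      using x(1-3) y(1-3) A B unfolding p_def q_def r_def by (simp_all only: F_add F_diff F_mult)
    have red: "(a + b * e + c * e^2) * (a' + b' * e + c' * e^2) = p + q * e + r * e^2" if "e^3 + A * e + B = 0" for e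
    proof -
      have "(a + b * e + c * e^2) * (a' + b' * e + c' * e^2) =
          p + q * e + r * e^2 + ((b * c' + c * b') + c * c' * e) * (e^3 + A * e + B)"
        unfolding p_def q_def r_def by algebra
      then show ?thesis unfolding that by simp
    qed
    have "h (x * y) = p + q * e2 + r * e2^2" unfolding x(4) y(4) red[OF e1] by (rule h[OF F])
    also have "\<dots> = h x * h y" unfolding x(4) y(4) h[OF x(1-3)] h[OF y(1-3)] red[OF e2] ..
    finally show ?thesis .
  qed
  have fix_F: "h x = x" if "x \<in> F" for x
    using h[of x 0 0] that by simp
  have "\<exists>a\<in>F. \<exists>b\<in>F. \<exists>c\<in>F. x = a + b * e1 + c * e1^2 \<and> h x = a + b * e2 + c * e2^2" for x
  proof -
    obtain a b c where x: "a \<in> F" "b \<in> F" "c \<in> F" "x = a + b * e1 + c * e1^2"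
      using repr[of x] by (elim bexE)
    have "x = a + b * e1 + c * e1^2 \<and> h x = a + b * e2 + c * e2^2"
      using x(4) h[OF x(1-3)] by (simp only: simp_thms)
    then show ?thesis by (rule bexI[OF bexI[OF bexI[OF _ x(3)] x(2)] x(1)])
  qed
  with add mult fix_F show ?thesis by (intro that[of h])
qed

end

section \<open>The classification over the sextic field\<close>

context gaussian_sextic_field
begin

lemma rational_square_in_F:
  assumes "w \<in> F" "w^2 = of_rat z"
  shows "\<exists>c. z = c^2 \<or> z = - (c^2)"
proof -
  obtain a b where w: "w = of_rat a + of_rat b * i" using assms(1) by (elim F_E)
  have "of_rat (a^2 - b^2 - z) + of_rat (2 * a * b) * i = w^2 - of_rat z - (of_rat b)^2 * (i^2 + 1)"
    unfolding w of_rat_diff of_rat_mult of_rat_power of_rat_numeral_eq by algebra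
  also have "\<dots> = 0" unfolding assms(2) i by simp
  finally have *: "of_rat (a^2 - b^2 - z) + of_rat (2 * a * b) * i = 0" .
  have "z = a^2 - b^2" using gauss_split(1)[OF *] by simp
  moreover have "a = 0 \<or> b = 0" using gauss_split(2)[OF *] by simp
  ultimately have "z = a^2 \<or> z = - (b^2)" by auto
  then show ?thesis by blast
qed

text \<open>Conjugates of the point of order three are again such points, so uniqueness of the abscissa \<open>x0\<close> makes it
  invariant. If \<open>f\<close> has no root in \<open>F\<close>, this puts \<open>x0\<close> into \<open>F\<close>; once it is in \<open>F\<close>, it is rational, and \<open>3 x0\<close> is a
  square in \<open>F\<close> because \<open>4 f(X) = 3 X (k X)\<^sup>2\<close> at a flex. Otherwise \<open>f\<close> has a rational root and the division
  polynomial a root in \<open>F\<close>.\<close>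

lemma rational_flex:
  fixes A B :: rat and e1 e2 e3 x0 y0 :: 'k
  assumes ne: "e1 \<noteq> e2" and sum: "e1 + e2 + e3 = 0"
    and roots: "e1^3 + of_rat A * e1 + of_rat B = 0" "e2^3 + of_rat A * e2 + of_rat B = 0"
      "e3^3 + of_rat A * e3 + of_rat B = 0"
    and y0: "y0 \<noteq> 0" and curve: "y0^2 = x0^3 + of_rat A * x0 + of_rat B"
    and psi: "3 * x0^4 + 6 * of_rat A * x0^2 + 12 * of_rat B * x0 - (of_rat A)^2 = 0"
    and unique: "\<And>x y. y^2 = x^3 + of_rat A * x + of_rat B \<Longrightarrow>
      3 * x^4 + 6 * of_rat A * x^2 + 12 * of_rat B * x - (of_rat A)^2 = 0 \<Longrightarrow> x = x0"
  obtains X where "3 * X^4 + 6 * A * X^2 + 12 * B * X - A^2 = 0"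
    "(\<exists>c. 3 * X = c^2 \<or> 3 * X = - (c^2)) \<or> (\<exists>t. t^3 + A * t + B = 0)"
proof (cases "x0 \<in> F")
  case True
  have "y0^2 \<in> F" unfolding curve by (intro F_add F_mult F_power F_of_rat True)
  then have yF: "y0 \<in> F" by (rule sqrt_in_F)
  obtain h where h: "\<And>a b. h (of_rat a + of_rat b * i) = of_rat a - of_rat b * i"
    "\<And>a. h (of_rat a) = of_rat a"
    "\<And>x y. x \<in> F \<Longrightarrow> y \<in> F \<Longrightarrow> h (x + y) = h x + h y"
    "\<And>x y. x \<in> F \<Longrightarrow> y \<in> F \<Longrightarrow> h (x * y) = h x * h y"
    by (rule conjugation_F) (rule that)
  have hx: "h x0 = x0"
    by (rule unique; rule hom_preserves_flex[of F h x0 y0 A B])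
      (fact F_of_rat F_add F_mult h(2) h(3) h(4) True yF curve psi)+
  obtain a b where ab: "x0 = of_rat a + of_rat b * i" using True by (elim F_E)
  have "of_rat a + of_rat b * i = of_rat a + of_rat (- b) * i"
    using hx unfolding ab h(1) of_rat_minus by simp
  then have "b = - b" unfolding gauss_eq_iff by blast
  then have x0: "x0 = of_rat a" using ab by simp
  have "of_rat (3 * a^4 + 6 * A * a^2 + 12 * B * a - A^2) = (of_rat 0 :: 'k)"
    using psi unfolding x0 of_rat_diff of_rat_add of_rat_mult of_rat_power of_rat_numeral_eq of_rat_0 .
  then have X: "3 * a^4 + 6 * A * a^2 + 12 * B * a - A^2 = 0" by (simp only: of_rat_eq_iff)
  have "\<exists>c. 3 * a = c^2 \<or> 3 * a = - (c^2)"
  proof (cases "a = 0")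
    case True
    then show ?thesis by (intro exI[of _ 0]) simp
  next
    case False
    obtain k where k: "A = 3 * a^2 * (k - 1)" "4 * B = a^3 * (3 * k^2 - 12 * k + 8)"
      by (rule three_isogeny_normal_form[OF X False])
    have "4 * (a^3 + A * a + B) = 3 * a * (a * k)^2"
      using cubic_at_flex[OF k, of 0] by simp
    then have "of_rat (4 * (a^3 + A * a + B)) = (of_rat (3 * a * (a * k)^2) :: 'k)" by simp
    then have "(2 * y0)^2 = of_rat (3 * a) * (of_rat (a * k))^2"
      unfolding power_mult_distrib[of 2] curve x0
      unfolding of_rat_add of_rat_mult of_rat_power of_rat_numeral_eq by simp
    moreover from this have ak: "of_rat (a * k) \<noteq> (0 :: 'k)" using y0 by auto
    ultimately have "(2 * y0 / of_rat (a * k))^2 = of_rat (3 * a)"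
      unfolding power_divide by (metis nonzero_mult_div_cancel_right power_not_zero)
    moreover have "2 * y0 / of_rat (a * k) \<in> F" by (intro F_divide F_mult F_const F_of_rat yF)
    ultimately show ?thesis using rational_square_in_F by blast
  qed
  then show ?thesis using that X by blast
next
  case False
  have "\<exists>t\<in>F. t^3 + of_rat A * t + of_rat B = 0"
  proof (rule ccontr)
    assume "\<not> ?thesis"
    then have no_root: "t^3 + of_rat A * t + of_rat B \<noteq> 0" if "t \<in> F" for t using that by blast
    obtain h where h: "\<And>x y. h (x + y) = h x + h y" "\<And>x y. h (x * y) = h x * h y"
      "\<And>x. x \<in> F \<Longrightarrow> h x = x"
      "\<And>x. \<exists>a\<in>F. \<exists>b\<in>F. \<exists>c\<in>F. x = a + b * e1 + c * e1^2 \<and> h x = a + b * e2 + c * e2^2"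
      by (rule cubic_conjugation[OF F_of_rat F_of_rat no_root roots(1,2)]) (assumption, rule that)
    have hr: "h (of_rat a) = of_rat a" for a by (rule h(3)[OF F_of_rat])
    have hx: "h x0 = x0"
      by (rule unique; rule hom_preserves_flex[of UNIV h x0 y0 A B])
        (rule UNIV_I hr h(1) h(2) curve psi)+
    obtain a b c where abc: "a \<in> F" "b \<in> F" "c \<in> F" "x0 = a + b * e1 + c * e1^2" "h x0 = a + b * e2 + c * e2^2"
      using h(4)[of x0] by (elim bexE conjE)
    have e12: "e1 + e2 = - e3" using sum by algebra
    have "(e1 - e2) * (b + c * (e1 + e2)) = (a + b * e1 + c * e1^2) - (a + b * e2 + c * e2^2)" by algebra
    also have "\<dots> = 0" unfolding abc(4)[symmetric] abc(5)[symmetric] hx by simp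
    finally have bc: "b = c * e3" using ne unfolding e12 by simp
    show False
    proof (cases "c = 0")
      case True
      then have "x0 = a" using abc(4) bc by simp
      then show False using abc(1) False by simp
    next
      case c: False
      then have "e3 = b / c" using bc by simp
      then have "e3 \<in> F" using abc(2,3) by (simp only: F_divide)
      then show False using no_root roots(3) by blast
    qed
  qed
  then have two: "\<exists>t::rat. t^3 + A * t + B = 0" using cubic_root_in_F_gives_rational by blast
  have monic: "3 * x^4 + 6 * of_rat A * x^2 + 12 * of_rat B * x - (of_rat A)^2 =
      3 * (x^4 + 0 * x^3 + of_rat (2 * A) * x^2 + of_rat (4 * B) * x + of_rat (- (A^2 / 3)))" for x :: 'k
    by (simp add: of_rat_mult of_rat_divide of_rat_minus of_rat_power distrib_left)
  have "x0^4 + 0 * x0^3 + of_rat (2 * A) * x0^2 + of_rat (4 * B) * x0 + of_rat (- (A^2 / 3)) = 0"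
  proof -
    have three: "t = 0" if "3 * t = 0" for t :: 'k using that by simp
    show ?thesis by (rule three) (use psi in \<open>unfold monic\<close>)
  qed
  from quartic_root_in_F[OF F_const(1) F_of_rat F_of_rat F_of_rat this]
  obtain r where r: "r \<in> F" "r^4 + 0 * r^3 + of_rat (2 * A) * r^2 + of_rat (4 * B) * r + of_rat (- (A^2 / 3)) = 0"
    by blast
  have "3 * r^4 + 6 * of_rat A * r^2 + 12 * of_rat B * r - (of_rat A)^2 = 0"
    unfolding monic r(2) by simp
  from flex_root_in_F_gives_rational[OF r(1) this False psi] that two show ?thesis by blast
qed

text \<open>With square roots \<open>z1\<close>, \<open>z2\<close>, \<open>z3\<close> of the three differences of the roots, \<open>r = z1 z2 z3\<close> satisfies
  \<open>r\<^sup>4 = - 4 A\<^sup>3 - 27 B\<^sup>2\<close>, and \<open>z1 + z2 + z3\<close> is a root of \<open>T\<^sup>4 - 8 r T - 12 A\<close>.\<close>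

lemma resolvent_root_in_F:
  fixes A B :: rat and e1 e2 e3 z1 z2 z3 :: 'k
  assumes sum: "e1 + e2 + e3 = 0" and A: "of_rat A = e1 * e2 + e1 * e3 + e2 * e3"
    and B: "of_rat B = - (e1 * e2 * e3)"
    and z: "z1^2 = e1 - e2" "z2^2 = e2 - e3" "z3^2 = e3 - e1"
  obtains r p where "r \<in> F" "p \<in> F" "r^4 = of_rat (- 4 * A^3 - 27 * B^2)" "p^4 - 8 * r * p = 12 * of_rat A"
proof -
  have e3: "e3 = - e1 - e2" using sum by algebra
  define r where "r = z1 * z2 * z3"
  define p where "p = z1 + z2 + z3"
  have "r^4 = ((z1^2) * (z2^2) * (z3^2))^2" unfolding r_def by algebra
  also have "\<dots> = - 4 * (of_rat A)^3 - 27 * (of_rat B)^2" unfolding z A B e3 by algebra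
  finally have r4: "r^4 = of_rat (- 4 * A^3 - 27 * B^2)"
    unfolding of_rat_diff of_rat_mult of_rat_power of_rat_minus of_rat_numeral_eq .
  have "(r^2)^2 = r^4" by algebra
  then have "(r^2)^2 \<in> F" unfolding r4 using F_of_rat by (simp only:)
  from sqrt_in_F[OF sqrt_in_F[OF this]] have rF: "r \<in> F" .
  have zz: "z3^2 = - (z1^2) - z2^2" unfolding z by algebra
  have "p^4 - 8 * r * p = 4 * (z1^2 * z2^2 + (z1^2 + z2^2) * z3^2)
      + (z1^2 + z2^2 + z3^2) * ((z1^2 + z2^2 + z3^2) + 4 * (z1 * z2 + z1 * z3 + z2 * z3))"
    unfolding p_def r_def by algebra
  also have "\<dots> = 12 * of_rat A" unfolding z A e3 by algebra
  finally have p: "p^4 - 8 * r * p = 12 * of_rat A" .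
  then have "p^4 + 0 * p^3 + 0 * p^2 + (- 8 * r) * p + (- 12 * of_rat A) = 0" by algebra
  moreover have "- 8 * r \<in> F" "- 12 * of_rat A \<in> F"
    using rF by (simp_all only: F_mult F_uminus F_const F_of_rat)
  ultimately obtain s where s: "s \<in> F" "s^4 + 0 * s^3 + 0 * s^2 + (- 8 * r) * s + (- 12 * of_rat A) = 0"
    using quartic_root_in_F[of 0 0 "- 8 * r" "- 12 * of_rat A" p] F_const(1) by blast
  have "s^4 - 8 * r * s = 12 * of_rat A" using s(2) by algebra
  then show ?thesis using that rF s(1) r4 by blast
qed

text \<open>The fourth power of \<open>r\<close> being rational, \<open>r\<close> is a rational multiple of \<open>1\<close>, \<open>i\<close>, \<open>1 + i\<close> or
  \<open>1 - i\<close>; multiplying \<open>r\<close> and \<open>p\<close> by suitable powers of \<open>i\<close> leaves the first and the third case.\<close>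

lemma resolvent_root_normal_form:
  fixes A D :: rat
  assumes r: "r \<in> F" and p: "p \<in> F" and r4: "r^4 = of_rat D" and eq: "p^4 - 8 * r * p = 12 * of_rat A"
  obtains q P where "P \<in> F" "D = q^4" "P^4 - 8 * of_rat q * P = 12 * of_rat A"
  | q P where "P \<in> F" "D = - 4 * q^4" "P^4 + 4 * of_rat q * P + 3 * of_rat A = 0"
proof -
  obtain a b where ab: "r = of_rat a + of_rat b * i" using r by (elim F_E)
  have "of_rat (a^4 - 6 * a^2 * b^2 + b^4 + 0 * (a^2 - b^2) + 0 * a + - D)
      + of_rat (4 * a^3 * b - 4 * a * b^3 + 2 * 0 * a * b + 0 * b) * i = 0"
    unfolding gauss_quartic[symmetric] ab[symmetric] r4
    by (simp only: of_rat_0 mult_zero_left add_0_right of_rat_minus add.right_inverse)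
  note split = gauss_split[OF this]
  have D: "D = a^4 - 6 * a^2 * b^2 + b^4" using split(1) by algebra
  have "4 * ((a * b) * ((a - b) * (a + b))) = 0" using split(2) by algebra
  then have im: "(a * b) * ((a - b) * (a + b)) = 0" by simp
  have four: "t = 0" if "4 * t = 0" for t :: 'k using that by simp
  have i1: "i * i = - 1" using i by (simp only: power2_eq_square)
  from im consider "b = 0" | "a = 0" | "a = b" | "a = - b" by (auto simp: eq_neg_iff_add_eq_0)
  then show ?thesis
  proof cases
    case 1
    then have "D = a^4" "r = of_rat a" using D ab by simp_all
    then show ?thesis using that(1)[of p a] p eq by simp
  next
    case 2
    then have b: "D = b^4" "r = of_rat b * i" using D ab by simp_all
    have "(i * p)^4 - 8 * of_rat b * (i * p) = (i * i)^2 * p^4 - 8 * (of_rat b * i) * p" by algebra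
    also have "\<dots> = 12 * of_rat A" unfolding i1 b(2)[symmetric] using eq by simp
    finally show ?thesis using that(1)[of "i * p" b] p b(1) by simp
  next
    case 3
    have b: "D = - 4 * b^4" unfolding D 3 by algebra
    define P where "P = p * (1 + i) / 2"
    have "2 * P = p * (1 + i)" by (simp add: P_def)
    then have "(1 - i) * (2 * P) = p * (1 - i * i)" by algebra
    then have pP: "p = (1 - i) * P" unfolding i1 by simp
    have r: "r = of_rat b * (1 + i)" unfolding ab 3 by algebra
    have "4 * (P^4 + 4 * of_rat b * P + 3 * of_rat A) =
        12 * of_rat A - (p^4 - 8 * r * p) + (i * i + 1) * (((i * i) - 4 * i + 5) * P^4 + 8 * of_rat b * P)"
      unfolding pP r by algebra
    then have "4 * (P^4 + 4 * of_rat b * P + 3 * of_rat A) = 0"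
      unfolding eq i1 by (simp only: diff_self add.left_inverse mult_zero_left add_0_right)
    then have "P^4 + 4 * of_rat b * P + 3 * of_rat A = 0" by (rule four)
    moreover have "P \<in> F" unfolding P_def by (intro F_divide F_mult F_add F_const F_i p)
    ultimately show ?thesis using that(2)[of P b] b by simp
  next
    case 4
    have b: "D = - 4 * a^4" unfolding D 4 by algebra
    have b4: "b = - a" using 4 by simp
    define P where "P = p * (1 - i) / 2"
    have "2 * P = p * (1 - i)" by (simp add: P_def)
    then have "(1 + i) * (2 * P) = p * (1 - i * i)" by algebra
    then have pP: "p = (1 + i) * P" unfolding i1 by simp
    have r: "r = of_rat a * (1 - i)" unfolding ab b4 of_rat_minus by algebra
    have "4 * (P^4 + 4 * of_rat a * P + 3 * of_rat A) =
        12 * of_rat A - (p^4 - 8 * r * p) + (i * i + 1) * (((i * i) + 4 * i + 5) * P^4 + 8 * of_rat a * P)"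
      unfolding pP r by algebra
    then have "4 * (P^4 + 4 * of_rat a * P + 3 * of_rat A) = 0"
      unfolding eq i1 by (simp only: diff_self add.left_inverse mult_zero_left add_0_right)
    then have "P^4 + 4 * of_rat a * P + 3 * of_rat A = 0" by (rule four)
    moreover have "P \<in> F" unfolding P_def by (intro F_divide F_mult F_diff F_const F_i p)
    ultimately show ?thesis using that(2)[of P a] b by simp
  qed
qed

text \<open>In the case of rational \<open>r\<close> the vanishing of \<open>B\<close> has to be excluded separately: the differences of
  \<open>0\<close>, \<open>e\<close>, \<open>- e\<close> would make \<open>2\<close> a square in \<open>F\<close>.\<close>

theorem classification:
  fixes A B :: rat and e1 e2 e3 z1 z2 z3 x0 y0 :: 'k
  assumes ne: "e1 \<noteq> e2" "e2 \<noteq> e3" "e3 \<noteq> e1" and sum: "e1 + e2 + e3 = 0"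
    and A: "of_rat A = e1 * e2 + e1 * e3 + e2 * e3" and B: "of_rat B = - (e1 * e2 * e3)"
    and z: "z1^2 = e1 - e2" "z2^2 = e2 - e3" "z3^2 = e3 - e1"
    and y0: "y0 \<noteq> 0" and curve: "y0^2 = x0^3 + of_rat A * x0 + of_rat B"
    and psi: "3 * x0^4 + 6 * of_rat A * x0^2 + 12 * of_rat B * x0 - (of_rat A)^2 = 0"
    and unique: "\<And>x y. y^2 = x^3 + of_rat A * x + of_rat B \<Longrightarrow>
      3 * x^4 + 6 * of_rat A * x^2 + 12 * of_rat B * x - (of_rat A)^2 = 0 \<Longrightarrow> x = x0"
  obtains u where "u \<noteq> 0" "A = 69 * u^4" "B = 22 * u^6 \<or> B = - 22 * u^6"
proof -
  have e3: "e3 = - e1 - e2" using sum by algebra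
  have roots: "e1^3 + of_rat A * e1 + of_rat B = 0" "e2^3 + of_rat A * e2 + of_rat B = 0"
      "e3^3 + of_rat A * e3 + of_rat B = 0"
    unfolding A B e3 by algebra+
  obtain X where X: "3 * X^4 + 6 * A * X^2 + 12 * B * X - A^2 = 0"
    "(\<exists>c. 3 * X = c^2 \<or> 3 * X = - (c^2)) \<or> (\<exists>t. t^3 + A * t + B = 0)"
    by (rule rational_flex[OF ne(1) sum roots y0 curve psi unique])
  obtain r p where rp: "r \<in> F" "p \<in> F" "r^4 = of_rat (- 4 * A^3 - 27 * B^2)" "p^4 - 8 * r * p = 12 * of_rat A"
    by (rule resolvent_root_in_F[OF sum A B z])
  have disc0: "- 4 * A^3 - 27 * B^2 \<noteq> 0"
  proof
    assume "- 4 * A^3 - 27 * B^2 = 0"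
    then have "of_rat (- 4 * A^3 - 27 * B^2) = (of_rat 0 :: 'k)" by (simp only:)
    then have "- 4 * (of_rat A)^3 - 27 * (of_rat B)^2 = (0 :: 'k)"
      unfolding of_rat_diff of_rat_mult of_rat_power of_rat_minus of_rat_numeral_eq of_rat_0 .
    moreover have "- 4 * (of_rat A)^3 - 27 * (of_rat B)^2 = ((e1 - e2) * (e2 - e3) * (e3 - e1))^2"
      unfolding A B e3 by algebra
    ultimately show False using ne by simp
  qed
  from rp show ?thesis
  proof (cases rule: resolvent_root_normal_form[consumes 4])
    case (1 q P)
    obtain u v where P: "P = of_rat u + of_rat v * i" using 1(1) by (elim F_E)
    have "of_rat (u^4 - 6 * u^2 * v^2 + v^4 + 0 * (u^2 - v^2) + (- 8 * q) * u + (- 12 * A))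
        + of_rat (4 * u^3 * v - 4 * u * v^3 + 2 * 0 * u * v + (- 8 * q) * v) * i = 0"
      unfolding gauss_quartic[symmetric] P[symmetric]
      unfolding of_rat_mult of_rat_minus of_rat_numeral_eq of_rat_0 using 1(3) by algebra
    note split = gauss_split[OF this]
    have re: "u^4 - 6 * u^2 * v^2 + v^4 - 8 * q * u - 12 * A = 0" using split(1) by algebra
    have im4: "4 * (u^3 * v - u * v^3 - 2 * q * v) = 0" using split(2) by algebra
    then have im: "u^3 * v - u * v^3 - 2 * q * v = 0" by simp
    have q: "q \<noteq> 0" using 1(2) disc0 by auto
    have disc: "4 * A^3 + 27 * B^2 = - (q^4)" using 1(2) by algebra
    have "B \<noteq> 0"
    proof
      assume "B = 0"
      then have "e1 = 0 \<or> e2 = 0 \<or> e3 = 0" using B by simp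
      then obtain a b :: 'k where "a \<noteq> 0" "b^2 = - 2 * a^2"
      proof (elim disjE)
        assume "e1 = 0"
        then have "z1 \<noteq> 0" "z2^2 = - 2 * z1^2" using z ne e3 by auto
        then show ?thesis by (rule that)
      next
        assume "e2 = 0"
        then have "z1 \<noteq> 0" "z3^2 = - 2 * z1^2" using z ne e3 by auto
        then show ?thesis by (rule that)
      next
        assume "e3 = 0"
        then have "e2 = - e1" using e3 by algebra
        then have "z2 \<noteq> 0" "z1^2 = - 2 * z2^2" using z ne \<open>e3 = 0\<close> by auto
        then show ?thesis by (rule that)
      qed
      then have "(b / a)^2 = - 2" by (simp add: power_divide)
      then show False using two_not_square by blast
    qed
    then obtain f1 f2 f3 w where f: "f1 + f2 + f3 = 0" "f1 \<noteq> f2" "f2 \<noteq> f3" "f3 \<noteq> f1"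
      "A = f1 * f2 + f1 * f3 + f2 * f3" "B = - (f1 * f2 * f3)" "(f3 - f2) * (f1 - f3) = w^2"
      using gaussian_root_gives_rational_two_torsion[OF q disc _ re im] by blast
    from three_isogeny_gap_product_not_square[OF f(1-6) X(1)] f(7) show ?thesis by blast
  next
    case (2 q P)
    obtain m n where P: "P = of_rat m + of_rat n * i" using 2(1) by (elim F_E)
    have "of_rat (m^4 - 6 * m^2 * n^2 + n^4 + 0 * (m^2 - n^2) + (4 * q) * m + 3 * A)
        + of_rat (4 * m^3 * n - 4 * m * n^3 + 2 * 0 * m * n + (4 * q) * n) * i = 0"
      unfolding gauss_quartic[symmetric] P[symmetric]
      unfolding of_rat_mult of_rat_numeral_eq of_rat_0 using 2(3) by algebra
    note split = gauss_split[OF this]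
    have re: "m^4 - 6 * m^2 * n^2 + n^4 + 4 * q * m + 3 * A = 0" using split(1) by algebra
    have im4: "4 * (m^3 * n - m * n^3 + q * n) = 0" using split(2) by algebra
    then have im: "m^3 * n - m * n^3 + q * n = 0" by simp
    have q: "q \<noteq> 0" using 2(2) disc0 by auto
    have disc: "4 * A^3 + 27 * B^2 = 4 * q^4" using 2(2) by algebra
    obtain M where "M^4 + 4 * q * M + 3 * A = 0"
      using gaussian_root_gives_rational_root[OF q disc re im] by blast
    from rational_points_classified[OF q this disc X] that show ?thesis by blast
  qed
qed

end

section \<open>The curves 162.d2 and 1296.l2\<close>

lemma short_weierstrass_form:
  fixes E :: "'a::field_char_0 weierstrass"
  obtains r s t A B where "change_coords 1 r s t E = Weierstrass 0 0 0 A B"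
proof -
  define s where "s = - (a1 E / 2)"
  define r where "r = (s^2 + s * a1 E - a2 E) / 3"
  define t where "t = - (a3 E + r * a1 E) / 2"
  have "2 * s = - a1 E" unfolding s_def by simp
  moreover have "3 * r = s^2 + s * a1 E - a2 E" unfolding r_def by simp
  moreover have "2 * t = - (a3 E + r * a1 E)" unfolding t_def by (simp only: times_divide_eq_right nonzero_mult_div_cancel_left zero_neq_numeral[symmetric] simp_thms)
  ultimately have "a1 E + 2 * s = 0" "a2 E - s * a1 E + 3 * r - s^2 = 0" "a3 E + r * a1 E + 2 * t = 0"
    by simp_all
  then have "a1 (change_coords 1 r s t E) = 0" "a2 (change_coords 1 r s t E) = 0" "a3 (change_coords 1 r s t E) = 0"
    unfolding change_coords_sel by simp_all
  then show ?thesis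
    by (intro that[of r s t "a4 (change_coords 1 r s t E)" "a6 (change_coords 1 r s t E)"])
      (metis weierstrass.collapse)
qed

lemma change_coords_scale:
  assumes "u \<noteq> 0"
  shows "change_coords u 0 0 0 (change_coords 1 r s t E) = change_coords u r s t E"
  using assms by (simp add: change_coords_def)

lemma base_change_change_coords:
  "(base_change (change_coords u r s t E) :: 'k::field_char_0 weierstrass) =
    change_coords (of_rat u) (of_rat r) (of_rat s) (of_rat t) (base_change E)"
  by (cases E) (simp add: base_change_def change_coords_def of_rat_add of_rat_diff of_rat_mult
      of_rat_divide of_rat_power)

lemma c4_discriminant_short_form:
  fixes E :: "'a::field weierstrass"
  assumes "change_coords 1 r s t E = Weierstrass 0 0 0 A B"
  shows "c4 E = - 48 * A" "discriminant E = - 16 * (4 * A^3 + 27 * B^2)"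
proof -
  have eqs: "a1 E + 2 * s = 0" "a2 E - s * a1 E + 3 * r - s^2 = 0" "a3 E + r * a1 E + 2 * t = 0"
    "a4 E - s * a3 E + 2 * r * a2 E - (t + r * s) * a1 E + 3 * r^2 - 2 * s * t = A"
    "a6 E + r * a4 E + r^2 * a2 E + r^3 - t * a3 E - t^2 - r * t * a1 E = B"
    using assms by (simp_all add: change_coords_def)
  have 1: "a1 E = - 2 * s" using eqs(1) by algebra
  have 2: "a2 E = s * a1 E - 3 * r + s^2" using eqs(2) by algebra
  have 3: "a3 E = - r * a1 E - 2 * t" using eqs(3) by algebra
  have 4: "a4 E = A + s * a3 E - 2 * r * a2 E + (t + r * s) * a1 E - 3 * r^2 + 2 * s * t"
    unfolding eqs(4)[symmetric] by algebra
  have 6: "a6 E = B - r * a4 E - r^2 * a2 E - r^3 + t * a3 E + t^2 + r * t * a1 E"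
    unfolding eqs(5)[symmetric] by algebra
  have b: "b2 E = - 12 * r" "b4 E = 2 * A + 6 * r^2" "b6 E = 4 * B - 4 * r * A - 4 * r^3"
    "b8 E = - 12 * r * B - A^2 + 6 * r^2 * A + 3 * r^4"
    unfolding b2_def b4_def b6_def b8_def 6 4 3 2 1 by algebra+
  show "c4 E = - 48 * A" unfolding c4_def b by algebra
  show "discriminant E = - 16 * (4 * A^3 + 27 * B^2)" unfolding discriminant_def b by algebra
qed

lemma cubic_with_distinct_roots:
  fixes A B :: "'a::field"
  assumes ne: "e1 \<noteq> e2" "e2 \<noteq> e3" "e3 \<noteq> e1"
    and roots: "e1^3 + A * e1 + B = 0" "e2^3 + A * e2 + B = 0" "e3^3 + A * e3 + B = 0"
  shows "e1 + e2 + e3 = 0" "A = e1 * e2 + e1 * e3 + e2 * e3" "B = - (e1 * e2 * e3)"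
proof -
  have quot: "x^2 + x * y + y^2 + A = 0" if "x^3 + A * x + B = 0" "y^3 + A * y + B = 0" "x \<noteq> y" for x y
  proof -
    have "(x - y) * (x^2 + x * y + y^2 + A) = (x^3 + A * x + B) - (y^3 + A * y + B)" by algebra
    also have "\<dots> = 0" unfolding that(1,2) by simp
    finally show ?thesis using that(3) by simp
  qed
  have 12: "e1^2 + e1 * e2 + e2^2 + A = 0" by (rule quot[OF roots(1,2) ne(1)])
  have 13: "e1^2 + e1 * e3 + e3^2 + A = 0" by (rule quot[OF roots(1,3) ne(3)[symmetric]])
  have "(e2 - e3) * (e1 + e2 + e3) = (e1^2 + e1 * e2 + e2^2 + A) - (e1^2 + e1 * e3 + e3^2 + A)" by algebra
  also have "\<dots> = 0" unfolding 12 13 by simp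
  finally show sum: "e1 + e2 + e3 = 0" using ne(2) by simp
  then have e3: "e3 = - e1 - e2" by algebra
  have "A = - (e1^2 + e1 * e2 + e2^2)" using 12 by algebra
  then show A: "A = e1 * e2 + e1 * e3 + e2 * e3" unfolding e3 by algebra
  have "B = - (e1^3 + A * e1)" using roots(1) by algebra
  then show "B = - (e1 * e2 * e3)" unfolding A e3 by algebra
qed

text \<open>The square root of \<open>- 1\<close> is the quotient of square roots of \<open>e2 - e1\<close> and \<open>e1 - e2\<close>.\<close>

theorem short_form_classification:
  fixes A B :: rat
  assumes degree: "degree_over_rat TYPE('k::field_char_0) = 6"
    and iso: "torsion_subgroup (point_group (Weierstrass 0 0 0 (of_rat A) (of_rat B) :: 'k weierstrass)) \<cong>
      integer_mod_group 4 \<times>\<times> integer_mod_group 12"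
  obtains u where "u \<noteq> 0" "A = 69 * u^4" "B = 22 * u^6 \<or> B = - 22 * u^6"
proof -
  define E :: "'k weierstrass" where "E = Weierstrass 0 0 0 (of_rat A) (of_rat B)"
  obtain P1 P2 P3 where P: "P1 \<in> points E" "P2 \<in> points E" "P3 \<in> points E"
    and dist: "distinct [Infinity, point_add E P1 P1, point_add E P2 P2, point_add E P3 P3]"
    and order4: "\<forall>P\<in>{P1, P2, P3}. point_add E (point_add E P P) (point_add E P P) = Infinity"
    and ex3: "\<exists>P\<in>points E. P \<noteq> Infinity \<and> point_add E P P = point_neg P"
    and uniq3: "\<forall>P\<in>points E. \<forall>Q\<in>points E. P \<noteq> Infinity \<longrightarrow> Q \<noteq> Infinity \<longrightarrow>
      point_add E P P = point_neg P \<longrightarrow> point_add E Q Q = point_neg Q \<longrightarrow> Q = P \<or> Q = point_neg P"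
    by (rule torsion_four_twelve[OF iso, folded E_def])
  have half: "\<exists>x y e. P = Affine x y \<and> point_add E P P = Affine e 0 \<and> e^3 + of_rat A * e + of_rat B = 0"
    if PE: "P \<in> points E" and nz: "point_add E P P \<noteq> Infinity"
      and two: "point_add E (point_add E P P) (point_add E P P) = Infinity" for P
  proof -
    obtain x y where xy: "P = Affine x y" using nz by (cases P) auto
    obtain e v where ev: "point_add E P P = Affine e v" using nz by (cases "point_add E P P") auto
    have "v + v = 0" using two unfolding ev by (simp add: E_def Let_def split: if_splits)
    then have v: "v = 0" by (simp add: mult_2[symmetric])
    have "Affine e v \<in> points E" using point_add_closed[OF PE PE] unfolding ev .
    then have ev0: "weierstrass_eval E e 0 = 0" unfolding v by simp
    have "e^3 + of_rat A * e + of_rat B = - weierstrass_eval E e 0"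
      unfolding E_def weierstrass_eval_def weierstrass.sel by simp
    then have "e^3 + of_rat A * e + of_rat B = 0" unfolding ev0 by (simp only: minus_zero)
    then show ?thesis using xy ev v by blast
  qed
  obtain x1 y1 e1 where 1: "P1 = Affine x1 y1" "point_add E P1 P1 = Affine e1 0" "e1^3 + of_rat A * e1 + of_rat B = 0"
    using half[OF P(1)] dist order4 by auto
  obtain x2 y2 e2 where 2: "P2 = Affine x2 y2" "point_add E P2 P2 = Affine e2 0" "e2^3 + of_rat A * e2 + of_rat B = 0"
    using half[OF P(2)] dist order4 by auto
  obtain x3 y3 e3 where 3: "P3 = Affine x3 y3" "point_add E P3 P3 = Affine e3 0" "e3^3 + of_rat A * e3 + of_rat B = 0"
    using half[OF P(3)] dist order4 by auto
  have ne: "e1 \<noteq> e2" "e2 \<noteq> e3" "e3 \<noteq> e1" using dist unfolding 1(2) 2(2) 3(2) by auto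
  note cubic = cubic_with_distinct_roots[OF ne 1(3) 2(3) 3(3)]
  note sum = cubic(1) and AK = cubic(2) and BK = cubic(3)
  have d1: "\<exists>z. z^2 = e1 - e2"
    by (rule difference_of_roots_is_square[OF sum AK BK
        P(1)[unfolded 1(1) E_def] 1(2)[unfolded 1(1) E_def]])
  have d2: "\<exists>z. z^2 = e2 - e3"
  proof (rule difference_of_roots_is_square)
    show "e2 + e3 + e1 = 0" using sum by algebra
    show "of_rat A = e2 * e3 + e2 * e1 + e3 * e1" using AK by algebra
    show "of_rat B = - (e2 * e3 * e1)" using BK by algebra
  qed (rule P(2)[unfolded 2(1) E_def] 2(2)[unfolded 2(1) E_def])+
  have d3: "\<exists>z. z^2 = e3 - e1"
  proof (rule difference_of_roots_is_square)
    show "e3 + e1 + e2 = 0" using sum by algebra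
    show "of_rat A = e3 * e1 + e3 * e2 + e1 * e2" using AK by algebra
    show "of_rat B = - (e3 * e1 * e2)" using BK by algebra
  qed (rule P(3)[unfolded 3(1) E_def] 3(2)[unfolded 3(1) E_def])+
  have d4: "\<exists>z. z^2 = e2 - e1"
  proof (rule difference_of_roots_is_square)
    show "e2 + e1 + e3 = 0" using sum by algebra
    show "of_rat A = e2 * e1 + e2 * e3 + e1 * e3" using AK by algebra
    show "of_rat B = - (e2 * e1 * e3)" using BK by algebra
  qed (rule P(2)[unfolded 2(1) E_def] 2(2)[unfolded 2(1) E_def])+
  from d1 d2 d3 d4 obtain z1 z2 z3 z4 where z: "z1^2 = e1 - e2" "z2^2 = e2 - e3" "z3^2 = e3 - e1"
    and z4: "z4^2 = e2 - e1" by blast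
  have "e1 - e2 \<noteq> 0" using ne by simp
  then have "(e1 - e2) / (e1 - e2) = 1" by (rule divide_self)
  moreover have "e2 - e1 = - (e1 - e2)" by algebra
  ultimately have i: "(z4 / z1)^2 = - 1"
    unfolding power_divide z(1) z4 by (simp only: divide_minus_left)
  interpret gaussian_sextic_field "z4 / z1" by unfold_locales (fact i degree)+
  obtain Q where Q: "Q \<in> points E" "Q \<noteq> Infinity" "point_add E Q Q = point_neg Q" using ex3 by blast
  obtain x0 y0 where Q0: "Q = Affine x0 y0" using Q(2) by (cases Q) auto
  have order3: "Affine x y \<in> points E \<longleftrightarrow> y^2 = x^3 + of_rat A * x + of_rat B"
    and flex: "y^2 = x^3 + of_rat A * x + of_rat B \<Longrightarrow>
      point_add E (Affine x y) (Affine x y) = point_neg (Affine x y) \<longleftrightarrow>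
      y \<noteq> 0 \<and> 3 * x^4 + 6 * of_rat A * x^2 + 12 * of_rat B * x - (of_rat A)^2 = 0" for x y
  proof -
    show *: "Affine x y \<in> points E \<longleftrightarrow> y^2 = x^3 + of_rat A * x + of_rat B"
      by (simp add: E_def weierstrass_eval_def)
    show "y^2 = x^3 + of_rat A * x + of_rat B \<Longrightarrow>
      point_add E (Affine x y) (Affine x y) = point_neg (Affine x y) \<longleftrightarrow>
      y \<noteq> 0 \<and> 3 * x^4 + 6 * of_rat A * x^2 + 12 * of_rat B * x - (of_rat A)^2 = 0"
      unfolding *[symmetric] point_neg_simps E_def by (rule order_three_abscissa)
  qed
  have curve: "y0^2 = x0^3 + of_rat A * x0 + of_rat B" using Q(1) unfolding Q0 order3 .
  have y0: "y0 \<noteq> 0" and psi: "3 * x0^4 + 6 * of_rat A * x0^2 + 12 * of_rat B * x0 - (of_rat A)^2 = 0"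
    using Q(3) unfolding Q0 flex[OF curve] by blast+
  have unique: "x = x0" if c: "y^2 = x^3 + of_rat A * x + of_rat B"
    and p: "3 * x^4 + 6 * of_rat A * x^2 + 12 * of_rat B * x - (of_rat A)^2 = 0" for x y :: 'k
  proof -
    have "y \<noteq> 0"
    proof
      \<comment> \<open>The division polynomial is \<open>12 x f - f'\<^sup>2\<close>, so it has no root in common with \<open>f\<close>.\<close>
      assume "y = 0"
      then have f: "x^3 + of_rat A * x + of_rat B = 0" using c by simp
      have "(3 * x^2 + of_rat A)^2 = 12 * x * (x^3 + of_rat A * x + of_rat B)
          - (3 * x^4 + 6 * of_rat A * x^2 + 12 * of_rat B * x - (of_rat A)^2)" by algebra
      also have "\<dots> = 0" unfolding f p by simp
      finally have "3 * x^2 + of_rat A = 0" by simp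
      then have A': "of_rat A = - 3 * x^2" by algebra
      then have B': "of_rat B = 2 * x^3" using f by algebra
      have e3: "e3 = - e1 - e2" using sum by algebra
      have "((e1 - e2) * (e2 - e3) * (e3 - e1))^2 = - 4 * (of_rat A)^3 - 27 * (of_rat B)^2"
        unfolding AK BK e3 by algebra
      also have "\<dots> = 0" unfolding A' B' by algebra
      finally show False using ne by simp
    qed
    then have "point_add E (Affine x y) (Affine x y) = point_neg (Affine x y)" using flex[OF c] p by blast
    moreover have "Affine x y \<in> points E" unfolding order3 by (rule c)
    ultimately have "Affine x y = Q \<or> Affine x y = point_neg Q" using uniq3 Q point.distinct(1) by metis
    then show ?thesis unfolding Q0 by auto
  qed
  show ?thesis
  proof (rule classification[OF ne sum AK BK z y0 curve psi])
    show "x = x0" if "y^2 = x^3 + of_rat A * x + of_rat B"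
      "3 * x^4 + 6 * of_rat A * x^2 + 12 * of_rat B * x - (of_rat A)^2 = 0" for x y
      by (rule unique[OF that])
  qed (rule that)
qed

theorem theorem5p1:
  fixes E :: "rat weierstrass"
  assumes "elliptic_curve E"
    and "degree_over_rat TYPE('k::field_char_0) = 6"
    and "torsion_subgroup (point_group (base_change E :: 'k weierstrass)) \<cong>
           integer_mod_group 4 \<times>\<times> integer_mod_group 12"
  shows "(isomorphic_curves E curve_162d2 \<or> isomorphic_curves E curve_1296l2) \<and>
         j_invariant E = 109503 / 64"
proof -
  obtain r s t A B where short: "change_coords 1 r s t E = Weierstrass 0 0 0 A B"
    by (rule short_weierstrass_form)
  have "(Weierstrass 0 0 0 (of_rat A) (of_rat B) :: 'k weierstrass) =
      change_coords 1 (of_rat r) (of_rat s) (of_rat t) (base_change E)"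
    using base_change_change_coords[of 1 r s t E, where 'k = 'k] unfolding short by (simp add: base_change_def)
  then have "torsion_subgroup (point_group (Weierstrass 0 0 0 (of_rat A) (of_rat B) :: 'k weierstrass)) \<cong>
      torsion_subgroup (point_group (base_change E :: 'k weierstrass))"
    using torsion_subgroup_change_coords_iso[of "1 :: 'k"] by simp
  from iso_trans[OF this assms(3)]
  obtain u where u: "u \<noteq> 0" "A = 69 * u^4" "B = 22 * u^6 \<or> B = - 22 * u^6"
    by (rule short_form_classification[OF assms(2)])
  have iso: "change_coords u r s t E = Weierstrass 0 0 0 (A / u^4) (B / u^6)"
    unfolding change_coords_scale[OF u(1), of r s t E, symmetric] short by (simp add: change_coords_def)
  have "A / u^4 = 69" "B / u^6 = 22 \<or> B / u^6 = - 22" using u by auto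
  then have "change_coords u r s t E = curve_162d2 \<or> change_coords u r s t E = curve_1296l2"
    unfolding iso curve_162d2_def curve_1296l2_def by auto
  then have "isomorphic_curves E curve_162d2 \<or> isomorphic_curves E curve_1296l2"
    unfolding isomorphic_curves_def using u(1) by metis
  moreover have "j_invariant E = 109503 / 64"
  proof -
    have B2: "B^2 = 484 * u^12" using u(3) by auto
    have "(c4 E)^3 = - (110592 * 328509 * u^12)"
      unfolding c4_discriminant_short_form(1)[OF short] u(2) by algebra
    moreover have "discriminant E = - (16 * 1327104 * u^12)"
      unfolding c4_discriminant_short_form(2)[OF short] B2 u(2) by algebra
    ultimately show ?thesis using u(1) unfolding j_invariant_def by simp
  qed
  ultimately show ?thesis by blast
qed

end
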